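(* For every $d\ge 1$ and every partition $\alpha\vdash d$, writing $\ell=\ell(\alpha)$, the genus one monotone single Hurwitz number $\vec H_1(\alpha)$ is given by $$\frac{|\mathrm{Aut}\,\alpha|}{d!}\vec H_1(\alpha)=\frac{1}{24}\prod_{i=1}^{\ell}\binom{2\alpha_i}{\alpha_i}\left((2d+1)^{\overline{\ell}}-3(2d+1)^{\overline{\ell-1}}-\sum_{k=2}^{\ell}(k-2)!\,(2d+1)^{\overline{\ell-k}}\,e_k(2\alpha+1)\right),$$ where $e_k(2\alpha+1)$ is the $k$th elementary symmetric polynomial evaluated at $2\alpha_i+1$, $1\le i\le\ell$.
   Context: For a partition $\alpha$ of $d\ge 1$ with $\ell(\alpha)$ parts and an integer $g\ge 0$, $\vec H_g(\alpha)$ is the number of $(r+1)$-tuples $(\sigma,\tau_1,\dots,\tau_r)$ of permutations in the symmetric group on $\{1,\dots,d\}$, with $r=2g-2+\ell(\alpha)+d$, such that: $\sigma$ has cycle type $\alpha$ and the $\tau_i$ are transpositions; $\sigma\tau_1\cdots\tau_r$ is the identity; the group $\langle\sigma,\tau_1,\dots,\tau_r\rangle$ acts transitively on $\{1,\dots,d\}$; and, writing $\tau_i=(s_i\ t_i)$ with $s_i<t_i$, one has $t_1\le\dots\le t_r$. $|\mathrm{Aut}\,\alpha|=\prod_{k\ge1}m_k!$ where $m_k$ is the number of parts of $\alpha$ equal to $k$. For $k\ge 0$, $(2d+1)^{\overline{k}}=(2d+1)(2d+2)\cdots(2d+k)$ is a rising product with $k$ factors (equal to $1$ for $k=0$). 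*)

theory Defs
  imports
    Complex_Main
    "HOL-Library.Multiset"
    "HOL-Combinatorics.Combinatorics"
    "HOL-Algebra.Sym_Groups"
begin

definition is_partition :: "nat \<Rightarrow> nat list \<Rightarrow> bool" where
  "is_partition d \<alpha> \<longleftrightarrow> sorted_wrt (\<ge>) \<alpha> \<and> (\<forall>a\<in>set \<alpha>. a > 0) \<and> sum_list \<alpha> = d"

definition aut_size :: "nat list \<Rightarrow> nat" where
  "aut_size \<alpha> = (\<Prod>k\<in>set \<alpha>. fact (count_list \<alpha> k))"

text \<open>The sum ranges over sets of positions, so repeated entries of the list count as distinct variables.\<close>

definition elem_sym :: "nat \<Rightarrow> 'a::comm_semiring_1 list \<Rightarrow> 'a" where
  "elem_sym k xs = (\<Sum>S | S \<subseteq> {..<length xs} \<and> card S = k. \<Prod>i\<in>S. xs ! i)"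

text \<open>
  Cycle lengths of a permutation of \<open>{1..d}\<close>, fixed points included. The name is qualified since
  the theory of group actions also defines an \<open>orbit\<close>.
\<close>

definition cycle_type :: "nat \<Rightarrow> (nat \<Rightarrow> nat) \<Rightarrow> nat multiset" where
  "cycle_type d \<sigma> = image_mset card (mset_set (Orbits.orbit \<sigma> ` {1..d}))"

definition transitive_on :: "'a set \<Rightarrow> ('a \<Rightarrow> 'a) set \<Rightarrow> bool" where
  "transitive_on X G \<longleftrightarrow> (\<forall>x\<in>X. \<forall>y\<in>X. \<exists>g\<in>G. g x = y)"

definition monotone_transpositions :: "nat \<Rightarrow> (nat \<Rightarrow> nat) list \<Rightarrow> bool" where
  "monotone_transpositions d \<tau>s \<longleftrightarrow>
     (\<exists>ss ts. length ss = length \<tau>s \<and> length ts = length \<tau>s \<and>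
        (\<forall>i<length \<tau>s. ss ! i \<in> {1..d} \<and> ts ! i \<in> {1..d} \<and> ss ! i < ts ! i \<and>
            \<tau>s ! i = transpose (ss ! i) (ts ! i)) \<and>
        sorted ts)"

text \<open>
  Products of permutations are composed from right to left. Composing from left to right instead
  gives the same count, by the bijection replacing \<open>\<sigma>\<close> with its inverse. The subtraction of 2
  does not truncate for nonempty \<open>\<alpha>\<close> with positive parts.
\<close>

definition monotone_factorizations ::
    "nat \<Rightarrow> nat list \<Rightarrow> ((nat \<Rightarrow> nat) \<times> (nat \<Rightarrow> nat) list) set" where
  "monotone_factorizations g \<alpha> =
     (let d = sum_list \<alpha>; r = 2 * g + length \<alpha> + d - 2 in
      {(\<sigma>, \<tau>s). \<sigma> permutes {1..d} \<and> cycle_type d \<sigma> = mset \<alpha> \<and>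
         length \<tau>s = r \<and> monotone_transpositions d \<tau>s \<and>
         \<sigma> \<circ> foldr (\<circ>) \<tau>s id = id \<and>
         transitive_on {1..d} (generate (sym_group d) (insert \<sigma> (set \<tau>s)))})"

definition monotone_hurwitz :: "nat \<Rightarrow> nat list \<Rightarrow> nat" where
  "monotone_hurwitz g \<alpha> = card (monotone_factorizations g \<alpha>)"

end

theory Submission
  imports Defs "HOL-Computational_Algebra.Formal_Power_Series" "HOL-Computational_Algebra.Polynomial"
begin

text \<open>
  In a transitive monotone factorization of length at least one the last transposition moves the
  largest point \<open>t\<close>. Removing it either joins the cycle of \<open>t\<close> with another cycle, or cuts it, in
  which case the remaining factorization is transitive or decomposes into two transitive ones whose
  interleaving is determined by monotonicity. The number of factorizations of a fixed permutation
  therefore satisfies a recursion on the cycle type, and it suffices to check that the closed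
  formulas for genus zero (which is needed for the cut terms) and genus one satisfy the same
  recursion for every choice of the distinguished cycle.

  For this check the distinguished part is encoded by a power series variable, and the set of the
  other parts by a square-free variable for each part, that is, by the algebra of set functions
  under subset convolution. There the products \<open>c (2D + c + 1) (2D + c + 2) \<dots> (2D + c + n - 1)\<close>,
  for a set of \<open>n\<close> parts with sum \<open>D\<close>, are the powers \<open>\<tau>\<^bsup>-c\<^esup>\<close> of a single element (Lagrange
  inversion), and both formulas become polynomial expressions over power series in
  \<open>V = (1 - 4X)\<^bsup>-1/2\<^esup>\<close>. The recursion then reduces to identities between power series in one
  variable, which follow from first order differential equations.
\<close>

section \<open>Power series in the central binomial coefficients\<close>

unbundle fps_syntax

text \<open>Joining replaces the distinguished size \<open>m\<close> by \<open>m + a i\<close>, so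
  the shift depends on the part that is absorbed. Rescaling \<open>X\<close> by
  \<open>\<tau>\<^sup>2\<close> adapts the series to all these shifts at once: a shift by
  \<open>a i\<close> then costs a factor \<open>\<tau>\<close> to the power
  \<open>- 2 * a i\<close>, which merges with the square-free variable of \<open>i\<close> into one
  element \<open>eh i\<close>, and \<open>\<tau>\<close> itself is 1 minus the sum of the
  \<open>eh i\<close>. The genus zero equation becomes quadratic in the \<open>eh i\<close>, with
  power series in \<open>X\<close> alone as coefficients, and splits into one identity for each
  degree 0, 1, 2. The genus one equation is its linearization with a source term, which comes from
  the cuts that lower the genus. Here the denominator \<open>1 - \<kappa>\<close> appears, where
  \<open>\<kappa>\<close> is the sum of the \<open>eh i\<close> with coefficients
  \<open>2 * a i + 1\<close>. The \<open>k\<close>-th power of a sum of square-zero variables is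
  \<open>k!\<close> times their \<open>k\<close>-th elementary symmetric polynomial; this is the
  origin of the factorials and elementary symmetric polynomials in the genus one formula.\<close>

definition cbin :: "nat \<Rightarrow> real" where
  "cbin m = real ((2 * m) choose m)"

definition wt :: "nat \<Rightarrow> real" where
  "wt m = real m * cbin m"

lemma cbin_0 [simp]: "cbin 0 = 1"
  by (simp add: cbin_def)

lemma cbin_pos [simp]: "cbin m > 0"
  by (simp add: cbin_def)

lemma cbin_ne_0 [simp]: "cbin m \<noteq> 0"
  using cbin_pos[of m] by linarith

lemma wt_0 [simp]: "wt 0 = 0"
  by (simp add: wt_def)

lemma wt_pos: "m > 0 \<Longrightarrow> wt m > 0"
  by (simp add: wt_def)

lemma cbin_Suc: "real (Suc m) * cbin (Suc m) = (4 * real m + 2) * cbin m"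
proof -
  have 1: "Suc m * ((2 * m + 2) choose Suc m) = (2 * m + 2) * ((2 * m + 1) choose m)"
    using Suc_times_binomial_eq[of "2 * m + 1" m] by (simp add: mult.commute)
  have 2: "Suc m * ((2 * m + 1) choose m) = (2 * m + 1) * ((2 * m) choose m)"
  proof -
    have "(2 * m + 1) choose m = (2 * m + 1) choose (Suc m)"
      using binomial_symmetric[of m "2 * m + 1"] by simp
    then show ?thesis
      using Suc_times_binomial_eq[of "2 * m" m] by (simp add: mult.commute)
  qed
  have "Suc m * (Suc m * ((2 * m + 2) choose Suc m)) = 2 * Suc m * (Suc m * ((2 * m + 1) choose m))"
    unfolding 1 by simp
  also have "\<dots> = Suc m * ((4 * m + 2) * ((2 * m) choose m))"
    unfolding 2 by (simp add: algebra_simps)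
  finally have "Suc m * ((2 * m + 2) choose Suc m) = (4 * m + 2) * ((2 * m) choose m)"
    by (simp only: Suc_mult_cancel1)
  then have "real (Suc m * ((2 * m + 2) choose Suc m)) = real ((4 * m + 2) * ((2 * m) choose m))"
    by (simp only:)
  moreover have "2 * Suc m = 2 * m + 2" by simp
  ultimately show ?thesis
    unfolding cbin_def of_nat_mult by (simp del: binomial_Suc_Suc)
qed

definition V :: "real fps" where "V = Abs_fps cbin"

definition U :: "real fps" where "U = inverse V"

text \<open>The generating function of the Catalan numbers, shifted by one: these are the genus zero numbers of
  a single cycle.\<close>

definition cat :: "real fps" where "cat = fps_const (1/2) * (1 - U)"

text \<open>Apart from the factor \<open>wt a\<close>, the coefficients are the genus zero numbers of cycle type \<open>(m, a)\<close>.\<close>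

definition pairing :: "nat \<Rightarrow> real fps" where
  "pairing a = Abs_fps (\<lambda>m. wt m / (2 * (real m + real a)))"

text \<open>The effect of joining a cycle of length \<open>a\<close> to the distinguished one, when the weights \<open>wt\<close> of
  the other cycles have been divided out.\<close>

definition joined :: "nat \<Rightarrow> real fps \<Rightarrow> real fps" where
  "joined a f = Abs_fps (\<lambda>m. if m = 0 then 0 else real a / wt a * f $ (m + a))"

text \<open>Subtracting the multiple of \<open>V - U\<close> eliminates \<open>\<tau>\<close> in favour of the elements \<open>eh i\<close>.\<close>

definition spairing :: "nat \<Rightarrow> real fps" where
  "spairing a = pairing a - fps_const (1/2) * (V - U)"

abbreviation D :: "real fps \<Rightarrow> real fps" where "D \<equiv> fps_XD"

lemma V_nth [simp]: "V $ m = cbin m"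
  by (simp add: V_def)

lemma VU: "V * U = 1"
  unfolding U_def by (simp add: inverse_mult_eq_1')

lemma joined_add: "joined a (f + g) = joined a f + joined a g"
  and joined_diff: "joined a (f - g) = joined a f - joined a g"
  and joined_const: "joined a (fps_const c * f) = fps_const c * joined a f"
  by (auto simp: joined_def fps_eq_iff algebra_simps)

section \<open>The Euler operator and the differential equations of \<open>V\<close>\<close>

lemma D_mult: "D (f * g) = D f * g + f * D g"
  by (simp add: fps_XD_def algebra_simps)

lemma D_diff: "D (f - g) = D f - D g"
  by (simp add: fps_XD_def algebra_simps)

lemma D_const [simp]: "D (fps_const c) = 0" "D 1 = 0" "D (numeral n) = 0"
  by (simp_all add: fps_XD_def)

lemma D_X [simp]: "D fps_X = fps_X"
  by (simp add: fps_XD_def)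

lemma half_fps: "fps_const (1/2) * (2 :: real fps) = 1"
  by (simp add: numeral_fps_const)

lemma fps_X_numeral_mult_nth:
  "(numeral w * fps_X * f) $ Suc k = numeral w * (f :: real fps) $ k"
  "(numeral w * fps_X * f) $ 0 = 0"
  by (simp_all add: mult.assoc numeral_fps_const)

lemma one_minus_4X_mult_nth:
  "((1 - 4 * fps_X) * f) $ Suc k = (f :: real fps) $ Suc k - 4 * f $ k"
  "((1 - 4 * fps_X) * f) $ 0 = f $ 0"
  by (simp_all only: left_diff_distrib mult_1_left fps_sub_nth fps_X_numeral_mult_nth diff_zero)

lemma D_V: "(1 - 4 * fps_X) * D V = 2 * fps_X * V"
proof (rule fps_ext)
  fix n
  show "((1 - 4 * fps_X) * D V) $ n = (2 * fps_X * V) $ n"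
  proof (cases n)
    case (Suc k)
    have "real (Suc k) * cbin (Suc k) - 4 * (real k * cbin k) = 2 * cbin k"
      unfolding cbin_Suc by (simp add: algebra_simps)
    then show ?thesis
      unfolding Suc one_minus_4X_mult_nth fps_X_numeral_mult_nth fps_XD_nth V_nth by simp
  qed (simp add: one_minus_4X_mult_nth fps_X_numeral_mult_nth)
qed

text \<open>The Euler operator annihilates the difference of the two sides, and the constant terms
  agree. This identifies \<open>V\<close> as the inverse square root of
  \<open>1 - 4X\<close>.\<close>

lemma V_sq: "(1 - 4 * fps_X) * V\<^sup>2 = 1"
proof -
  let ?y = "(1 - 4 * fps_X) * V\<^sup>2 - 1"
  have "D ?y = 2 * V * ((1 - 4 * fps_X) * D V) - 4 * fps_X * V\<^sup>2"
    by (simp add: D_mult D_diff power2_eq_square algebra_simps)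
  also have "\<dots> = 0"
    unfolding D_V by (simp add: power2_eq_square algebra_simps)
  finally have "D ?y = 0" .
  then have "\<And>n. real n * ?y $ n = 0"
    by (metis fps_XD_nth fps_zero_nth)
  moreover have "?y $ 0 = 0"
    by (simp add: algebra_simps power2_eq_square numeral_fps_const)
  ultimately have "?y = 0"
    by (metis fps_ext fps_zero_nth mult_eq_0_iff of_nat_eq_0_iff)
  then show ?thesis by simp
qed

abbreviation disc :: "real fps" where "disc \<equiv> V\<^sup>2 - 1"

lemma V_sq_minus_one: "V\<^sup>2 - 1 = 4 * fps_X * V\<^sup>2"
proof -
  have "V\<^sup>2 - 1 = V\<^sup>2 - (1 - 4 * fps_X) * V\<^sup>2" unfolding V_sq ..
  then show ?thesis by (simp add: left_diff_distrib)
qed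

text \<open>Eliminates the denominator \<open>1 - 4X\<close>, so that all derivatives of
  \<open>V\<close> are polynomials in \<open>V\<close>.\<close>

lemma D_V': "2 * D V = V * disc"
proof -
  have "D V = (1 - 4 * fps_X) * V\<^sup>2 * D V" by (simp add: V_sq)
  also have "\<dots> = V\<^sup>2 * ((1 - 4 * fps_X) * D V)" by (simp add: algebra_simps)
  also have "\<dots> = 2 * fps_X * V ^ 3" unfolding D_V by (simp add: power2_eq_square power3_eq_cube algebra_simps)
  finally show ?thesis unfolding V_sq_minus_one by (simp add: power2_eq_square power3_eq_cube algebra_simps)
qed

lemma D_V_nth: "D V $ m = wt m"
  by (simp add: wt_def)

text \<open>The uniqueness principle behind the one-variable identities: \<open>D + c\<close>
  multiplies the \<open>n\<close>-th coefficient by \<open>n + c\<close>, hence is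
  injective.\<close>

lemma D_eq_0:
  assumes "D y + fps_const c * y = 0" "\<And>n. real n + c \<noteq> 0"
  shows "y = 0"
proof (rule fps_ext)
  fix n
  have "(D y + fps_const c * y) $ n = 0" using assms(1) by simp
  then have "(real n + c) * y $ n = 0" by (simp add: algebra_simps)
  then show "y $ n = 0 $ n" using assms(2)[of n] by simp
qed

text \<open>The operator \<open>D + a\<close> cancels exactly the denominators \<open>m + a\<close>
  of the pairing series.\<close>

lemma D_pairing:
  assumes "a > 0"
  shows "2 * (D (pairing a) + fps_const (real a) * pairing a) = D V"
proof (rule fps_ext)
  fix n
  have "real n + real a \<noteq> 0" using assms by linarith
  then show "(2 * (D (pairing a) + fps_const (real a) * pairing a)) $ n = D V $ n"
    by (simp add: numeral_fps_const pairing_def wt_def divide_simps) (simp add: algebra_simps)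
qed

text \<open>The coefficient at \<open>m\<close> was shifted down from \<open>m + a\<close>, and
  \<open>D + a\<close> multiplies it by this original exponent.\<close>

lemma D_joined:
  "D (joined a f) + fps_const (real a) * joined a f = joined a (D f)"
  by (rule fps_ext) (auto simp: joined_def algebra_simps)

text \<open>Shifting coefficients by \<open>a\<close> loses regularity in \<open>V\<close>, but the pairing series compensates
  exactly: both sides satisfy the same first order differential equation.\<close>

lemma joined_V:
  assumes a: "a > 0"
  shows "joined a V + 2 * pairing a * V = V\<^sup>2 - 1"
proof -
  let ?A = "fps_const (real a)"
  \<comment> \<open>Adding 1 restores the coefficient at 0 that \<open>joined\<close> drops; it is 1
    because \<open>real a / wt a\<close> equals \<open>1 / cbin a\<close>. The formula for the
    coefficients of \<open>h\<close> then has no exception.\<close>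
  define h where "h = joined a V + 1"
  define y where "y = h + 2 * pairing a * V - V\<^sup>2"
  have h_nth: "h $ n = cbin (n + a) / cbin a" for n
    using a wt_pos[OF a] by (auto simp: h_def joined_def wt_def)
  have h: "(1 - 4 * fps_X) * (D h + ?A * h) = ?A + 2 * fps_X * h"
  proof (rule fps_ext)
    fix n
    show "((1 - 4 * fps_X) * (D h + ?A * h)) $ n = (?A + 2 * fps_X * h) $ n"
    proof (cases n)
      case 0
      then show ?thesis
        by (simp add: one_minus_4X_mult_nth fps_X_numeral_mult_nth h_nth)
    next
      case (Suc k)
      have "(real (k + a) + 1) * cbin (Suc (k + a)) = (4 * real (k + a) + 2) * cbin (k + a)"
        using cbin_Suc[of "k + a"] by (simp add: algebra_simps)
      then have "(real k + 1 + real a) * h $ Suc k = (4 * real k + 4 * real a + 2) * h $ k"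
        by (simp add: h_nth field_simps)
      then show ?thesis
        unfolding Suc fps_add_nth one_minus_4X_mult_nth fps_X_numeral_mult_nth
        by (simp add: algebra_simps)
    qed
  qed
  note g = D_pairing[OF a]
  have "(1 - 4 * fps_X) * (D y + ?A * y) - 2 * fps_X * y
      = ((1 - 4 * fps_X) * (D h + ?A * h) - 2 * fps_X * h)
        + V * ((1 - 4 * fps_X) * (2 * (D (pairing a) + ?A * pairing a)))
        + 2 * pairing a * ((1 - 4 * fps_X) * D V)
        - 2 * V * ((1 - 4 * fps_X) * D V) - ?A * ((1 - 4 * fps_X) * V\<^sup>2)
        - 4 * fps_X * pairing a * V + 2 * fps_X * V\<^sup>2"
    unfolding y_def by (simp add: D_mult D_diff power2_eq_square algebra_simps)
  also have "\<dots> = 0"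
    unfolding h g D_V V_sq by (simp add: power2_eq_square algebra_simps)
  finally have y: "(1 - 4 * fps_X) * (D y + ?A * y) = 2 * fps_X * y" by simp
  \<comment> \<open>The right-hand side carries a factor \<open>X\<close>, so each coefficient is
    determined by the previous one, with leading factor \<open>n + a\<close>, which is never
    zero.\<close>
  have "y $ n = 0" for n
  proof (induction n)
    case 0
    have "((1 - 4 * fps_X) * (D y + ?A * y)) $ 0 = (2 * fps_X * y) $ 0" using y by simp
    then show ?case using a by (simp add: one_minus_4X_mult_nth fps_X_numeral_mult_nth)
  next
    case (Suc k)
    have "((1 - 4 * fps_X) * (D y + ?A * y)) $ Suc k = (2 * fps_X * y) $ Suc k" using y by simp
    then have "(real (Suc k) + real a) * y $ Suc k = 0"
      unfolding one_minus_4X_mult_nth fps_X_numeral_mult_nth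
      using Suc by (simp add: algebra_simps)
    then show ?case by (simp only: mult_eq_0_iff) (use a in linarith)
  qed
  then have "y = 0" by (simp add: fps_eq_iff)
  then show ?thesis unfolding y_def h_def by (simp add: algebra_simps)
qed

text \<open>Apply \<open>D + a\<close> to the hypothesis: it passes through the shift, and on the
  product it falls on either factor by the Leibniz rule. This propagates \<open>joined_V\<close> to
  the derivatives of \<open>V\<close>.\<close>

lemma joined_D:
  assumes a: "a > 0"
  assumes "joined a f + 2 * pairing a * f = e"
  shows "joined a (D f) + 2 * pairing a * D f = D e + fps_const (real a) * e - f * D V"
proof -
  have "D e + fps_const (real a) * e = (D (joined a f) + fps_const (real a) * joined a f)
     + f * (2 * (D (pairing a) + fps_const (real a) * pairing a)) + 2 * pairing a * D f"
    unfolding assms(2)[symmetric] by (simp add: D_mult algebra_simps)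
  then show ?thesis unfolding D_pairing[OF a] D_joined by (simp add: algebra_simps)
qed

lemma D_V_sq: "D (V\<^sup>2) = 2 * V * D V"
  by (simp add: power2_eq_square D_mult algebra_simps)

lemma joined_D_V:
  assumes a: "a > 0"
  shows "joined a (D V) + 2 * pairing a * D V = V * D V + fps_const (real a) * disc"
  using joined_D[OF a joined_V[OF a]] by (simp add: D_diff D_V_sq algebra_simps)

lemma joined_D_D_V:
  assumes a: "a > 0"
  shows "joined a (D (D V)) + 2 * pairing a * D (D V)
    = V * D (D V) + 3 * fps_const (real a) * V * D V + (fps_const (real a))\<^sup>2 * disc"
  using joined_D[OF a joined_D_V[OF a]]
  by (simp add: D_mult D_diff D_V_sq power2_eq_square algebra_simps del: fps_const_mult)

section \<open>The Catalan series and the one-variable identities of genus zero\<close>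

lemma D_U: "D U = - U\<^sup>2 * D V"
proof -
  have "D V * U + V * D U = 0" using D_mult[of V U] by (simp add: VU)
  then have "U * (D V * U + V * D U) = 0" by (simp only: mult_zero_right)
  moreover have "U * (D V * U + V * D U) = U\<^sup>2 * D V + D U * (V * U)"
    by (simp add: power2_eq_square algebra_simps)
  ultimately have "U\<^sup>2 * D V + D U = 0" by (simp only: VU mult_1_right)
  then show ?thesis by (simp add: eq_neg_iff_add_eq_0 add.commute)
qed

lemma two_half: "2 * (fps_const (1/2) * f) = (f :: real fps)"
  using half_fps by (simp only: mult.assoc[symmetric] mult.commute[of 2] mult_1_left)

lemma two_cat: "2 * cat = 1 - U"
  unfolding cat_def by (rule two_half)

text \<open>Since \<open>D U\<close> is expressible in \<open>U\<close> and \<open>V\<close>, the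
  series \<open>2 * D cat - cat\<close> is half of \<open>V - 1\<close>; comparing coefficients
  divides by \<open>2m - 1\<close>.\<close>

lemma cat_nth:
  assumes "m > 0"
  shows "cat $ m = cbin m / (2 * (2 * real m - 1))"
proof -
  have "2 * (2 * D cat - cat) = V - 1"
  proof -
    have "2 * cat = 1 - U" by (rule two_cat)
    then have "D (2 * cat) = - D U" by (simp add: D_diff)
    then have "2 * D cat = - D U" by (simp add: D_mult)
    then have "2 * (2 * D cat - cat) = 2 * (- D U) - (1 - U)"
      unfolding right_diff_distrib two_cat by simp
    also have "\<dots> = 2 * U\<^sup>2 * D V - (1 - U)" unfolding D_U by simp
    also have "2 * U\<^sup>2 * D V = U\<^sup>2 * (2 * D V)" by simp
    also have "\<dots> = (V * U) * (V * U) * V - (V * U) * U" unfolding D_V' by (simp add: power2_eq_square algebra_simps)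
    finally show ?thesis unfolding VU by simp
  qed
  then have "(2 * (2 * D cat - cat)) $ m = (V - 1) $ m" by simp
  then have "2 * (2 * real m - 1) * cat $ m = cbin m"
    using assms by (simp add: numeral_fps_const algebra_simps)
  moreover have "2 * real m - 1 \<noteq> 0" using assms by linarith
  ultimately show ?thesis by (simp add: field_simps)
qed

lemma two_spairing: "2 * spairing a = 2 * pairing a - (V - U)"
proof -
  have "2 * (fps_const (1/2) * (V - U)) = V - U" by (rule two_half)
  then show ?thesis unfolding spairing_def by (simp add: algebra_simps)
qed

lemma four_X: "4 * fps_X = 1 - U\<^sup>2"
proof -
  have "(1 - 4 * fps_X) * V\<^sup>2 * U\<^sup>2 = U\<^sup>2" unfolding V_sq by simp
  moreover have "(1 - 4 * fps_X) * V\<^sup>2 * U\<^sup>2 = (1 - 4 * fps_X) * ((V * U) * (V * U))"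
    by (simp add: power2_eq_square algebra_simps)
  ultimately have "1 - 4 * fps_X = U\<^sup>2" unfolding VU by simp
  then show ?thesis by (metis add_diff_cancel diff_add_cancel add.commute)
qed

text \<open>The part of degree zero in the \<open>eh i\<close> of the genus zero equation.\<close>

lemma cat_eq: "cat = fps_X + cat * cat"
proof -
  have "4 * (fps_X + cat * cat) = 4 * fps_X + (2 * cat) * (2 * cat)" by (simp add: algebra_simps)
  also have "\<dots> = 2 * (1 - U)" unfolding two_cat four_X by (simp add: power2_eq_square algebra_simps)
  also have "\<dots> = 4 * cat" unfolding two_cat[symmetric] by simp
  finally have "4 * cat = 4 * (fps_X + cat * cat)" ..
  moreover have "(4 :: real fps) \<noteq> 0" by (simp add: numeral_fps_const)
  ultimately show ?thesis using mult_left_cancel by blast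
qed

lemma two_neq: "(2::real fps) \<noteq> 0"
  by (simp add: numeral_fps_const)

lemma two_mult_eq_0: "2 * (f :: real fps) = 0 \<Longrightarrow> f = 0"
  using two_neq by (simp only: mult_eq_0_iff) simp

text \<open>Both sides solve \<open>2 * (2 * D y + (2 * a - 1) * y) = joined a V\<close>. The
  solution is unique because \<open>n + a - 1/2\<close> is never zero.\<close>

lemma joined_cat:
  assumes a: "a > 0"
  shows "joined a cat = pairing a * U"
proof -
  let ?A = "fps_const (real a)"
  have a1: "real a \<ge> 1" using a by simp
  define r where "r = real a / wt a"
  have nth: "joined a f $ n = r * f $ (n + a)" if "n \<noteq> 0" for f n
    using that by (simp add: joined_def r_def)
  have 1: "2 * (2 * D (joined a cat) + (2 * ?A - 1) * joined a cat) = joined a V"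
  proof (rule fps_ext)
    fix n
    show "(2 * (2 * D (joined a cat) + (2 * ?A - 1) * joined a cat)) $ n = joined a V $ n"
    proof (cases "n = 0")
      case False
      have "2 * (real n + real a) - 1 > 0" using a1 of_nat_0_le_iff[of n, where 'a = real] unfolding distrib_left by linarith
      then have "2 * (real n + real a) - 1 \<noteq> 0" by linarith
      moreover have "cat $ (n + a) = cbin (n + a) / (2 * (2 * (real n + real a) - 1))"
        using cat_nth[of "n + a"] a by simp
      ultimately have "2 * (2 * (real n + real a) - 1) * cat $ (n + a) = cbin (n + a)"
        by simp
      then have c: "r * cbin (n + a) = r * (2 * (2 * (real n + real a) - 1) * cat $ (n + a))"
        by (simp only:)
      have "(2 * (2 * D (joined a cat) + (2 * ?A - 1) * joined a cat)) $ n
        = 2 * (2 * (real n * (r * cat $ (n + a))) + (2 * (real a * (r * cat $ (n + a))) - r * cat $ (n + a)))"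
        using False by (simp add: numeral_fps_const left_diff_distrib mult.assoc nth)
      also have "\<dots> = joined a V $ n"
        unfolding nth[OF False] V_nth c by (simp only: algebra_simps)
      finally show ?thesis .
    qed (simp add: numeral_fps_const joined_def left_diff_distrib mult.assoc)
  qed
  have 2: "2 * (2 * D (pairing a * U) + (2 * ?A - 1) * (pairing a * U)) = joined a V"
  proof -
    have "2 * (2 * D (pairing a * U) + (2 * ?A - 1) * (pairing a * U))
       = 2 * U * (2 * (D (pairing a) + ?A * pairing a)) + 4 * pairing a * D U - 2 * pairing a * U"
      by (simp add: D_mult algebra_simps)
    also have "\<dots> = U * (2 * D V) - 2 * pairing a * (U * (U * (2 * D V))) - 2 * pairing a * U"
      unfolding D_pairing[OF a] D_U by (simp add: power2_eq_square algebra_simps)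
    also have "\<dots> = (V * U) * disc - 2 * pairing a * ((V * U) * (U * disc)) - 2 * pairing a * U"
      unfolding D_V' by (simp add: algebra_simps)
    also have "\<dots> = V\<^sup>2 - 1 - 2 * pairing a * (V * (V * U))"
      using VU by (simp add: power2_eq_square algebra_simps)
    also have "\<dots> = joined a V" unfolding VU joined_V[OF a, symmetric] by simp
    finally show ?thesis .
  qed
  define y where "y = joined a cat - pairing a * U"
  have "4 * (D y + fps_const (real a - 1/2) * y) = 4 * D y + (4 * fps_const (real a - 1/2)) * y"
    by (simp add: algebra_simps)
  also have "4 * fps_const (real a - 1/2) = 2 * (2 * ?A - 1)"
    by (simp add: fps_eq_iff numeral_fps_const)
  also have "4 * D y + \<dots> * y = 2 * (2 * D (joined a cat) + (2 * ?A - 1) * joined a cat)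
     - 2 * (2 * D (pairing a * U) + (2 * ?A - 1) * (pairing a * U))"
    unfolding y_def by (simp add: D_diff algebra_simps)
  also have "\<dots> = 0" unfolding 1 2 by simp
  finally have "D y + fps_const (real a - 1/2) * y = 0" by (simp add: numeral_fps_const)
  moreover have "real n + (real a - 1/2) \<noteq> 0" for n
  proof -
    have "real n + (real a - 1/2) > 0" using a1 of_nat_0_le_iff[of n, where 'a = real] unfolding distrib_left by linarith
    then show ?thesis by linarith
  qed
  ultimately have "y = 0" by (rule D_eq_0)
  then show ?thesis by (simp add: y_def)
qed

text \<open>The part of degree one in the \<open>eh i\<close> of the genus zero equation; the term
  \<open>- 2X\<close> stems from the square of \<tau>.\<close>

lemma spairing_eq:
  assumes a: "a > 0"
  shows "spairing a = joined a cat + 2 * cat * spairing a - 2 * fps_X"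
proof -
  have "2 * (joined a cat + 2 * cat * spairing a - 2 * fps_X - spairing a)
     = 2 * pairing a * U + (2 * cat) * (2 * spairing a) - 4 * fps_X - 2 * spairing a"
    unfolding joined_cat[OF a] by (simp add: algebra_simps)
  also have "\<dots> = 0"
    unfolding two_cat two_spairing four_X using VU by (simp add: power2_eq_square algebra_simps)
  finally have "joined a cat + 2 * cat * spairing a - 2 * fps_X - spairing a = 0"
    by (rule two_mult_eq_0)
  then show ?thesis by simp
qed

text \<open>The operator \<open>D + (a + b)\<close> removes the denominators of all three products
  at once and reduces the claim to \<open>joined_D_V\<close> for \<open>a\<close> and for
  \<open>b\<close>.\<close>

lemma joined_pairing:
  assumes a: "a > 0" and b: "b > 0"
  shows "2 * (joined a (pairing b) + joined b (pairing a) + 2 * pairing a * pairing b) = V\<^sup>2 - 1"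
proof -
  let ?A = "fps_const (real a)" and ?B = "fps_const (real b)"
  have key: "2 * (D (joined a (pairing b)) + (fps_const (real a) + fps_const (real b)) * joined a (pairing b)) = joined a (D V)"
    if a: "a > 0" and b: "b > 0" for a b
  proof -
    let ?A = "fps_const (real a)" and ?B = "fps_const (real b)"
    have "2 * (D (joined a (pairing b)) + (?A + ?B) * joined a (pairing b))
      = 2 * ((D (joined a (pairing b)) + ?A * joined a (pairing b)) + ?B * joined a (pairing b))"
      by (simp add: algebra_simps del: fps_const_add)
    also have "\<dots> = joined a (fps_const 2 * (D (pairing b) + ?B * pairing b))"
      unfolding D_joined joined_const joined_add by (simp add: numeral_fps_const)
    also have "\<dots> = joined a (D V)"
      using D_pairing[OF b] by (simp add: numeral_fps_const)
    finally show ?thesis .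
  qed
  define y where "y = 2 * (joined a (pairing b) + joined b (pairing a) + 2 * pairing a * pairing b) - disc"
  have "D y + (?A + ?B) * y
     = 2 * (D (joined a (pairing b)) + (?A + ?B) * joined a (pairing b))
     + 2 * (D (joined b (pairing a)) + (?B + ?A) * joined b (pairing a))
     + 2 * pairing b * (2 * (D (pairing a) + ?A * pairing a))
     + 2 * pairing a * (2 * (D (pairing b) + ?B * pairing b))
     - 2 * V * D V - (?A + ?B) * disc"
    unfolding y_def by (simp add: D_mult D_diff power2_eq_square algebra_simps del: fps_const_add)
  also have "\<dots> = (joined a (D V) + 2 * pairing a * D V) + (joined b (D V) + 2 * pairing b * D V)
     - 2 * V * D V - (?A + ?B) * disc"
    unfolding key[OF a b] key[OF b a] D_pairing[OF a] D_pairing[OF b]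
    by (simp add: algebra_simps del: fps_const_add)
  also have "\<dots> = 0"
    unfolding joined_D_V[OF a] joined_D_V[OF b] by (simp add: algebra_simps del: fps_const_add fps_const_neg)
  finally have "D y + fps_const (real a + real b) * y = 0" by simp
  moreover have "real n + (real a + real b) \<noteq> 0" for n
  proof -
    have "real n + (real a + real b) > 0" using a by simp
    then show ?thesis by linarith
  qed
  ultimately have "y = 0" by (rule D_eq_0)
  then show ?thesis by (simp add: y_def)
qed

lemma joined_V_minus_U:
  assumes a: "a > 0"
  shows "joined a (V - U) = V\<^sup>2 - 1 - 2 * pairing a * (V - U)"
proof -
  have "joined a (V - U) = joined a (V + fps_const 2 * cat - 1)"
    using two_cat by (simp add: numeral_fps_const)
  also have "\<dots> = joined a V + 2 * joined a cat - joined a 1"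
    unfolding joined_diff joined_add joined_const by (simp add: numeral_fps_const)
  also have "joined a 1 = 0" using a by (auto simp: joined_def fps_eq_iff)
  also have "joined a V + 2 * joined a cat - 0 = (joined a V + 2 * pairing a * V) - 2 * pairing a * (V - U)"
    unfolding joined_cat[OF a] by (simp add: algebra_simps)
  finally show ?thesis unfolding joined_V[OF a] .
qed

text \<open>The part of degree two in the \<open>eh i\<close> of the genus zero equation,
  symmetrized because only the symmetric sum over pairs occurs.\<close>

lemma joined_spairing:
  assumes a: "a > 0" and b: "b > 0"
  shows "2 * fps_X + joined a (spairing b) + joined b (spairing a) + 2 * spairing a * spairing b = 0"
proof -
  have j: "2 * joined a (spairing b) = 2 * joined a (pairing b) - joined a (V - U)" for a b
    using arg_cong[OF two_spairing, of "joined a"] joined_const[of a 2]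
    by (simp add: joined_diff numeral_fps_const)
  have "2 * (2 * fps_X + joined a (spairing b) + joined b (spairing a) + 2 * spairing a * spairing b)
    = 4 * fps_X + 2 * joined a (spairing b) + 2 * joined b (spairing a) + (2 * spairing a) * (2 * spairing b)"
    by (simp add: algebra_simps)
  also have "\<dots> = 4 * fps_X + 2 * (joined a (pairing b) + joined b (pairing a) + 2 * pairing a * pairing b)
     - joined a (V - U) - joined b (V - U) - 2 * pairing a * (V - U) - 2 * pairing b * (V - U) + (V - U)\<^sup>2"
    unfolding j two_spairing by (simp add: power2_eq_square algebra_simps)
  also have "\<dots> = 0"
    unfolding four_X joined_pairing[OF a b] joined_V_minus_U[OF a] joined_V_minus_U[OF b]
    using VU by (simp add: power2_eq_square algebra_simps)
  finally show ?thesis by (rule two_mult_eq_0)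
qed

text \<open>The genus one series is a combination of \<open>tor\<close> and \<open>D V\<close>.\<close>

definition tor :: "real fps" where "tor = 2 * D (D V) - 2 * D V"

lemma four_D_D_V: "4 * D (D V) = V * disc * (3 * V\<^sup>2 - 1)"
proof -
  have "4 * D (D V) = 2 * D (2 * D V)" by (simp add: D_mult)
  also have "\<dots> = 2 * D (V * disc)" unfolding D_V' ..
  also have "\<dots> = (3 * V\<^sup>2 - 1) * (2 * D V)"
    by (simp add: D_mult D_diff power2_eq_square algebra_simps)
  finally show ?thesis unfolding D_V' by (simp add: algebra_simps)
qed

lemma two_tor: "2 * tor = 3 * (V * disc\<^sup>2)"
proof -
  have "2 * tor = 4 * D (D V) - 2 * (2 * D V)" unfolding tor_def by (simp add: algebra_simps)
  then show ?thesis unfolding four_D_D_V D_V' by (simp add: power2_eq_square algebra_simps)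
qed

text \<open>With \<open>cat_tor\<close>, \<open>spairing_D_V\<close> and
  \<open>spairing_tor\<close>, this evaluates the linearized genus zero equation on
  \<open>D V\<close> and \<open>tor\<close>. All results are combinations of \<open>disc\<close> and
  its square, so that a cancellation of the \<open>disc\<close> terms becomes possible in
  \<open>wser_eq\<close>.\<close>

lemma cat_D_V: "2 * (D V - 2 * cat * D V) = V\<^sup>2 - 1"
proof -
  have "2 * (D V - 2 * cat * D V) = (1 - 2 * cat) * (2 * D V)" by (simp add: algebra_simps)
  then show ?thesis unfolding two_cat D_V' using VU by (simp add: algebra_simps)
qed

lemma cat_tor: "2 * (tor - 2 * cat * tor) = 3 * disc\<^sup>2"
proof -
  have "2 * (tor - 2 * cat * tor) = (1 - 2 * cat) * (2 * tor)" by (simp add: algebra_simps)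
  also have "\<dots> = 3 * ((V * U) * disc\<^sup>2)" unfolding two_cat two_tor by (simp add: algebra_simps)
  finally show ?thesis unfolding VU by simp
qed

lemma spairing_D_V:
  assumes a: "a > 0"
  shows "2 * (joined a (D V) + 2 * spairing a * D V) = (1 + 2 * fps_const (real a)) * disc"
proof -
  have "2 * (joined a (D V) + 2 * spairing a * D V)
    = 2 * (joined a (D V) + 2 * pairing a * D V) - (V - U) * (2 * D V)"
    unfolding two_spairing by (simp add: algebra_simps)
  also have "\<dots> = V * (2 * D V) + 2 * fps_const (real a) * disc - V * (2 * D V) + U * (2 * D V)"
    unfolding joined_D_V[OF a] by (simp add: algebra_simps)
  also have "U * (2 * D V) = (V * U) * disc" unfolding D_V' by (simp add: algebra_simps)
  finally show ?thesis unfolding VU by (simp add: algebra_simps)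
qed

lemma spairing_tor:
  assumes a: "a > 0"
  shows "2 * (joined a tor + 2 * spairing a * tor)
    = (3 + 6 * fps_const (real a)) * disc\<^sup>2
      + (4 * (fps_const (real a))\<^sup>2 + 2 * fps_const (real a)) * disc"
proof -
  let ?A = "fps_const (real a)"
  have J: "joined a tor = 2 * joined a (D (D V)) - 2 * joined a (D V)"
    unfolding tor_def numeral_fps_const joined_diff joined_const ..
  have "2 * (joined a tor + 2 * spairing a * tor) = 2 * joined a tor + (2 * spairing a) * (2 * tor)"
    by (simp add: algebra_simps)
  also have "\<dots> = 2 * (2 * joined a (D (D V)) - 2 * joined a (D V)) + (2 * spairing a) * (2 * tor)"
    unfolding J ..
  also have "\<dots> = 4 * (joined a (D (D V)) + 2 * pairing a * D (D V)) - 4 * (joined a (D V) + 2 * pairing a * D V)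
      - (V - U) * (2 * tor)"
    unfolding two_spairing tor_def by (simp add: algebra_simps)
  also have "\<dots> = V * (4 * D (D V)) + 6 * ?A * V * (2 * D V) + 4 * ?A\<^sup>2 * disc
      - 2 * V * (2 * D V) - 4 * ?A * disc - (V - U) * (2 * tor)"
    unfolding joined_D_V[OF a] joined_D_D_V[OF a] by (simp add: algebra_simps del: fps_const_mult fps_const_power)
  also have "\<dots> = V\<^sup>2 * disc * (3 * V\<^sup>2 - 1) + 6 * ?A * V\<^sup>2 * disc + 4 * ?A\<^sup>2 * disc
      - 2 * V\<^sup>2 * disc - 4 * ?A * disc - 3 * V\<^sup>2 * disc\<^sup>2 + 3 * (V * U) * disc\<^sup>2"
    unfolding two_tor four_D_D_V D_V' by (simp add: power2_eq_square algebra_simps del: fps_const_mult fps_const_power)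
  also have "\<dots> = (3 + 6 * ?A) * disc\<^sup>2 + (4 * ?A\<^sup>2 + 2 * ?A) * disc"
    unfolding VU by (simp add: power2_eq_square algebra_simps del: fps_const_mult fps_const_power)
  finally show ?thesis .
qed

text \<open>Integrates the source term of genus one: the convolution of the weights
  \<open>wt k\<close> and \<open>wt (m - k)\<close>, divided by \<open>m\<close>, is up to a
  constant a coefficient of the square of \<open>disc\<close>.\<close>

lemma D_V_D_V: "D (disc\<^sup>2) = 8 * (D V * D V)"
proof -
  have "D (disc\<^sup>2) = 2 * D V * (2 * (V * disc))"
    by (simp add: power2_eq_square D_mult D_diff algebra_simps)
  then show ?thesis unfolding D_V'[symmetric] by (simp add: algebra_simps)
qed

section \<open>The algebra of set functions\<close>

text \<open>On infinite sets the convolution over all subsets would be an infinite sum. Fixing the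
  value zero there makes equality a matter of finite sets.\<close>

typedef 'i sfun = "{f :: 'i set \<Rightarrow> real. \<forall>S. infinite S \<longrightarrow> f S = 0}"
  morphisms val Abs_sfun
  by (rule exI[of _ "\<lambda>_. 0"]) simp

definition mk :: "('i set \<Rightarrow> real) \<Rightarrow> 'i sfun" where
  "mk f = Abs_sfun (\<lambda>S. if finite S then f S else 0)"

lemma val_mk [simp]: "val (mk f) S = (if finite S then f S else 0)"
  unfolding mk_def by (subst Abs_sfun_inverse) auto

lemma val_infinite: "infinite S \<Longrightarrow> val x S = 0"
  using val[of x] by auto

lemma sfun_eqI: "(\<And>S. finite S \<Longrightarrow> val x S = val y S) \<Longrightarrow> x = y"
  by (metis val_inject ext val_infinite)

instantiation sfun :: (type) "{comm_ring_1, real_algebra_1}"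
begin

definition "0 = mk (\<lambda>_. 0)"
definition "1 = mk (\<lambda>S. if S = {} then 1 else 0)"
definition "x + y = mk (\<lambda>S. val x S + val y S)"
definition "x - y = mk (\<lambda>S. val x S - val y S)"
definition "- x = mk (\<lambda>S. - val x S)"
definition "r *\<^sub>R x = mk (\<lambda>S. r * val x S)"
definition "x * y = mk (\<lambda>S. \<Sum>A\<in>Pow S. val x A * val y (S - A))"

lemma val_simps [simp]:
  "val 0 S = 0"
  "val (x + y) S = val x S + val y S"
  "val (x - y) S = val x S - val y S"
  "val (- x) S = - val x S"
  "val (r *\<^sub>R x) S = r * val x S"
  by (auto simp: zero_sfun_def plus_sfun_def minus_sfun_def uminus_sfun_def scaleR_sfun_def val_infinite)

lemma val_1: "val 1 S = (if S = {} then 1 else 0)"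
  by (simp add: one_sfun_def)

lemma val_mult: "finite S \<Longrightarrow> val (x * y) S = (\<Sum>A\<in>Pow S. val x A * val y (S - A))"
  by (simp add: times_sfun_def)

instance
proof
  fix x y z :: "'a sfun" and r s :: real
  show "x * y * z = x * (y * z)"
  proof (rule sfun_eqI)
    fix S :: "'a set" assume S: "finite S"
    have fin: "finite A" if "A \<subseteq> S" for A using that S finite_subset by blast
    have "val (x * y * z) S = (\<Sum>A\<in>Pow S. \<Sum>B\<in>Pow A. val x B * val y (A - B) * val z (S - A))"
      using S fin by (auto simp: val_mult sum_distrib_right intro!: sum.cong)
    also have "\<dots> = (\<Sum>(A, B)\<in>(SIGMA A:Pow S. Pow A). val x B * val y (A - B) * val z (S - A))"
      using S fin by (subst sum.Sigma) auto
    also have "\<dots> = (\<Sum>(B, C)\<in>(SIGMA B:Pow S. Pow (S - B)). val x B * (val y C * val z (S - B - C)))"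
      by (rule sum.reindex_bij_witness[of _ "\<lambda>(B, C). (B \<union> C, B)" "\<lambda>(A, B). (B, A - B)"])
        (auto simp: Diff_Un[symmetric] Un_absorb1 Diff_eq mult.assoc intro!: arg_cong[of _ _ "val _"] arg_cong2[of _ _ _ _ "(*)"])
    also have "\<dots> = (\<Sum>B\<in>Pow S. \<Sum>C\<in>Pow (S - B). val x B * (val y C * val z (S - B - C)))"
      using S by (subst sum.Sigma) auto
    also have "\<dots> = val (x * (y * z)) S"
      using S by (auto simp: val_mult sum_distrib_left intro!: sum.cong)
    finally show "val (x * y * z) S = val (x * (y * z)) S" .
  qed
  show comm: "x * y = y * x" for x y :: "'a sfun"
  proof (rule sfun_eqI)
    fix S :: "'a set" assume S: "finite S"
    show "val (x * y) S = val (y * x) S"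
      unfolding val_mult[OF S]
      by (rule sum.reindex_bij_witness[of _ "\<lambda>A. S - A" "\<lambda>A. S - A"])
        (auto simp: double_diff)
  qed
  show one: "1 * x = x" for x :: "'a sfun"
  proof (rule sfun_eqI)
    fix S :: "'a set" assume S: "finite S"
    have "val (1 * x) S = (\<Sum>A\<in>{{}}. val 1 A * val x (S - A))"
      unfolding val_mult[OF S] using S by (intro sum.mono_neutral_right) (auto simp: val_1)
    then show "val (1 * x) S = val x S" by (simp add: val_1)
  qed
  show distr: "(x + y) * z = x * z + y * z" for x y z :: "'a sfun"
    by (rule sfun_eqI) (simp add: val_mult distrib_right sum.distrib)
  show "x * (y + z) = x * y + x * z"
    by (metis comm distr)
  show "x * 1 = x" by (metis comm one)
  show "r *\<^sub>R x * y = r *\<^sub>R (x * y)"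
    by (rule sfun_eqI) (simp add: val_mult sum_distrib_left mult.assoc)
  show "x * r *\<^sub>R y = r *\<^sub>R (x * y)"
    by (rule sfun_eqI) (simp add: val_mult sum_distrib_left mult.left_commute)
  show "(0 :: 'a sfun) \<noteq> 1"
    by (metis val_1 val_simps(1) zero_neq_one)
qed (auto intro!: sfun_eqI simp: algebra_simps)

end

lemma val_sum: "val (\<Sum>i\<in>A. f i) S = (\<Sum>i\<in>A. val (f i) S)"
  by (induction A rule: infinite_finite_induct) auto

definition eps :: "'i \<Rightarrow> 'i sfun" where
  "eps i = mk (\<lambda>S. if S = {i} then 1 else 0)"

lemma val_eps_mult: "finite S \<Longrightarrow> val (eps i * x) S = (if i \<in> S then val x (S - {i}) else 0)"
proof -
  assume S: "finite S"
  have "val (eps i * x) S = (\<Sum>A\<in>(if i \<in> S then {{i}} else {}). val (eps i) A * val x (S - A))"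
    unfolding val_mult[OF S] using S by (intro sum.mono_neutral_right) (auto simp: eps_def)
  then show ?thesis by (simp add: eps_def)
qed

lemma sum_eps_mult:
  assumes "finite I" "finite S"
  shows "val (\<Sum>i\<in>I. r i *\<^sub>R (eps i * x i)) S = (\<Sum>i\<in>S \<inter> I. r i * val (x i) (S - {i}))"
proof -
  have "val (\<Sum>i\<in>I. r i *\<^sub>R (eps i * x i)) S = (\<Sum>i\<in>I. if i \<in> S then r i * val (x i) (S - {i}) else 0)"
    using assms by (auto simp: val_sum val_eps_mult intro!: sum.cong)
  also have "\<dots> = (\<Sum>i\<in>I \<inter> S. r i * val (x i) (S - {i}))"
    using assms by (simp add: sum.inter_restrict)
  finally show ?thesis by (simp add: Int_commute)
qed

section \<open>Lagrange inversion in the algebra of set functions\<close>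

locale weights =
  fixes I :: "'i set" and a :: "'i \<Rightarrow> nat"
  assumes finite_I: "finite I" and a_pos: "\<And>i. i \<in> I \<Longrightarrow> a i > 0"
begin

definition on_I :: "('i set \<Rightarrow> real) \<Rightarrow> 'i sfun" where
  "on_I f = mk (\<lambda>S. if S \<subseteq> I then f S else 0)"

lemma val_on_I: "val (on_I f) S = (if S \<subseteq> I then f S else 0)"
  using finite_I finite_subset by (auto simp: on_I_def)

lemma val_sum_eps_on_I:
  assumes "finite S"
  shows "val (\<Sum>i\<in>I. r i *\<^sub>R (eps i * on_I (f i))) S =
    (if S \<subseteq> I then \<Sum>i\<in>S. r i * f i (S - {i}) else 0)"
proof -
  have *: "S \<inter> I = S" if "S \<subseteq> I" using that by blast
  have "val (on_I (f i)) (S - {i}) = 0" if "i \<in> I" "\<not> S \<subseteq> I" for i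
    using that by (auto simp: val_on_I)
  then show ?thesis
    by (auto simp: sum_eps_mult[OF finite_I assms] val_on_I * intro!: sum.cong sum.neutral)
qed

definition tot :: "'i set \<Rightarrow> real" where "tot S = (\<Sum>i\<in>S. real (a i))"

lemma tot_remove: "finite S \<Longrightarrow> i \<in> S \<Longrightarrow> tot (S - {i}) = tot S - real (a i)"
  unfolding tot_def by (simp add: sum_diff1)

lemma tot_empty [simp]: "tot {} = 0" by (simp add: tot_def)

text \<open>On the empty set the rising product would have -1 factors, that is the value
  \<open>1 / c\<close>, and the prefactor \<open>c\<close> turns it into 1.\<close>

definition G :: "int \<Rightarrow> 'i sfun" where
  "G c = on_I (\<lambda>S. if S = {} then 1 else
     of_int c * pochhammer (2 * tot S + of_int c + 1) (card S - 1))"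

text \<open>Read with \<open>G c\<close> as the power \<open>- c\<close> of \<tau>, this is the
  functional equation that determines \<tau>: 1 is the sum of \<tau> and of all \<open>eps i\<close>
  times the power \<open>- 2 * a i\<close> of \<tau>. The proof is the backward difference of the
  rising product.\<close>

lemma G_step: "G c = G (c - 1) + (\<Sum>i\<in>I. eps i * G (c + 2 * int (a i)))"
proof (rule sfun_eqI)
  fix S :: "'i set" assume S: "finite S"
  define g where "g c S = (if S = {} then 1 else
     of_int c * pochhammer (2 * tot S + of_int c + 1) (card S - 1))" for c :: int and S
  have G: "G c = on_I (g c)" for c
    by (simp add: G_def g_def[abs_def])
  have sum: "val (\<Sum>i\<in>I. eps i * G (c + 2 * int (a i))) S = (if S \<subseteq> I then \<Sum>i\<in>S. g (c + 2 * int (a i)) (S - {i}) else 0)"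
    using val_sum_eps_on_I[OF S, of "\<lambda>_. 1" "\<lambda>i. g (c + 2 * int (a i))"] by (simp add: G)
  have main: "g c S = g (c - 1) S + (\<Sum>i\<in>S. g (c + 2 * int (a i)) (S - {i}))"
  proof (cases "card S")
    case 0
    then show ?thesis using S by (simp add: g_def)
  next
    case (Suc k)
    then have ne: "S \<noteq> {}" by auto
    show ?thesis
    proof (cases k)
      case 0
      then obtain i where "S = {i}" using Suc card_1_singletonE by (metis One_nat_def)
      then show ?thesis by (simp add: g_def)
    next
      case (Suc j)
      let ?X = "2 * tot S + of_int c"
      have "(\<Sum>i\<in>S. g (c + 2 * int (a i)) (S - {i})) =
        (\<Sum>i\<in>S. (of_int c + 2 * real (a i)) * pochhammer (?X + 1) j)"
      proof (rule sum.cong)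
        fix i assume i: "i \<in> S"
        have c: "card (S - {i}) = Suc j" using i S Suc \<open>card S = Suc k\<close> by simp
        then have "S - {i} \<noteq> {}" by (metis card.empty nat.distinct(1))
        then show "g (c + 2 * int (a i)) (S - {i}) = (of_int c + 2 * real (a i)) * pochhammer (?X + 1) j"
          using c i S by (simp add: g_def tot_remove algebra_simps)
      qed simp
      also have "\<dots> = (real (card S) * of_int c + 2 * tot S) * pochhammer (?X + 1) j"
        unfolding sum_distrib_right[symmetric] sum.distrib tot_def sum_distrib_left by simp
      finally have "(\<Sum>i\<in>S. g (c + 2 * int (a i)) (S - {i})) =
        (real (Suc (Suc j)) * of_int c + 2 * tot S) * pochhammer (?X + 1) j"
        using Suc \<open>card S = Suc k\<close> by simp
      moreover have "g c S = of_int c * (pochhammer (?X + 1) j * (?X + 1 + real j))"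
        using ne \<open>card S = Suc k\<close> Suc by (simp add: g_def pochhammer_Suc)
      moreover have "g (c - 1) S = (of_int c - 1) * (?X * pochhammer (?X + 1) j)"
        using ne \<open>card S = Suc k\<close> Suc by (simp add: g_def pochhammer_rec)
      ultimately show ?thesis by (simp add: algebra_simps)
    qed
  qed
  show "val (G c) S = val (G (c - 1) + (\<Sum>i\<in>I. eps i * G (c + 2 * int (a i)))) S"
    using main sum unfolding G by (simp add: val_on_I)
qed

lemma G_0: "G 0 = 1"
  by (rule sfun_eqI) (auto simp: G_def val_on_I val_1)

text \<open>The defect of multiplicativity is, by induction on the set of indices, periodic in \<open>c\<close>;
  it vanishes at \<open>c = 0\<close>.\<close>

lemma G_mult: "G c * G c' = G (c + c')"
proof (rule sfun_eqI)
  fix S :: "'i set" assume "finite S"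
  then show "val (G c * G c') S = val (G (c + c')) S"
  proof (induction "card S" arbitrary: S c c' rule: less_induct)
    case less
    define d where "d c = val (G c * G c') S - val (G (c + c')) S" for c
    have step: "d c = d (c - 1)" for c
    proof -
      have "val (G c * G c') S = val (G (c - 1) * G c') S + val (\<Sum>i\<in>I. eps i * (G (c + 2 * int (a i)) * G c')) S"
        by (subst G_step) (simp add: distrib_right sum_distrib_right mult.assoc)
      moreover have "val (G (c + c')) S = val (G (c - 1 + c')) S + val (\<Sum>i\<in>I. eps i * G (c + c' + 2 * int (a i))) S"
        by (subst G_step) (simp add: algebra_simps)
      moreover have "val (\<Sum>i\<in>I. eps i * (G (c + 2 * int (a i)) * G c')) S
        = val (\<Sum>i\<in>I. eps i * G (c + c' + 2 * int (a i))) S"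
        unfolding val_sum
      proof (rule sum.cong)
        fix i
        have "val (G (c + 2 * int (a i)) * G c') (S - {i}) = val (G (c + 2 * int (a i) + c')) (S - {i})" if "i \<in> S"
          using that less.prems by (intro less.hyps card_Diff1_less) auto
        then show "val (eps i * (G (c + 2 * int (a i)) * G c')) S = val (eps i * G (c + c' + 2 * int (a i))) S"
          using less.prems by (simp add: val_eps_mult algebra_simps)
      qed simp
      ultimately show ?thesis by (simp add: d_def)
    qed
    have "d c = d 0"
    proof (induction c rule: int_induct[of _ 0])
      case (step1 i) then show ?case using step[of "i + 1"] by simp
    next
      case (step2 i) then show ?case using step[of i] by simp
    qed simp
    moreover have "d 0 = 0" by (simp add: d_def G_0)
    ultimately show ?case by (simp add: d_def)
  qed
qed

definition eh :: "'i \<Rightarrow> 'i sfun" where "eh i = eps i * G (2 * int (a i))"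

lemma eps_G: "eps i * G (c + 2 * int (a i)) = eh i * G c"
  by (simp add: eh_def mult.assoc G_mult add.commute)

definition \<tau> :: "'i sfun" where "\<tau> = G (- 1)"

lemma \<tau>_eq: "\<tau> = 1 - (\<Sum>i\<in>I. eh i)"
  using G_step[of 0] by (simp add: \<tau>_def G_0 eh_def eq_diff_eq)

text \<open>Multiplication by \<open>G c'\<close> commutes with the recursion, and the factor
  \<open>eps i\<close> refers to a smaller set, so the shift law passes from the inhomogeneous term
  \<open>g\<close> to the solution \<open>f\<close>. It is needed for the quotients \<open>H\<close>
  and \<open>J\<close>, whose shift laws are not visible in their formulas.\<close>

lemma G_transfer:
  assumes f: "\<And>c. f c = g c + (\<Sum>i\<in>I. r i *\<^sub>R (eps i * f (c + 2 * int (a i))))"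
    and g: "\<And>c c'. g c * G c' = g (c + c')"
  shows "f c * G c' = f (c + c')"
proof (rule sfun_eqI)
  fix S :: "'i set" assume "finite S"
  then show "val (f c * G c') S = val (f (c + c')) S"
  proof (induction "card S" arbitrary: S c rule: less_induct)
    case less
    have "val (r i *\<^sub>R (eps i * (f (c + 2 * int (a i)) * G c'))) S
      = val (r i *\<^sub>R (eps i * f (c + c' + 2 * int (a i)))) S" for i
    proof -
      have "val (f (c + 2 * int (a i)) * G c') (S - {i}) = val (f (c + 2 * int (a i) + c')) (S - {i})" if "i \<in> S"
        using that less.prems by (intro less.hyps card_Diff1_less) auto
      then show ?thesis
        using less.prems by (simp add: val_eps_mult algebra_simps)
    qed
    then have "val (\<Sum>i\<in>I. r i *\<^sub>R (eps i * (f (c + 2 * int (a i)) * G c'))) S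
       = val (\<Sum>i\<in>I. r i *\<^sub>R (eps i * f (c + c' + 2 * int (a i)))) S"
      unfolding val_sum by (intro sum.cong refl)
    moreover have "f c * G c' = g (c + c') + (\<Sum>i\<in>I. r i *\<^sub>R (eps i * (f (c + 2 * int (a i)) * G c')))"
      by (subst f) (simp add: distrib_right g sum_distrib_right mult.assoc)
    ultimately show ?case by (subst f[of "c + c'"]) simp
  qed
qed

end

section \<open>The genus zero series and its quadratic equation\<close>

definition emb :: "real fps \<Rightarrow> 'i sfun fps" where
  "emb f = Abs_fps (\<lambda>n. (f $ n) *\<^sub>R 1)"

lemma emb_nth [simp]: "emb f $ n = (f $ n) *\<^sub>R 1"
  by (simp add: emb_def)

lemma emb_add: "emb (f + g) = emb f + emb g"
  and emb_diff: "emb (f - g) = emb f - emb g"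
  and emb_X: "emb fps_X = fps_X"
  and emb_const: "emb (fps_const c) = fps_const (c *\<^sub>R 1)"
  by (auto simp: fps_eq_iff algebra_simps)

lemma emb_mult: "emb (f * g) = emb f * emb g"
  by (rule fps_ext) (simp add: fps_mult_nth scaleR_sum_left mult.commute)

lemma emb_numeral: "emb (numeral n) = numeral n"
proof -
  have "(numeral n :: real) *\<^sub>R (1 :: 'i sfun) = numeral n"
    by (metis of_real_def of_real_numeral)
  then show ?thesis by (simp add: fps_eq_iff numeral_fps_const)
qed

text \<open>The rising product starting at \<open>2x + 1\<close> with \<open>l - 3\<close> factors, continued to negative numbers of factors
  for \<open>l = 1\<close> and \<open>l = 2\<close>.\<close>

definition rising3 :: "real \<Rightarrow> nat \<Rightarrow> real" where
  "rising3 x l = (if l = 1 then 1 / (2 * x * (2 * x - 1)) else if l = 2 then 1 / (2 * x)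
     else pochhammer (2 * x + 1) (l - 3))"

context weights
begin

definition shift :: "'i \<Rightarrow> 'i sfun fps \<Rightarrow> 'i sfun fps" where
  "shift i F = Abs_fps (\<lambda>m. if m = 0 then 0 else (real (a i) / wt (a i)) *\<^sub>R (F $ (m + a i)))"

lemma shift_emb: "shift i (emb f) = emb (joined (a i) f)"
  and shift_add: "shift i (F + F') = shift i F + shift i F'"
  and shift_const: "shift i (fps_const x * F) = fps_const x * shift i F"
  by (auto simp: shift_def joined_def fps_eq_iff scaleR_add_right)

lemma shift_sum: "shift i (\<Sum>j\<in>A. F j) = (\<Sum>j\<in>A. shift i (F j))"
proof -
  have "shift i 0 = 0" by (simp add: shift_def fps_eq_iff)
  then show ?thesis by (induction A rule: infinite_finite_induct) (auto simp: shift_add)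
qed

abbreviation sp :: "'i \<Rightarrow> 'i sfun fps" where "sp i \<equiv> emb (spairing (a i))"
abbreviation ce :: "'i \<Rightarrow> 'i sfun fps" where "ce i \<equiv> fps_const (eh i)"

text \<open>The genus zero series after the substitution of \<open>X \<tau>\<^sup>2\<close> for \<open>X\<close>.\<close>

definition qser :: "'i sfun fps" where
  "qser = emb cat + (\<Sum>i\<in>I. ce i * sp i)"

lemma fps_const_sum: "fps_const (\<Sum>i\<in>A. x i) = (\<Sum>i\<in>A. fps_const (x i))"
  by (induction A rule: infinite_finite_induct) (auto simp flip: fps_const_add)

lemma two_sfun_cancel: "2 * (F :: 'i sfun fps) = 2 * F' \<Longrightarrow> F = F'"
proof (rule fps_ext)
  fix n assume "2 * F = 2 * F'"
  then have "(2 * F) $ n = (2 * F') $ n" by simp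
  then have "2 * F $ n = 2 * F' $ n" by (simp add: numeral_fps_const)
  then have "(2 :: real) *\<^sub>R (F $ n) = (2 :: real) *\<^sub>R (F' $ n)" by (simp only: scaleR_2 mult_2)
  then show "F $ n = F' $ n" by simp
qed

text \<open>The genus zero recursion in rescaled form: the term in \<open>X\<close> is the one-point
  factorization, \<open>shift\<close> describes the joins and the square the cuts into two
  transitive pieces. Sorted by degree in the \<open>eh i\<close>, it is \<open>cat_eq\<close>,
  \<open>spairing_eq\<close> and \<open>joined_spairing\<close>.\<close>

theorem qser_eq:
  "qser = fps_const (\<tau>\<^sup>2) * fps_X + (\<Sum>i\<in>I. ce i * shift i qser) + qser * qser"
proof -
  have sp: "sp i = emb (joined (a i) cat) + 2 * emb cat * sp i - 2 * fps_X" if "i \<in> I" for i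
    using arg_cong[OF spairing_eq[OF a_pos[OF that]], of emb]
    by (simp only: emb_add emb_diff emb_mult emb_numeral emb_X)
  have sp2: "2 * fps_X + emb (joined (a i) (spairing (a j))) + emb (joined (a j) (spairing (a i))) + 2 * sp i * sp j = 0"
    if "i \<in> I" "j \<in> I" for i j
  proof -
    have "emb (2 * fps_X + joined (a i) (spairing (a j)) + joined (a j) (spairing (a i)) + 2 * spairing (a i) * spairing (a j)) = emb 0"
      using joined_spairing[OF a_pos a_pos] that by metis
    then show ?thesis
      unfolding emb_add emb_diff emb_mult emb_numeral emb_X by (simp add: fps_eq_iff)
  qed
  have cat: "emb cat = fps_X + emb cat * emb cat"
    using arg_cong[OF cat_eq, of emb] by (simp only: emb_add emb_mult emb_X)
  let ?s = "\<Sum>i\<in>I. ce i"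
  let ?J = "\<lambda>i j. emb (joined (a i) (spairing (a j)))"
  \<comment> \<open>Only the summand symmetrized in \<open>i\<close> and \<open>j\<close> vanishes,
    so the double sum is added to its copy with the indices exchanged.\<close>
  have quad: "(\<Sum>i\<in>I. \<Sum>j\<in>I. ce i * ce j * (fps_X + ?J i j + sp i * sp j)) = 0" (is "?S = 0")
  proof (rule two_sfun_cancel)
    let ?S' = "\<Sum>i\<in>I. \<Sum>j\<in>I. ce i * ce j * (fps_X + ?J j i + sp i * sp j)"
    have "?S = (\<Sum>j\<in>I. \<Sum>i\<in>I. ce i * ce j * (fps_X + ?J i j + sp i * sp j))"
      by (rule sum.swap)
    also have "\<dots> = ?S'"
    proof (intro sum.cong refl)
      fix i j
      show "ce j * ce i * (fps_X + ?J j i + sp j * sp i) = ce i * ce j * (fps_X + ?J j i + sp i * sp j)"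
        unfolding mult.commute[of "ce j" "ce i"] mult.commute[of "sp j" "sp i"] ..
    qed
    finally have swap: "?S = ?S'" .
    have "2 * ?S = ?S + ?S" by (rule mult_2)
    also have "\<dots> = ?S + ?S'" using swap by (rule arg_cong)
    also have "\<dots> = (\<Sum>i\<in>I. \<Sum>j\<in>I. ce i * ce j * (2 * fps_X + ?J i j + ?J j i + 2 * sp i * sp j))"
      unfolding sum.distrib[symmetric] by (intro sum.cong refl) (simp add: algebra_simps del: fps_const_mult)
    also have "\<dots> = 2 * 0"
      using sp2 by simp
    finally show "2 * ?S = 2 * 0" .
  qed
  have expand: "(1 - s) * (1 - s) * x = x - s * (2 * x) + s * s * x" for s x :: "'i sfun fps"
    by (simp add: algebra_simps)
  have tau: "fps_const (\<tau>\<^sup>2) * fps_X = fps_X - ?s * (2 * fps_X) + ?s * ?s * fps_X"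
  proof -
    have t: "fps_const \<tau> = 1 - ?s"
      unfolding \<tau>_eq fps_const_sub[symmetric] fps_const_sum by simp
    show ?thesis
      unfolding power2_eq_square fps_const_mult[symmetric] t by (rule expand)
  qed
  have shift: "(\<Sum>i\<in>I. ce i * shift i qser) = (\<Sum>i\<in>I. ce i * emb (joined (a i) cat)) + (\<Sum>i\<in>I. \<Sum>j\<in>I. ce i * ce j * ?J i j)"
    unfolding qser_def shift_add shift_sum shift_const shift_emb
    by (simp add: distrib_left sum.distrib sum_distrib_left mult.assoc del: fps_const_mult)
  have sq: "(x + y) * (x + y) = x * x + 2 * (x * y) + y * y" for x y :: "'i sfun fps"
    by (simp add: algebra_simps)
  have sq: "qser * qser = emb cat * emb cat + (\<Sum>i\<in>I. ce i * (2 * emb cat * sp i)) + (\<Sum>i\<in>I. \<Sum>j\<in>I. ce i * ce j * (sp i * sp j))"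
  proof -
    have "(\<Sum>i\<in>I. ce i * sp i) * (\<Sum>i\<in>I. ce i * sp i) = (\<Sum>i\<in>I. \<Sum>j\<in>I. ce i * ce j * (sp i * sp j))"
      unfolding sum_product by (intro sum.cong refl) (simp only: mult_ac)
    moreover have "2 * (emb cat * (\<Sum>i\<in>I. ce i * sp i)) = (\<Sum>i\<in>I. ce i * (2 * emb cat * sp i))"
      unfolding sum_distrib_left by (intro sum.cong refl) (simp only: mult_ac)
    moreover have "qser * qser = emb cat * emb cat + 2 * (emb cat * (\<Sum>i\<in>I. ce i * sp i)) + (\<Sum>i\<in>I. ce i * sp i) * (\<Sum>i\<in>I. ce i * sp i)"
      unfolding qser_def by (rule sq)
    ultimately show ?thesis by simp
  qed
  have s2: "?s * ?s * fps_X = (\<Sum>i\<in>I. \<Sum>j\<in>I. ce i * ce j * fps_X)"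
    unfolding sum_product unfolding sum_distrib_right ..
  have s1: "?s * (2 * fps_X) = (\<Sum>i\<in>I. ce i * (2 * fps_X))"
    by (rule sum_distrib_right)
  have "fps_const (\<tau>\<^sup>2) * fps_X + (\<Sum>i\<in>I. ce i * shift i qser) + qser * qser
    = (fps_X + emb cat * emb cat)
      + ((\<Sum>i\<in>I. ce i * emb (joined (a i) cat)) + (\<Sum>i\<in>I. ce i * (2 * emb cat * sp i)) - (\<Sum>i\<in>I. ce i * (2 * fps_X)))
      + ((\<Sum>i\<in>I. \<Sum>j\<in>I. ce i * ce j * fps_X) + (\<Sum>i\<in>I. \<Sum>j\<in>I. ce i * ce j * ?J i j)
        + (\<Sum>i\<in>I. \<Sum>j\<in>I. ce i * ce j * (sp i * sp j)))"
    unfolding tau shift sq s1 s2 by simp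
  also have "\<dots> = emb cat + (\<Sum>i\<in>I. ce i * (emb (joined (a i) cat) + 2 * emb cat * sp i - 2 * fps_X)) + ?S"
    unfolding cat[symmetric] sum.distrib[symmetric] sum_subtractf[symmetric] distrib_left right_diff_distrib ..
  also have "\<dots> = qser"
    unfolding quad qser_def using sp by simp
  finally show ?thesis by simp
qed

definition Q :: "nat \<Rightarrow> 'i sfun" where
  "Q m = on_I (\<lambda>S. rising3 (real m + tot S) (Suc (card S)))"

text \<open>Dividing \<open>G c\<close> by \<open>c\<close> leaves a plain rising product. For a set
  of \<open>n \<ge> 2\<close> parts the sum over \<open>i\<close> yields the wanted product
  \<open>n\<close> times, and the difference of the last two terms, a backward difference, takes
  away \<open>n - 1\<close> copies. The cases of at most one part fix the continuation in
  \<open>rising3\<close>.\<close>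

lemma Q_expand:
  assumes m: "m > 0"
  shows "Q m = (\<Sum>i\<in>I. (1 / (2 * real m + 2 * real (a i))) *\<^sub>R (eps i * G (2 * int m + 2 * int (a i))))
    - (1 / (2 * real m)) *\<^sub>R G (2 * int m) + (1 / (2 * real m - 1)) *\<^sub>R G (2 * int m - 1)"
proof (rule sfun_eqI)
  fix S :: "'i set" assume S: "finite S"
  define g where "g c S = (if S = {} then 1 else
     of_int c * pochhammer (2 * tot S + of_int c + 1) (card S - 1))" for c :: int and S
  have G: "G c = on_I (g c)" for c
    by (simp add: G_def g_def[abs_def])
  have m1: "real m \<ge> 1" using m by simp
  then have m2: "2 * real m - 1 > 0" by linarith
  let ?r = "\<lambda>i. 1 / (2 * real m + 2 * real (a i))"
  have main: "rising3 (real m + tot S) (Suc (card S)) =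
     (\<Sum>i\<in>S. ?r i * g (2 * int m + 2 * int (a i)) (S - {i}))
     - 1 / (2 * real m) * g (2 * int m) S + 1 / (2 * real m - 1) * g (2 * int m - 1) S"
  proof (cases "card S")
    case 0
    then have "S = {}" using S by simp
    then show ?thesis using m1 m2 by (simp add: g_def rising3_def divide_simps) 
  next
    case (Suc k)
    then have ne: "S \<noteq> {}" by auto
    show ?thesis
    proof (cases k)
      case 0
      then obtain i where "S = {i}" using Suc card_1_singletonE by (metis One_nat_def)
      then show ?thesis using m1 m2 by (simp add: g_def rising3_def tot_def algebra_simps)
    next
      case (Suc j)
      let ?X = "2 * tot S + 2 * real m"
      have c: "card S = Suc (Suc j)" using Suc \<open>card S = Suc k\<close> by simp
      have "(\<Sum>i\<in>S. ?r i * g (2 * int m + 2 * int (a i)) (S - {i})) = (\<Sum>i\<in>S. pochhammer (?X + 1) j)"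
      proof (rule sum.cong)
        fix i assume i: "i \<in> S"
        have ci: "card (S - {i}) = Suc j" using i S c by simp
        then have "S - {i} \<noteq> {}" by (metis card.empty nat.distinct(1))
        then have "g (2 * int m + 2 * int (a i)) (S - {i})
            = (2 * real m + 2 * real (a i)) * pochhammer (?X + 1) j"
          using ci i S by (simp add: g_def tot_remove algebra_simps)
        moreover have "2 * real m + 2 * real (a i) \<noteq> 0" using m by simp
        ultimately show "?r i * g (2 * int m + 2 * int (a i)) (S - {i}) = pochhammer (?X + 1) j"
          by simp
      qed simp
      also have "\<dots> = (real j + 2) * pochhammer (?X + 1) j" using c by simp
      finally have 1: "(\<Sum>i\<in>S. ?r i * g (2 * int m + 2 * int (a i)) (S - {i})) = (real j + 2) * pochhammer (?X + 1) j" .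
      have 2: "1 / (2 * real m) * g (2 * int m) S = pochhammer (?X + 1) j * (?X + 1 + real j)"
        using ne c m1 by (simp add: g_def pochhammer_Suc)
      have 3: "1 / (2 * real m - 1) * g (2 * int m - 1) S = ?X * pochhammer (?X + 1) j"
        using ne c m2 by (simp add: g_def pochhammer_rec)
      have 4: "rising3 (real m + tot S) (Suc (card S)) = pochhammer (?X + 1) j"
        using c by (simp add: rising3_def numeral_3_eq_3 algebra_simps)
      show ?thesis unfolding 1 2 3 4 by (simp add: algebra_simps)
    qed
  qed
  show "val (Q m) S = val ((\<Sum>i\<in>I. ?r i *\<^sub>R (eps i * G (2 * int m + 2 * int (a i))))
    - (1 / (2 * real m)) *\<^sub>R G (2 * int m) + (1 / (2 * real m - 1)) *\<^sub>R G (2 * int m - 1)) S"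
    using main unfolding Q_def G val_simps val_sum_eps_on_I[OF S] by (simp add: val_on_I)
qed

lemma spairing_nth:
  assumes "m > 0"
  shows "spairing b $ m = wt m * (1 / (2 * real m + 2 * real b) - 1 / (2 * real m - 1))"
proof -
  have m1: "2 * real m - 1 > 0" using assms by simp
  have m0: "real m > 0" using assms by simp
  have "(2 * spairing b) $ m = (2 * pairing b - (V - (1 - 2 * cat))) $ m"
    unfolding two_spairing two_cat by simp
  then have "2 * spairing b $ m = 2 * pairing b $ m - (cbin m + 2 * cat $ m)"
    using assms by (simp add: numeral_fps_const)
  then have "spairing b $ m = pairing b $ m - (cbin m + 2 * cat $ m) / 2"
    unfolding add_divide_distrib by linarith
  also have "2 * cat $ m = cbin m / (2 * real m - 1)"
    unfolding cat_nth[OF assms] using m1 by (simp add: field_simps)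
  also have "pairing b $ m = wt m / (2 * real m + 2 * real b)"
    by (simp add: pairing_def)
  also have "(cbin m + cbin m / (2 * real m - 1)) / 2 = wt m / (2 * real m - 1)"
    using m1 by (simp add: wt_def field_simps)
  finally show ?thesis by (simp add: algebra_simps)
qed

text \<open>The factor \<open>G (2 * int m)\<close> undoes the rescaling of \<open>X\<close>.
  Writing \<tau> as 1 minus the sum of the \<open>eh i\<close> in the term
  \<open>G (2 * int m - 1)\<close> distributes its coefficient over the \<open>eh i\<close>, which
  produces the correction in \<open>spairing\<close>.\<close>

lemma qser_nth:
  assumes m: "m > 0"
  shows "wt m *\<^sub>R Q m = G (2 * int m) * qser $ m"
proof -
  have m1: "2 * real m - 1 > 0" using m by simp
  have m0: "real m > 0" using m by simp
  have 1: "eps i * G (2 * int m + 2 * int (a i)) = G (2 * int m) * eh i" for i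
    using eps_G[of i "2 * int m"] mult.commute by metis
  have "G (2 * int m - 1) = G (2 * int m) * (1 - (\<Sum>i\<in>I. eh i))"
    unfolding \<tau>_eq[symmetric] \<tau>_def G_mult by simp
  then have 2: "G (2 * int m - 1) = G (2 * int m) - (\<Sum>i\<in>I. G (2 * int m) * eh i)"
    by (simp only: right_diff_distrib mult_1_right sum_distrib_left)
  have cat: "cat $ m = wt m * (1 / (2 * real m - 1) - 1 / (2 * real m))"
    unfolding cat_nth[OF m] wt_def using m1 m0 by (simp add: field_simps)
  have q: "qser $ m = (cat $ m) *\<^sub>R 1 + (\<Sum>i\<in>I. (spairing (a i) $ m) *\<^sub>R eh i)"
    by (simp add: qser_def fps_sum_nth)
  have "G (2 * int m) * qser $ m = (cat $ m) *\<^sub>R G (2 * int m) + (\<Sum>i\<in>I. (spairing (a i) $ m) *\<^sub>R (G (2 * int m) * eh i))"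
    unfolding q by (simp add: distrib_left sum_distrib_left)
  moreover have "wt m *\<^sub>R Q m = (cat $ m) *\<^sub>R G (2 * int m) + (\<Sum>i\<in>I. (spairing (a i) $ m) *\<^sub>R (G (2 * int m) * eh i))"
    unfolding Q_expand[OF m] 1 2 cat spairing_nth[OF m]
    by (simp add: right_diff_distrib scaleR_diff_left scaleR_diff_right scaleR_add_right scaleR_sum_right sum_subtractf)
  ultimately show ?thesis by simp
qed

end

section \<open>Genus one\<close>

lemma numeral_mult_nth: "(numeral w * F) $ n = numeral w * (F :: 'b :: comm_ring_1 fps) $ n"
  by (simp add: numeral_fps_const)

text \<open>As polynomial coefficients, so that sums over a removed index come from the product rule
  for \<open>pderiv\<close>.\<close>

definition esym :: "('i \<Rightarrow> real) \<Rightarrow> 'i set \<Rightarrow> nat \<Rightarrow> real" where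
  "esym x S k = coeff (\<Prod>i\<in>S. [:1, x i:]) k"

lemma esym_0: "esym x S 0 = 1"
  by (simp add: esym_def coeff_0_prod_list poly_prod flip: poly_0_coeff_0)

lemma esym_remove:
  assumes "finite S" "i \<in> S"
  shows "esym x S (Suc k) = esym x (S - {i}) (Suc k) + x i * esym x (S - {i}) k"
  unfolding esym_def by (subst prod.remove[OF assms]) simp

lemma esym_beyond: "finite S \<Longrightarrow> k > card S \<Longrightarrow> esym x S k = 0"
proof -
  assume "finite S" "k > card S"
  have "degree (\<Prod>i\<in>S. [:1, x i:]) \<le> (\<Sum>i\<in>S. degree [:1, x i:])"
    using degree_prod_sum_le[OF \<open>finite S\<close>, of "\<lambda>i. [:1, x i:]"] by (simp add: o_def)
  also have "\<dots> \<le> (\<Sum>i\<in>S. 1)" by (rule sum_mono) simp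
  finally show ?thesis unfolding esym_def using \<open>k > card S\<close> by (intro coeff_eq_0) simp
qed

lemma sum_esym:
  assumes "finite S"
  shows "(\<Sum>i\<in>S. x i * esym x (S - {i}) k) = real (Suc k) * esym x S (Suc k)"
proof -
  have "real (Suc k) * esym x S (Suc k) = coeff (pderiv (\<Prod>i\<in>S. [:1, x i:])) k"
    by (simp add: esym_def coeff_pderiv)
  also have "\<dots> = (\<Sum>i\<in>S. x i * esym x (S - {i}) k)"
    unfolding pderiv_prod by (simp add: coeff_sum esym_def pderiv_pCons mult.commute)
  finally show ?thesis by simp
qed

lemma esym_1: "finite S \<Longrightarrow> esym x S 1 = sum x S"
  using sum_esym[of S x 0] by (simp add: esym_0)

lemma sum_square_esym:
  assumes "finite S"
  shows "(\<Sum>i\<in>S. x i * x i * esym x (S - {i}) k) =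
    sum x S * esym x S (Suc k) - real (Suc (Suc k)) * esym x S (Suc (Suc k))"
proof -
  have "(\<Sum>i\<in>S. x i * x i * esym x (S - {i}) k) =
    (\<Sum>i\<in>S. x i * esym x S (Suc k) - x i * esym x (S - {i}) (Suc k))"
    using esym_remove[OF assms] by (intro sum.cong refl) (simp add: algebra_simps)
  then show ?thesis
    by (simp add: sum_subtractf sum_esym[OF assms] flip: sum_distrib_right)
qed

text \<open>The bracket of the theorem for an arbitrary sequence in place of the elementary
  symmetric polynomials, so that one variable can be split off.\<close>

definition torus :: "real \<Rightarrow> nat \<Rightarrow> (nat \<Rightarrow> real) \<Rightarrow> real" where
  "torus z l e = pochhammer z l - 3 * pochhammer z (l - 1)
    - (\<Sum>k = 2..l. fact (k - 2) * pochhammer z (l - k) * e k)"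

text \<open>Splits the distinguished variable \<open>y\<close> off the bracket, after which it
  occurs in the first term only. For elementary symmetric polynomials of the variables
  \<open>x i\<close>, the parenthesis on the right is the sum of \<open>x i * (x i - 1)\<close>
  times the polynomial of degree \<open>j\<close> without \<open>x i\<close>, by
  \<open>sum_square_esym\<close> and \<open>sum_esym\<close>; this reveals \<open>J\<close>.\<close>

lemma torus_step:
  fixes e :: "nat \<Rightarrow> real"
  assumes e: "e 0 = 1" "e (Suc n) = 0" and n: "n > 0" and y: "y = z - e 1 + real n"
  shows "torus z (Suc n) (\<lambda>k. e k + y * e (k - 1)) = (y - 3) * pochhammer z n
    + (\<Sum>j<n. fact j * (e 1 * e (Suc j) - real (Suc (Suc j)) * e (Suc (Suc j)) - real (Suc j) * e (Suc j)) * pochhammer z (n - 1 - j))"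
proof -
  define p where "p = pochhammer z"
  have p_Suc: "p (Suc k) = p k * (z + real k)" for k
    by (simp add: p_def pochhammer_Suc)
  obtain n' where n': "n = Suc n'" using n by (cases n) auto
  define A where "A = (\<Sum>j<n. fact j * p (n - 1 - j) * e (Suc (Suc j)))"
  define B where "B = (\<Sum>j<n. fact j * p (n - 1 - j) * e (Suc j))"
  define A' where "A' = (\<Sum>j<n. fact j * real (Suc (Suc j)) * p (n - 1 - j) * e (Suc (Suc j)))"
  define B' where "B' = (\<Sum>j<n. fact j * real (Suc j) * p (n - 1 - j) * e (Suc j))"
  have "(\<Sum>k = 2..Suc n. fact (k - 2) * p (Suc n - k) * (e k + y * e (k - 1)))
      = (\<Sum>j<n. fact j * p (n - 1 - j) * (e (Suc (Suc j)) + y * e (Suc j)))"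
    by (rule sum.reindex_bij_witness[of _ "\<lambda>j. j + 2" "\<lambda>k. k - 2"])
      (auto simp: Suc_diff_Suc numeral_2_eq_2 Suc_diff_le)
  also have "\<dots> = A + y * B"
    unfolding A_def B_def by (simp add: distrib_left sum.distrib sum_distrib_left mult_ac)
  finally have L: "torus z (Suc n) (\<lambda>k. e k + y * e (k - 1)) = p (Suc n) - 3 * p n - (A + y * B)"
    by (simp add: torus_def p_def)
  have R: "(\<Sum>j<n. fact j * (e 1 * e (Suc j) - real (Suc (Suc j)) * e (Suc (Suc j)) - real (Suc j) * e (Suc j)) * p (n - 1 - j))
      = e 1 * B - A' - B'"
    unfolding A'_def B_def B'_def
    by (simp add: algebra_simps sum_subtractf sum.distrib sum_distrib_left)
  have A: "A' - A = (\<Sum>j<n. fact (Suc j) * p (n - 1 - j) * e (Suc (Suc j)))"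
    unfolding A'_def A_def sum_subtractf[symmetric] by (intro sum.cong refl) (simp add: algebra_simps)
  have B: "(z + real n) * B - B' = (\<Sum>j<n. fact j * p (n - j) * e (Suc j))"
    unfolding B'_def B_def sum_distrib_left sum_subtractf[symmetric]
  proof (intro sum.cong refl)
    fix j assume "j \<in> {..<n}"
    then have "n - j = Suc (n - 1 - j)" "real (n - 1 - j) = real n - 1 - real j" by auto
    then have p: "p (n - j) = p (n - 1 - j) * (z + (real n - 1 - real j))" using p_Suc by metis
    show "(z + real n) * (fact j * p (n - 1 - j) * e (Suc j)) - fact j * real (Suc j) * p (n - 1 - j) * e (Suc j)
      = fact j * p (n - j) * e (Suc j)"
      unfolding p by (simp add: algebra_simps)
  qed
  have "(\<Sum>j<n. fact j * p (n - j) * e (Suc j)) = p n * e 1 + (\<Sum>j<n'. fact (Suc j) * p (n' - j) * e (Suc (Suc j)))"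
    unfolding n' by (subst sum.lessThan_Suc_shift) simp
  \<comment> \<open>The left sum has one more summand, and that one contains
    \<open>e (Suc n) = 0\<close>.\<close>
  moreover have "(\<Sum>j<n. fact (Suc j) * p (n - 1 - j) * e (Suc (Suc j))) = (\<Sum>j<n'. fact (Suc j) * p (n' - j) * e (Suc (Suc j)))"
    unfolding n' using e(2) n' by simp
  ultimately have "(z + real n) * B - B' = p n * e 1 + (A' - A)" using A B by simp
  then show ?thesis
    unfolding L p_def[symmetric] R unfolding y p_Suc by (simp add: algebra_simps)
qed

context weights
begin

lemma qser_0: "qser $ 0 = 0"
  by (simp add: qser_def fps_sum_nth cat_def U_def spairing_def pairing_def)

lemma mult_nth_inner:
  assumes "F $ 0 = 0" "F' $ 0 = (0 :: 'b :: comm_ring_1)"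
  shows "(F * F') $ m = (\<Sum>k=1..<m. F $ k * F' $ (m - k))"
  unfolding fps_mult_nth using assms
  by (intro sum.mono_neutral_right) (auto simp: le_less not_less_eq_eq Suc_le_eq)

lemma G_eps_shift:
  "G (2 * int m) * (eh i * x) = eps i * (G (2 * int (m + a i)) * x)"
  using eps_G[of i "2 * int m"] by (simp add: mult_ac)

lemma G_split:
  assumes "k \<in> {1..<m}"
  shows "G (2 * int m) = G (2 * int k) * G (2 * int (m - k))"
  using assms unfolding G_mult by (simp add: algebra_simps of_nat_diff)

text \<open>Multiplying the \<open>m\<close>-th coefficient of \<open>qser_eq\<close> by
  \<open>G (2 * int m)\<close> returns to the original series; for \<open>m = 1\<close> it cancels
  the square of \<tau>.\<close>

theorem Q_rec:
  assumes m: "m > 0"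
  shows "wt m *\<^sub>R Q m = (if m = 1 then 1 else 0)
    + (\<Sum>i\<in>I. (real (a i) / wt (a i) * wt (m + a i)) *\<^sub>R (eps i * Q (m + a i)))
    + (\<Sum>k=1..<m. (wt k * wt (m - k)) *\<^sub>R (Q k * Q (m - k)))"
proof -
  have q: "qser $ m = (if m = 1 then \<tau>\<^sup>2 else 0)
    + (\<Sum>i\<in>I. eh i * ((real (a i) / wt (a i)) *\<^sub>R (qser $ (m + a i))))
    + (\<Sum>k=1..<m. qser $ k * qser $ (m - k))"
    by (subst qser_eq, simp add: fps_sum_nth shift_def mult_nth_inner[OF qser_0 qser_0]) (use m in simp)
  have 1: "G (2 * int m) * (if m = 1 then \<tau>\<^sup>2 else 0) = (if m = 1 then 1 else 0)"
    by (simp add: \<tau>_def power2_eq_square G_mult G_0)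
  have 2: "G (2 * int m) * (eh i * ((real (a i) / wt (a i)) *\<^sub>R (qser $ (m + a i))))
    = (real (a i) / wt (a i) * wt (m + a i)) *\<^sub>R (eps i * Q (m + a i))" for i
  proof -
    have "G (2 * int (m + a i)) * qser $ (m + a i) = wt (m + a i) *\<^sub>R Q (m + a i)"
      using qser_nth[of "m + a i"] m by simp
    then show ?thesis unfolding G_eps_shift mult_scaleR_right by (simp only: mult_scaleR_right scaleR_scaleR)
  qed
  have 3: "G (2 * int m) * (qser $ k * qser $ (m - k)) = (wt k * wt (m - k)) *\<^sub>R (Q k * Q (m - k))"
    if k: "k \<in> {1..<m}" for k
  proof -
    have "G (2 * int m) * (qser $ k * qser $ (m - k)) = (G (2 * int k) * qser $ k) * (G (2 * int (m - k)) * qser $ (m - k))"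
      unfolding G_split[OF k] by (simp only: mult_ac)
    also have "\<dots> = (wt k *\<^sub>R Q k) * (wt (m - k) *\<^sub>R Q (m - k))"
      using k by (simp add: qser_nth)
    finally show ?thesis by simp
  qed
  show ?thesis
    unfolding qser_nth[OF m] by (subst q) (simp only: distrib_left 1 sum_distrib_left 2 3 cong: sum.cong)
qed

abbreviation x :: "'i \<Rightarrow> real" where "x i \<equiv> 2 * real (a i) + 1"

text \<open>\<open>H c\<close> and \<open>J c\<close> are \<open>G (c - 1)\<close> divided by \<open>1 - \<kappa>\<close> and \<open>(1 - \<kappa>)\<^sup>2\<close>.\<close>

definition H :: "int \<Rightarrow> 'i sfun" where
  "H c = on_I (\<lambda>S. pochhammer (2 * tot S + of_int c) (card S))"

definition J :: "int \<Rightarrow> 'i sfun" where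
  "J c = on_I (\<lambda>S. \<Sum>j\<le>card S. fact j * esym x S j * pochhammer (2 * tot S + of_int c) (card S - j))"

lemma sum_x: "sum x S = 2 * tot S + real (card S)"
  by (simp add: tot_def sum.distrib sum_distrib_left)

lemma H_eq: "H c = G (c - 1) + (\<Sum>i\<in>I. x i *\<^sub>R (eps i * H (c + 2 * int (a i))))"
proof (rule sfun_eqI)
  fix S :: "'i set" assume S: "finite S"
  define Y where "Y = 2 * tot S + of_int c"
  have "(\<Sum>i\<in>S. x i * pochhammer (2 * tot (S - {i}) + of_int (c + 2 * int (a i))) (card (S - {i})))
     = (\<Sum>i\<in>S. x i * pochhammer Y (card S - 1))"
    using S by (intro sum.cong) (auto simp: Y_def tot_remove)
  also have "\<dots> = (2 * tot S + real (card S)) * pochhammer Y (card S - 1)"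
    unfolding sum_distrib_right[symmetric] sum_x ..
  finally have 1: "(\<Sum>i\<in>S. x i * pochhammer (2 * tot (S - {i}) + of_int (c + 2 * int (a i))) (card (S - {i})))
     = (2 * tot S + real (card S)) * pochhammer Y (card S - 1)" .
  have "pochhammer Y (card S) = (if S = {} then 1 else of_int (c - 1) * pochhammer Y (card S - 1))
     + (2 * tot S + real (card S)) * pochhammer Y (card S - 1)"
  proof (cases "card S")
    case 0 then show ?thesis using S by simp
  next
    case (Suc k)
    then have "S \<noteq> {}" by auto
    then show ?thesis using Suc by (simp add: pochhammer_Suc Y_def algebra_simps)
  qed
  then show "val (H c) S = val (G (c - 1) + (\<Sum>i\<in>I. x i *\<^sub>R (eps i * H (c + 2 * int (a i))))) S"
    unfolding H_def val_simps val_sum_eps_on_I[OF S] 1 G_def by (auto simp: val_on_I 1 Y_def)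
qed

text \<open>The sum over \<open>j\<close> is a geometric series: its \<open>j\<close>-th summand is
  the value of \<open>\<kappa> ^ j * H c\<close>. Indeed \<open>j\<close> factors
  \<open>eps i\<close> select a subset of size \<open>j\<close> in \<open>j!\<close> orders, and the
  accompanying shifts of \<open>c\<close> restore the full total of the set.\<close>

lemma J_eq: "J c = H c + (\<Sum>i\<in>I. x i *\<^sub>R (eps i * J (c + 2 * int (a i))))"
proof (rule sfun_eqI)
  fix S :: "'i set" assume S: "finite S"
  define Y where "Y = 2 * tot S + of_int c"
  define j where "j c S = (\<Sum>j\<le>card S. fact j * esym x S j * pochhammer (2 * tot S + of_int c) (card S - j))" for c :: int and S
  have J: "J c = on_I (j c)" for c by (simp add: J_def j_def[abs_def])
  have main: "j c S = pochhammer Y (card S) + (\<Sum>i\<in>S. x i * j (c + 2 * int (a i)) (S - {i}))"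
  proof (cases "card S")
    case 0
    then show ?thesis using S by (simp add: j_def Y_def esym_0)
  next
    case (Suc k)
    have "(\<Sum>i\<in>S. x i * j (c + 2 * int (a i)) (S - {i}))
      = (\<Sum>i\<in>S. \<Sum>l\<le>k. fact l * pochhammer Y (k - l) * (x i * esym x (S - {i}) l))"
    proof (rule sum.cong)
      fix i assume i: "i \<in> S"
      then have c: "card (S - {i}) = k" using S Suc by simp
      have t: "2 * tot (S - {i}) + of_int (c + 2 * int (a i)) = Y" using i S by (simp add: Y_def tot_remove)
      show "x i * j (c + 2 * int (a i)) (S - {i}) = (\<Sum>l\<le>k. fact l * pochhammer Y (k - l) * (x i * esym x (S - {i}) l))"
        unfolding j_def c t sum_distrib_left by (intro sum.cong refl) simp
    qed simp
    also have "\<dots> = (\<Sum>l\<le>k. \<Sum>i\<in>S. fact l * pochhammer Y (k - l) * (x i * esym x (S - {i}) l))"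
      by (rule sum.swap)
    also have "\<dots> = (\<Sum>l\<le>k. fact l * pochhammer Y (k - l) * (real (Suc l) * esym x S (Suc l)))"
      unfolding sum_distrib_left[symmetric] sum_esym[OF S] ..
    also have "\<dots> = (\<Sum>l\<le>k. fact (Suc l) * esym x S (Suc l) * pochhammer Y (k - l))"
      by (intro sum.cong refl) simp
    finally show ?thesis
      unfolding j_def Suc sum.atMost_Suc_shift by (simp add: esym_0 Y_def)
  qed
  show "val (J c) S = val (H c + (\<Sum>i\<in>I. x i *\<^sub>R (eps i * J (c + 2 * int (a i))))) S"
    using main unfolding J val_simps val_sum_eps_on_I[OF S] by (simp add: val_on_I H_def Y_def)
qed

lemma H_G: "H c * G c' = H (c + c')"
proof (rule G_transfer[of H "\<lambda>c. G (c - 1)" x])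
  show "H c = G (c - 1) + (\<Sum>i\<in>I. x i *\<^sub>R (eps i * H (c + 2 * int (a i))))" for c
    by (rule H_eq)
  show "G (c - 1) * G c' = G (c + c' - 1)" for c c'
    unfolding G_mult by (simp add: algebra_simps)
qed

lemma J_G: "J c * G c' = J (c + c')"
  by (rule G_transfer[of J H x], rule J_eq, rule H_G)

section \<open>The genus one series and its linear equation\<close>

definition \<iota> :: "'i sfun" where "\<iota> = H 1"
definition \<kappa> :: "'i sfun" where "\<kappa> = (\<Sum>i\<in>I. x i *\<^sub>R eh i)"
definition \<kappa>2 :: "'i sfun" where "\<kappa>2 = (\<Sum>i\<in>I. (x i * (x i - 1)) *\<^sub>R eh i)"

lemma H_\<iota>: "H c = G (c - 1) * \<iota>"
  using H_G[of 1 "c - 1"] by (simp add: \<iota>_def mult.commute)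

lemma \<iota>_eq: "\<iota> = 1 + \<kappa> * \<iota>"
proof -
  have 1: "eps i * H (1 + 2 * int (a i)) = eh i * \<iota>" for i
    unfolding H_\<iota> eh_def by (simp add: mult.assoc)
  have "\<iota> = G 0 + (\<Sum>i\<in>I. x i *\<^sub>R (eps i * H (1 + 2 * int (a i))))"
    unfolding \<iota>_def by (subst H_eq) simp
  then show ?thesis
    unfolding 1 G_0 \<kappa>_def sum_distrib_right mult_scaleR_left .
qed

lemma J_\<iota>: "J c = G (c - 1) * \<iota>\<^sup>2"
proof -
  have 1: "eps i * J (1 + 2 * int (a i)) = eh i * J 1" for i
    unfolding J_G[symmetric] eh_def by (simp only: mult_ac)
  have "J 1 = \<iota> + (\<Sum>i\<in>I. x i *\<^sub>R (eps i * J (1 + 2 * int (a i))))"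
    unfolding \<iota>_def by (rule J_eq)
  then have J1: "J 1 = \<iota> + \<kappa> * J 1"
    unfolding 1 \<kappa>_def sum_distrib_right mult_scaleR_left .
  have "J 1 = \<iota> * J 1 - \<kappa> * \<iota> * J 1"
  proof -
    have "\<iota> * J 1 = 1 * J 1 + \<kappa> * \<iota> * J 1"
      unfolding distrib_right[symmetric] using \<iota>_eq by (rule arg_cong)
    then show ?thesis by (simp only: mult_1_left add_diff_cancel_right')
  qed
  also have "\<dots> = \<iota> * (J 1 - \<kappa> * J 1)" by (simp add: algebra_simps)
  also have "J 1 - \<kappa> * J 1 = \<iota>" using J1 by (metis add_diff_cancel_right')
  finally have "J 1 = \<iota>\<^sup>2" by (simp add: power2_eq_square)
  then show ?thesis using J_G[of 1 "c - 1"] by (simp add: mult.commute)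
qed

text \<open>The genus one numbers times 24, with the weights divided out. The truncated
  \<open>k - 1\<close> at \<open>k = 0\<close> is harmless, as \<open>torus\<close> reads the
  sequence from 2 on.\<close>

definition R :: "nat \<Rightarrow> 'i sfun" where
  "R m = on_I (\<lambda>S. torus (2 * (real m + tot S) + 1) (Suc (card S))
     (\<lambda>k. esym x S k + (2 * real m + 1) * esym x S (k - 1)))"

lemma R_expand:
  "R m = (2 * real m - 2) *\<^sub>R H (2 * int m + 1)
    + (\<Sum>i\<in>I. (x i * (x i - 1)) *\<^sub>R (eps i * J (2 * int m + 1 + 2 * int (a i))))"
proof (rule sfun_eqI)
  fix S :: "'i set" assume S: "finite S"
  define Z where "Z = 2 * (real m + tot S) + 1"
  define j where "j c S = (\<Sum>j\<le>card S. fact j * esym x S j * pochhammer (2 * tot S + of_int c) (card S - j))" for c :: int and S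
  have J: "J c = on_I (j c)" for c by (simp add: J_def j_def[abs_def])
  have main: "torus Z (Suc (card S)) (\<lambda>k. esym x S k + (2 * real m + 1) * esym x S (k - 1))
    = (2 * real m - 2) * pochhammer Z (card S)
     + (\<Sum>i\<in>S. x i * (x i - 1) * j (2 * int m + 1 + 2 * int (a i)) (S - {i}))"
  proof (cases "card S")
    case 0
    then show ?thesis using S by (simp add: torus_def Z_def)
  next
    case (Suc k)
    have "(\<Sum>i\<in>S. x i * (x i - 1) * j (2 * int m + 1 + 2 * int (a i)) (S - {i}))
      = (\<Sum>i\<in>S. \<Sum>l<Suc k. fact l * pochhammer Z (k - l) * (x i * x i * esym x (S - {i}) l - x i * esym x (S - {i}) l))"
    proof (rule sum.cong)
      fix i assume i: "i \<in> S"
      then have c: "card (S - {i}) = k" using S Suc by simp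
      have t: "2 * tot (S - {i}) + of_int (2 * int m + 1 + 2 * int (a i)) = Z"
        using i S by (simp add: Z_def tot_remove algebra_simps)
      show "x i * (x i - 1) * j (2 * int m + 1 + 2 * int (a i)) (S - {i})
        = (\<Sum>l<Suc k. fact l * pochhammer Z (k - l) * (x i * x i * esym x (S - {i}) l - x i * esym x (S - {i}) l))"
        unfolding j_def c t sum_distrib_left lessThan_Suc_atMost
        by (intro sum.cong refl) (simp add: algebra_simps)
    qed simp
    also have "\<dots> = (\<Sum>l<Suc k. fact l * pochhammer Z (k - l) *
       (sum x S * esym x S (Suc l) - real (Suc (Suc l)) * esym x S (Suc (Suc l)) - real (Suc l) * esym x S (Suc l)))"
      by (subst sum.swap)
        (simp only: sum_distrib_left[symmetric] sum_subtractf sum_esym[OF S] sum_square_esym[OF S])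
    finally have s: "(\<Sum>i\<in>S. x i * (x i - 1) * j (2 * int m + 1 + 2 * int (a i)) (S - {i}))
      = (\<Sum>l<card S. fact l * (esym x S 1 * esym x S (Suc l) - real (Suc (Suc l)) * esym x S (Suc (Suc l)) - real (Suc l) * esym x S (Suc l))
          * pochhammer Z (card S - 1 - l))"
      unfolding Suc esym_1[OF S] by (simp only: mult_ac diff_Suc_1)
    have "2 * real m + 1 = Z - esym x S 1 + real (card S)"
      unfolding esym_1[OF S] sum_x Z_def by simp
    from torus_step[OF esym_0 _ _ this] show ?thesis
      unfolding s using esym_beyond[OF S] Suc by simp
  qed
  show "val (R m) S = val ((2 * real m - 2) *\<^sub>R H (2 * int m + 1)
    + (\<Sum>i\<in>I. (x i * (x i - 1)) *\<^sub>R (eps i * J (2 * int m + 1 + 2 * int (a i))))) S"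
    using main unfolding J val_simps val_sum_eps_on_I[OF S] by (simp add: val_on_I R_def H_def Z_def algebra_simps)
qed

text \<open>By \<open>R_expand\<close>, \<open>R m\<close> depends on \<open>m\<close>, apart from
  \<open>G (2 * int m)\<close>, through the factors \<open>2 * m - 2\<close> and 1 only; with the
  weight \<open>wt m\<close> these are the coefficients of \<open>tor\<close> and
  \<open>D V\<close>.\<close>

definition wser :: "'i sfun fps" where
  "wser = fps_const \<iota> * emb tor + fps_const (\<kappa>2 * \<iota>\<^sup>2) * emb (D V)"

lemma wser_nth: "wt m *\<^sub>R R m = G (2 * int m) * wser $ m"
proof -
  have "tor $ m = wt m * (2 * real m - 2)"
    by (simp add: tor_def numeral_fps_const wt_def algebra_simps)
  then have w: "wser $ m = wt m *\<^sub>R ((2 * real m - 2) *\<^sub>R \<iota> + \<kappa>2 * \<iota>\<^sup>2)"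
    by (simp add: wser_def D_V_nth scaleR_add_right del: fps_XD_nth)
  have "eps i * J (2 * int m + 1 + 2 * int (a i)) = G (2 * int m) * (eh i * \<iota>\<^sup>2)" for i
  proof -
    have "J (2 * int m + 1 + 2 * int (a i)) = G (2 * int (m + a i)) * \<iota>\<^sup>2"
      unfolding J_\<iota> by (simp add: algebra_simps)
    then show ?thesis unfolding G_eps_shift by simp
  qed
  then have "R m = G (2 * int m) * ((2 * real m - 2) *\<^sub>R \<iota> + \<kappa>2 * \<iota>\<^sup>2)"
    unfolding R_expand \<kappa>2_def by (simp add: H_\<iota> distrib_left sum_distrib_left sum_distrib_right)
  then show ?thesis unfolding w by simp
qed

text \<open>On the left stands the linearized genus zero equation. The terms in \<open>disc\<close>
  cancel and its square survives with coefficient 1, both because \<open>1 - \<kappa>\<close> is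
  inverse to \<iota>.\<close>

lemma wser_eq:
  "2 * (wser - 2 * (qser * wser) - (\<Sum>i\<in>I. ce i * shift i wser)) = 3 * emb (disc\<^sup>2)"
proof -
  let ?P = "emb (disc\<^sup>2) :: 'i sfun fps" and ?L = "emb disc :: 'i sfun fps"
  let ?i = "fps_const \<iota>" and ?k = "fps_const (\<kappa>2 * \<iota>\<^sup>2)"
  let ?cat = "emb cat :: 'i sfun fps" and ?tor = "emb tor :: 'i sfun fps" and ?DV = "emb (D V) :: 'i sfun fps"
  have t0: "2 * (?tor - 2 * ?cat * ?tor) = 3 * ?P"
    using arg_cong[OF cat_tor, of emb] by (simp only: emb_diff emb_mult emb_numeral)
  have d0: "2 * (?DV - 2 * ?cat * ?DV) = ?L"
    using arg_cong[OF cat_D_V, of emb] by (simp only: emb_diff emb_mult emb_numeral)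
  have t1: "2 * (emb (joined (a i) tor) + 2 * sp i * ?tor)
    = fps_const (x i *\<^sub>R 1) * (3 * ?P) + fps_const ((x i * (x i - 1)) *\<^sub>R 1) * ?L" if "i \<in> I" for i
  proof -
    have "3 + 6 * fps_const (real (a i)) = 3 * fps_const (x i)"
      by (simp add: fps_eq_iff numeral_fps_const)
    moreover have "4 * (fps_const (real (a i)))\<^sup>2 + 2 * fps_const (real (a i)) = fps_const (x i * (x i - 1))"
      by (simp add: fps_eq_iff numeral_fps_const power2_eq_square algebra_simps)
    ultimately have "2 * (joined (a i) tor + 2 * spairing (a i) * tor)
      = fps_const (x i) * (3 * disc\<^sup>2) + fps_const (x i * (x i - 1)) * disc"
      using spairing_tor[OF a_pos[OF that]] by (simp only: mult_ac)
    from arg_cong[OF this, of emb] show ?thesis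
      by (simp only: emb_add emb_mult emb_numeral emb_const)
  qed
  have d1: "2 * (emb (joined (a i) (D V)) + 2 * sp i * ?DV) = fps_const (x i *\<^sub>R 1) * ?L" if "i \<in> I" for i
  proof -
    have "1 + 2 * fps_const (real (a i)) = fps_const (x i)"
      by (simp add: fps_eq_iff numeral_fps_const)
    then have "2 * (joined (a i) (D V) + 2 * spairing (a i) * D V) = fps_const (x i) * disc"
      using spairing_D_V[OF a_pos[OF that]] by simp
    from arg_cong[OF this, of emb] show ?thesis
      by (simp only: emb_add emb_mult emb_numeral emb_const)
  qed
  have qw: "qser * wser = ?cat * wser + (\<Sum>i\<in>I. ce i * (sp i * wser))"
    unfolding qser_def distrib_right sum_distrib_right mult.assoc ..
  have trm: "2 * (ce i * shift i wser + 2 * (ce i * (sp i * wser)))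
    = ce i * fps_const (x i *\<^sub>R 1) * (?i * (3 * ?P) + ?k * ?L)
      + ce i * fps_const ((x i * (x i - 1)) *\<^sub>R 1) * (?i * ?L)" if "i \<in> I" for i
  proof -
    have gen: "2 * (c * (p * jt + q * jd) + 2 * (c * (s * (p * t + q * d))))
      = c * (p * (2 * (jt + 2 * s * t)) + q * (2 * (jd + 2 * s * d)))" for c p jt q jd s t d :: "'i sfun fps"
      by (simp add: algebra_simps)
    have gen2: "c * (p * (u * P3 + w * L) + q * (u * L)) = c * u * (p * P3 + q * L) + c * w * (p * L)"
      for c p u P3 w L q :: "'i sfun fps"
      by (simp add: algebra_simps)
    have "shift i wser = ?i * emb (joined (a i) tor) + ?k * emb (joined (a i) (D V))"
      unfolding wser_def shift_add shift_const shift_emb ..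
    then have "2 * (ce i * shift i wser + 2 * (ce i * (sp i * wser)))
      = ce i * (?i * (2 * (emb (joined (a i) tor) + 2 * sp i * ?tor)) + ?k * (2 * (emb (joined (a i) (D V)) + 2 * sp i * ?DV)))"
      unfolding wser_def by (simp only: gen)
    then show ?thesis unfolding t1[OF that] d1[OF that] gen2 .
  qed
  have k: "fps_const \<kappa> = (\<Sum>i\<in>I. ce i * fps_const (x i *\<^sub>R 1))"
    and k2: "fps_const \<kappa>2 = (\<Sum>i\<in>I. ce i * fps_const ((x i * (x i - 1)) *\<^sub>R 1))"
    unfolding \<kappa>_def \<kappa>2_def fps_const_sum by simp_all
  have "2 * (wser - 2 * (qser * wser) - (\<Sum>i\<in>I. ce i * shift i wser))
    = 2 * (wser - 2 * ?cat * wser) - (\<Sum>i\<in>I. 2 * (ce i * shift i wser + 2 * (ce i * (sp i * wser))))"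
    unfolding qw by (simp add: algebra_simps sum.distrib sum_distrib_left)
  also have "(\<Sum>i\<in>I. 2 * (ce i * shift i wser + 2 * (ce i * (sp i * wser))))
    = fps_const \<kappa> * (?i * (3 * ?P) + ?k * ?L) + fps_const \<kappa>2 * (?i * ?L)"
    unfolding k k2 sum_distrib_right sum.distrib[symmetric] using trm by (intro sum.cong refl)
  also have "2 * (wser - 2 * ?cat * wser) = ?i * (3 * ?P) + ?k * ?L"
  proof -
    have gen: "2 * (p * t + q * d - 2 * c * (p * t + q * d)) = p * (2 * (t - 2 * c * t)) + q * (2 * (d - 2 * c * d))"
      for p t q d c :: "'i sfun fps" by (simp add: algebra_simps)
    show ?thesis unfolding wser_def gen t0 d0 ..
  qed
  also have "?i * (3 * ?P) + ?k * ?L - (fps_const \<kappa> * (?i * (3 * ?P) + ?k * ?L) + fps_const \<kappa>2 * (?i * ?L)) = 3 * ?P"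
  proof -
    have i: "?i - fps_const \<kappa> * ?i = 1"
      using \<iota>_eq by (metis add_diff_cancel_right' fps_const_1_eq_1 fps_const_mult fps_const_sub)
    have gen: "i * P + k2 * (i * i) * L - (k * (i * P + k2 * (i * i) * L) + k2 * (i * L))
      = (i - k * i) * P + (k2 * i * L) * (i - k * i - 1)" for i P k2 L k :: "'i sfun fps"
      by (simp add: algebra_simps)
    show ?thesis
      unfolding power2_eq_square fps_const_mult[symmetric] gen i by simp
  qed
  finally show ?thesis .
qed

text \<open>The middle sum is the source: up to weights, \<open>G (2 * int m)\<close> divided by
  \<open>2 * m\<close> is the genus zero number after a cut into \<open>k\<close> and
  \<open>m - k\<close>, see \<open>F0_G\<close>. The factor 2 in the last sum counts which of the
  two pieces has genus one.\<close>

theorem R_rec: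
  assumes m: "m > 0"
  shows "wt m *\<^sub>R R m =
    (\<Sum>i\<in>I. (real (a i) / wt (a i) * wt (m + a i)) *\<^sub>R (eps i * R (m + a i)))
    + (\<Sum>k=1..<m. (24 * (wt k * wt (m - k))) *\<^sub>R ((1 / (2 * real m)) *\<^sub>R G (2 * int m)))
    + (\<Sum>k=1..<m. (2 * (wt k * wt (m - k))) *\<^sub>R (Q k * R (m - k)))"
proof -
  let ?P = "disc\<^sup>2" and ?w = "wser $ m - 2 * (qser * wser) $ m - (\<Sum>i\<in>I. eh i * shift i wser $ m)"
  have w0: "wser $ 0 = 0" by (simp add: wser_def tor_def numeral_fps_const)
  have DV0: "D V $ 0 = 0" by simp
  have "(2 * (wser - 2 * (qser * wser) - (\<Sum>i\<in>I. ce i * shift i wser))) $ m = (3 * emb ?P) $ m"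
    unfolding wser_eq ..
  then have "2 * ?w = 3 * ((?P $ m) *\<^sub>R 1)"
    unfolding numeral_mult_nth fps_sub_nth fps_sum_nth fps_mult_left_const_nth emb_nth .
  then have "(2::real) *\<^sub>R ?w = (3::real) *\<^sub>R ((?P $ m) *\<^sub>R 1)"
    by (simp only: scaleR_conv_of_real of_real_numeral)
  from arg_cong[OF this, of "\<lambda>z. (1 / 2 :: real) *\<^sub>R z"]
  have "?w = (3 / 2 * ?P $ m) *\<^sub>R 1"
    by simp
  then have w: "wser $ m = (\<Sum>i\<in>I. eh i * shift i wser $ m) + (3 / 2 * ?P $ m) *\<^sub>R 1 + 2 * (qser * wser) $ m"
    by (simp add: algebra_simps)
  have P: "3 / 2 * ?P $ m = (\<Sum>k=1..<m. 24 * (wt k * wt (m - k)) * (1 / (2 * real m)))"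
  proof -
    have "D ?P $ m = (8 * (D V * D V)) $ m" unfolding D_V_D_V ..
    then have "real m * ?P $ m = 8 * (\<Sum>k=1..<m. wt k * wt (m - k))"
      unfolding numeral_mult_nth mult_nth_inner[OF DV0 DV0] D_V_nth by simp
    then have "?P $ m = 8 * (\<Sum>k=1..<m. wt k * wt (m - k)) / real m"
      using m by (simp add: field_simps)
    then show ?thesis
      by (simp add: sum_distrib_left sum_divide_distrib)
  qed
  have 2: "G (2 * int m) * (eh i * shift i wser $ m)
    = (real (a i) / wt (a i) * wt (m + a i)) *\<^sub>R (eps i * R (m + a i))" for i
  proof -
    have "shift i wser $ m = (real (a i) / wt (a i)) *\<^sub>R wser $ (m + a i)"
      using m by (simp add: shift_def)
    then show ?thesis
      unfolding G_eps_shift by (simp only: mult_scaleR_right scaleR_scaleR wser_nth[symmetric])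
  qed
  have 3: "G (2 * int m) * (qser $ k * wser $ (m - k)) = (wt k * wt (m - k)) *\<^sub>R (Q k * R (m - k))"
    if k: "k \<in> {1..<m}" for k
  proof -
    have "G (2 * int m) * (qser $ k * wser $ (m - k)) = (G (2 * int k) * qser $ k) * (G (2 * int (m - k)) * wser $ (m - k))"
      unfolding G_split[OF k] by (simp only: mult_ac)
    also have "\<dots> = (wt k *\<^sub>R Q k) * (wt (m - k) *\<^sub>R R (m - k))"
      using k by (simp add: qser_nth wser_nth)
    finally show ?thesis by simp
  qed
  have 4: "G (2 * int m) * (2 * (qser * wser) $ m) = (\<Sum>k=1..<m. (2 * (wt k * wt (m - k))) *\<^sub>R (Q k * R (m - k)))"
  proof -
    have "G (2 * int m) * (2 * (qser * wser) $ m) = (2::real) *\<^sub>R (\<Sum>k=1..<m. G (2 * int m) * (qser $ k * wser $ (m - k)))"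
      unfolding mult_nth_inner[OF qser_0 w0] by (simp add: scaleR_conv_of_real sum_distrib_left mult_ac)
    also have "\<dots> = (2::real) *\<^sub>R (\<Sum>k=1..<m. (wt k * wt (m - k)) *\<^sub>R (Q k * R (m - k)))"
      using 3 by simp
    finally show ?thesis by (simp add: scaleR_sum_right)
  qed
  have 5: "G (2 * int m) * ((3 / 2 * ?P $ m) *\<^sub>R 1) = (\<Sum>k=1..<m. (24 * (wt k * wt (m - k))) *\<^sub>R ((1 / (2 * real m)) *\<^sub>R G (2 * int m)))"
    unfolding P by (simp add: scaleR_sum_left sum_distrib_left)
  show ?thesis
    unfolding wser_nth by (subst w) (simp only: distrib_left sum_distrib_left 2 4 5)
qed

end

section \<open>Recursions for the closed formulas\<close>

definition weight :: "nat multiset \<Rightarrow> real" where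
  "weight M = (\<Prod>m\<in>#M. wt m)"

definition mesym :: "nat multiset \<Rightarrow> nat \<Rightarrow> real" where
  "mesym M k = coeff (\<Prod>m\<in>#M. [:1, 2 * real m + 1:]) k"

text \<open>\<open>F0\<close> and \<open>F1\<close> are the predicted numbers of factorizations of
  one fixed permutation with cycle type \<open>M\<close>, in genus zero and one;
  \<open>card_facts\<close> confirms them.\<close>

definition F0 :: "nat multiset \<Rightarrow> real" where
  "F0 M = weight M * rising3 (real (\<Sum>\<^sub># M)) (size M)"

definition F1 :: "nat multiset \<Rightarrow> real" where
  "F1 M = weight M / 24 * torus (2 * real (\<Sum>\<^sub># M) + 1) (size M) (mesym M)"

definition parts :: "('i \<Rightarrow> nat) \<Rightarrow> 'i set \<Rightarrow> nat multiset" where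
  "parts a S = image_mset a (mset_set S)"

lemma torus_cong: "(\<And>k. k \<ge> 2 \<Longrightarrow> e k = e' k) \<Longrightarrow> torus z l e = torus z l e'"
  unfolding torus_def by simp

context weights
begin

lemma weight_parts: "finite S \<Longrightarrow> weight (parts a S) = (\<Prod>i\<in>S. wt (a i))"
  by (simp add: weight_def parts_def prod_unfold_prod_mset image_mset.compositionality comp_def)

lemma sum_real_parts: "\<Sum>\<^sub># (image_mset real (parts a S)) = tot S"
  by (simp add: parts_def tot_def image_mset.compositionality comp_def sum_unfold_sum_mset)

lemma size_parts: "size (parts a S) = card S"
  by (simp add: parts_def)

lemma mesym_parts: "mesym (parts a S) = esym x S"
  by (rule ext) (simp add: mesym_def esym_def parts_def prod_unfold_prod_mset image_mset.compositionality comp_def)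

lemma mesym_add: "k > 0 \<Longrightarrow> mesym (add_mset m M) k = mesym M k + (2 * real m + 1) * mesym M (k - 1)"
  by (cases k) (simp_all add: mesym_def)

definition W :: "'i set \<Rightarrow> real" where "W S = (\<Prod>i\<in>S. wt (a i))"

lemma F0_Q:
  assumes "S \<subseteq> I"
  shows "F0 (add_mset m (parts a S)) = wt m * W S * val (Q m) S"
proof -
  have "finite S" using assms finite_I finite_subset by blast
  then show ?thesis
    using assms weight_parts[OF \<open>finite S\<close>] unfolding F0_def Q_def val_on_I
    by (simp add: weight_def W_def sum_real_parts size_parts)
qed

lemma F1_R:
  assumes "S \<subseteq> I"
  shows "24 * F1 (add_mset m (parts a S)) = wt m * W S * val (R m) S"
proof -
  have "finite S" using assms finite_I finite_subset by blast
  have "torus z l (mesym (add_mset m (parts a S))) = torus z l (\<lambda>k. esym x S k + (2 * real m + 1) * esym x S (k - 1))"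
    for z l by (rule torus_cong) (simp add: mesym_add mesym_parts)
  then show ?thesis
    using assms weight_parts[OF \<open>finite S\<close>] unfolding F1_def R_def val_on_I
    by (simp add: weight_def W_def sum_real_parts size_parts)
qed

text \<open>Besides the weights, only the total and the number of parts matter, so the sizes
  \<open>k\<close> and \<open>m - k\<close> enter through their sum.\<close>

lemma F0_G:
  assumes "S \<subseteq> I" "0 < k" "k < m"
  shows "F0 (add_mset k (add_mset (m - k) (parts a S))) = wt k * wt (m - k) * W S * val ((1 / (2 * real m)) *\<^sub>R G (2 * int m)) S"
proof -
  have S: "finite S" using assms finite_I finite_subset by blast
  have "rising3 (real m + tot S) (Suc (Suc (card S))) = 1 / (2 * real m) * val (G (2 * int m)) S"
  proof (cases "S = {}")
    case False
    then obtain n where "card S = Suc n" using S by (metis card_gt_0_iff gr0_conv_Suc)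
    then show ?thesis using assms False by (simp add: rising3_def G_def val_on_I numeral_3_eq_3 algebra_simps)
  qed (use assms in \<open>simp add: rising3_def G_def val_on_I\<close>)
  moreover have "real (\<Sum>\<^sub># (add_mset k (add_mset (m - k) (parts a S)))) = real m + tot S"
    using assms by (simp add: sum_real_parts of_nat_diff)
  ultimately show ?thesis
    using weight_parts[OF S] unfolding F0_def
    by (simp add: weight_def W_def size_parts mult_ac)
qed

lemma W_remove: "i \<in> I \<Longrightarrow> W I = wt (a i) * W (I - {i})"
  unfolding W_def by (rule prod.remove[OF finite_I])

lemma W_split: "A \<subseteq> I \<Longrightarrow> W I = W A * W (I - A)"
  unfolding W_def using finite_I by (metis prod.subset_diff mult.commute)

lemma wt_ne_0: "i \<in> I \<Longrightarrow> wt (a i) \<noteq> 0"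
  using wt_pos[OF a_pos] by (metis less_irrefl)

lemma join_term:
  assumes "i \<in> I"
  shows "W I * (real (a i) / wt (a i) * wt n * y) = real (a i) * (wt n * W (I - {i}) * y)"
  unfolding W_remove[OF assms] using wt_ne_0[OF assms] by simp

lemma val_eps_I: "i \<in> I \<Longrightarrow> val (eps i * y) I = val y (I - {i})"
  using finite_I by (simp add: val_eps_mult)

text \<open>Joins come with multiplicity \<open>a i\<close>, the number of points in the absorbed
  cycle. The assumption \<open>ne\<close> excludes the single point, whose empty factorization is
  the extra term in \<open>Q_rec\<close>.\<close>

lemma F0_rec:
  assumes m: "m > 0" and ne: "m \<noteq> 1 \<or> I \<noteq> {}"
  shows "F0 (add_mset m (parts a I)) = (\<Sum>i\<in>I. real (a i) * F0 (add_mset (m + a i) (parts a (I - {i}))))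
    + (\<Sum>k=1..<m. \<Sum>A\<in>Pow I. F0 (add_mset k (parts a A)) * F0 (add_mset (m - k) (parts a (I - A))))"
proof -
  have "F0 (add_mset m (parts a I)) = W I * val (wt m *\<^sub>R Q m) I"
    by (simp add: F0_Q)
  also have "\<dots> = W I * val (if m = 1 then 1 else 0) I
    + (\<Sum>i\<in>I. W I * (real (a i) / wt (a i) * wt (m + a i) * val (Q (m + a i)) (I - {i})))
    + (\<Sum>k=1..<m. \<Sum>A\<in>Pow I. W I * (wt k * wt (m - k) * (val (Q k) A * val (Q (m - k)) (I - A))))"
  proof -
    have "val (Q k * Q l) I = (\<Sum>A\<in>Pow I. val (Q k) A * val (Q l) (I - A))" for k l
      using finite_I by (rule val_mult)
    then show ?thesis
      unfolding Q_rec[OF m]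
      by (simp only: val_simps val_sum val_eps_I distrib_left sum_distrib_left cong: sum.cong)
  qed
  also have "val (if m = 1 then 1 else 0) I = 0" using ne by (auto simp: val_1)
  also have "(\<Sum>i\<in>I. W I * (real (a i) / wt (a i) * wt (m + a i) * val (Q (m + a i)) (I - {i})))
    = (\<Sum>i\<in>I. real (a i) * F0 (add_mset (m + a i) (parts a (I - {i}))))"
    by (intro sum.cong refl) (simp only: join_term, subst F0_Q, auto)
  also have "(\<Sum>k=1..<m. \<Sum>A\<in>Pow I. W I * (wt k * wt (m - k) * (val (Q k) A * val (Q (m - k)) (I - A))))
    = (\<Sum>k=1..<m. \<Sum>A\<in>Pow I. F0 (add_mset k (parts a A)) * F0 (add_mset (m - k) (parts a (I - A))))"
    by (intro sum.cong refl) (auto simp: F0_Q W_split)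
  finally show ?thesis by simp
qed

text \<open>A cut that leaves a transitive factorization lowers the genus, hence the term in
  \<open>F0\<close> alone; a cut into two factorizations distributes the genus.\<close>

lemma F1_rec:
  assumes m: "m > 0"
  shows "F1 (add_mset m (parts a I)) = (\<Sum>i\<in>I. real (a i) * F1 (add_mset (m + a i) (parts a (I - {i}))))
    + (\<Sum>k=1..<m. F0 (add_mset k (add_mset (m - k) (parts a I)))
      + (\<Sum>A\<in>Pow I. F0 (add_mset k (parts a A)) * F1 (add_mset (m - k) (parts a (I - A)))
        + F1 (add_mset k (parts a A)) * F0 (add_mset (m - k) (parts a (I - A)))))"
proof -
  have "24 * F1 (add_mset m (parts a I)) = W I * val (wt m *\<^sub>R R m) I"
    by (simp add: F1_R)
  also have "\<dots> = (\<Sum>i\<in>I. W I * (real (a i) / wt (a i) * wt (m + a i) * val (R (m + a i)) (I - {i})))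
    + (\<Sum>k=1..<m. W I * (24 * (wt k * wt (m - k)) * val ((1 / (2 * real m)) *\<^sub>R G (2 * int m)) I))
    + (\<Sum>k=1..<m. \<Sum>A\<in>Pow I. W I * (2 * (wt k * wt (m - k)) * (val (Q k) A * val (R (m - k)) (I - A))))"
  proof -
    have "val (Q k * R l) I = (\<Sum>A\<in>Pow I. val (Q k) A * val (R l) (I - A))" for k l
      using finite_I by (rule val_mult)
    then show ?thesis
      unfolding R_rec[OF m]
      by (simp only: val_simps val_sum val_eps_I distrib_left sum_distrib_left cong: sum.cong)
  qed
  also have "(\<Sum>i\<in>I. W I * (real (a i) / wt (a i) * wt (m + a i) * val (R (m + a i)) (I - {i})))
    = (\<Sum>i\<in>I. 24 * (real (a i) * F1 (add_mset (m + a i) (parts a (I - {i})))))"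
  proof (intro sum.cong refl)
    fix i assume i: "i \<in> I"
    have "24 * F1 (add_mset (m + a i) (parts a (I - {i}))) = wt (m + a i) * W (I - {i}) * val (R (m + a i)) (I - {i})"
      by (rule F1_R) auto
    then show "W I * (real (a i) / wt (a i) * wt (m + a i) * val (R (m + a i)) (I - {i}))
      = 24 * (real (a i) * F1 (add_mset (m + a i) (parts a (I - {i}))))"
      unfolding join_term[OF i] by (metis mult.left_commute)
  qed
  also have "(\<Sum>k=1..<m. W I * (24 * (wt k * wt (m - k)) * val ((1 / (2 * real m)) *\<^sub>R G (2 * int m)) I))
    = (\<Sum>k=1..<m. 24 * F0 (add_mset k (add_mset (m - k) (parts a I))))"
    by (intro sum.cong refl, subst F0_G) auto
  also have "(\<Sum>k=1..<m. \<Sum>A\<in>Pow I. W I * (2 * (wt k * wt (m - k)) * (val (Q k) A * val (R (m - k)) (I - A))))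
    = (\<Sum>k=1..<m. \<Sum>A\<in>Pow I. 2 * (24 * (F0 (add_mset k (parts a A)) * F1 (add_mset (m - k) (parts a (I - A))))))"
  proof (intro sum.cong refl)
    fix k A assume "A \<in> Pow I"
    then have A: "A \<subseteq> I" by simp
    have "24 * F1 (add_mset (m - k) (parts a (I - A))) = wt (m - k) * W (I - A) * val (R (m - k)) (I - A)"
      by (rule F1_R) auto
    then have "2 * (24 * (F0 (add_mset k (parts a A)) * F1 (add_mset (m - k) (parts a (I - A)))))
      = 2 * (F0 (add_mset k (parts a A)) * (wt (m - k) * W (I - A) * val (R (m - k)) (I - A)))"
      by simp
    then show "W I * (2 * (wt k * wt (m - k)) * (val (Q k) A * val (R (m - k)) (I - A)))
      = 2 * (24 * (F0 (add_mset k (parts a A)) * F1 (add_mset (m - k) (parts a (I - A)))))"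
      unfolding F0_Q[OF A] W_split[OF A] by (simp only: mult_ac)
  qed
  finally have *: "24 * F1 (add_mset m (parts a I)) =
    24 * ((\<Sum>i\<in>I. real (a i) * F1 (add_mset (m + a i) (parts a (I - {i}))))
    + (\<Sum>k=1..<m. F0 (add_mset k (add_mset (m - k) (parts a I))))
    + 2 * (\<Sum>k=1..<m. \<Sum>A\<in>Pow I. F0 (add_mset k (parts a A)) * F1 (add_mset (m - k) (parts a (I - A)))))"
    by (simp add: sum_distrib_left distrib_left)
  \<comment> \<open>Exchanging the two pieces of the cut turns the factor 2 into the two possible
    positions of the genus one factor.\<close>
  have "(\<Sum>k=1..<m. \<Sum>A\<in>Pow I. F0 (add_mset k (parts a A)) * F1 (add_mset (m - k) (parts a (I - A))))
    = (\<Sum>k=1..<m. \<Sum>A\<in>Pow I. F1 (add_mset k (parts a A)) * F0 (add_mset (m - k) (parts a (I - A))))"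
  proof (rule sum.reindex_bij_witness[of _ "\<lambda>k. m - k" "\<lambda>k. m - k"])
    fix k assume k: "k \<in> {1..<m}"
    show "(\<Sum>A\<in>Pow I. F1 (add_mset (m - k) (parts a A)) * F0 (add_mset (m - (m - k)) (parts a (I - A))))
      = (\<Sum>A\<in>Pow I. F0 (add_mset k (parts a A)) * F1 (add_mset (m - k) (parts a (I - A))))"
      by (rule sum.reindex_bij_witness[of _ "\<lambda>A. I - A" "\<lambda>A. I - A"])
        (use k in \<open>auto simp: double_diff mult.commute\<close>)
  qed auto
  with * show ?thesis
    by (simp add: sum.distrib)
qed

end

section \<open>Cycles and transpositions\<close>

abbreviation orb :: "('a \<Rightarrow> 'a) \<Rightarrow> 'a \<Rightarrow> 'a set" where "orb \<equiv> Orbits.orbit"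

text \<open>A cycle is listed from an arbitrary starting point, so that joining and cutting cycles
  become operations on lists.\<close>

definition cyc :: "('a \<Rightarrow> 'a) \<Rightarrow> 'a list \<Rightarrow> bool" where
  "cyc f xs \<longleftrightarrow> xs \<noteq> [] \<and> distinct xs \<and> map f xs = rotate1 xs"

lemma cyc_funpow:
  assumes "cyc f xs" "i < length xs"
  shows "(f ^^ n) (xs ! i) = xs ! ((i + n) mod length xs)"
proof (induction n)
  case 0 then show ?case using assms by simp
next
  case (Suc n)
  let ?j = "(i + n) mod length xs"
  have "xs \<noteq> []" using assms by (auto simp: cyc_def)
  then have j: "?j < length xs" by simp
  have "f (xs ! ?j) = map f xs ! ?j" using j by simp
  also have "\<dots> = xs ! (Suc ?j mod length xs)"
    using assms j by (simp add: cyc_def nth_rotate1)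
  finally show ?case using Suc by (simp add: mod_Suc_eq)
qed

lemma cyc_orbit:
  assumes "cyc f xs" "x \<in> set xs"
  shows "orb f x = set xs"
proof
  have sub: "f ` set xs = set xs" using assms(1) by (metis cyc_def set_map set_rotate1)
  show "orb f x \<subseteq> set xs"
  proof
    fix y assume "y \<in> orb f x"
    then show "y \<in> set xs" by induction (use sub assms(2) in auto)
  qed
  show "set xs \<subseteq> orb f x"
  proof
    fix y assume "y \<in> set xs"
    then obtain j where j: "j < length xs" "y = xs ! j" by (metis in_set_conv_nth)
    obtain i where i: "i < length xs" "x = xs ! i" using assms(2) by (metis in_set_conv_nth)
    have "(f ^^ (j + length xs - i)) x = y"
      using cyc_funpow[OF assms(1) i(1), of "j + length xs - i"] i j by simp
    moreover have "0 < j + length xs - i" using i by simp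
    ultimately show "y \<in> orb f x" unfolding orbit_altdef by blast
  qed
qed

lemma cyc_exists:
  assumes "permutation f"
  obtains ys where "cyc f (x # ys)"
proof -
  have x: "x \<in> orb f x" using assms by (rule permutation_self_in_orbit)
  define n where "n = funpow_dist1 f x x"
  have n0: "n > 0" by (simp add: n_def)
  have per: "(f ^^ n) x = x" unfolding n_def using x by (rule funpow_dist1_prop)
  define xs where "xs = map (\<lambda>i. (f ^^ i) x) [0..<n]"
  have len: "length xs = n" by (simp add: xs_def)
  have nth: "xs ! i = (f ^^ i) x" if "i < n" for i using that by (simp add: xs_def)
  have inj: "inj_on (\<lambda>i. (f ^^ i) x) {0..<n}"
    unfolding n_def using x by (rule inj_on_funpow_dist1)
  then have "distinct xs"
    by (simp add: xs_def distinct_map)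
  moreover have "map f xs = rotate1 xs"
  proof (rule nth_equalityI)
    fix i assume "i < length (map f xs)"
    then have i: "i < n" by (simp add: len)
    show "map f xs ! i = rotate1 xs ! i"
    proof (cases "Suc i < n")
      case True
      then show ?thesis using i by (simp add: nth_rotate1 len nth)
    next
      case False
      then have "Suc i = n" using i by simp
      then show ?thesis using i per n0 by (auto simp: nth_rotate1 len nth)
    qed
  qed simp
  moreover have "xs = x # tl xs"
    using n0 by (simp add: xs_def upt_conv_Cons)
  ultimately have "cyc f (x # tl xs)"
    unfolding cyc_def by (metis list.distinct(1))
  then show ?thesis using that by blast
qed

lemma orbit_eq:
  assumes "permutation f" "y \<in> orb f x"
  shows "orb f y = orb f x"
proof -
  obtain ys where ys: "cyc f (x # ys)" using cyc_exists[OF assms(1)] by blast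
  then have "orb f x = set (x # ys)" by (rule cyc_orbit) simp
  then show ?thesis using cyc_orbit[OF ys, of y] assms(2) by simp
qed

lemma cyc_unchanged:
  assumes "cyc f xs" "s \<notin> set xs" "t \<notin> set xs"
  shows "cyc (transpose s t \<circ> f) xs"
proof -
  have "f ` set xs = set xs" using assms(1) by (metis cyc_def set_map set_rotate1)
  then have eq: "map (transpose s t \<circ> f) xs = map f xs"
    using assms(2,3) by (auto simp: transpose_def)
  show ?thesis using assms(1) unfolding cyc_def eq .
qed

lemma map_transpose_id:
  "s \<notin> set xs \<Longrightarrow> t \<notin> set xs \<Longrightarrow> map (transpose s t) xs = xs"
  by (induction xs) (auto simp: transpose_def)

text \<open>Composition with the transposition exchanges the images of the predecessors of
  \<open>s\<close> and \<open>t\<close>, which are the last elements of the two lists; each list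
  then continues into the other.\<close>

lemma cyc_join:
  assumes u: "cyc f (t # us)" and v: "cyc f (s # vs)" and disj: "set (t # us) \<inter> set (s # vs) = {}"
  shows "cyc (transpose s t \<circ> f) ((t # us) @ (s # vs))"
proof -
  have 1: "map f (t # us) = us @ [t]" "map f (s # vs) = vs @ [s]"
    and 2: "distinct (t # us)" "distinct (s # vs)"
    using u v by (simp_all add: cyc_def)
  have "map (transpose s t \<circ> f) (t # us) = map (transpose s t) (us @ [t])"
    unfolding 1(1)[symmetric] by simp
  also have "\<dots> = us @ [s]" using 2 disj by (simp add: map_transpose_id)
  finally have 3: "map (transpose s t \<circ> f) (t # us) = us @ [s]" .
  have "map (transpose s t \<circ> f) (s # vs) = map (transpose s t) (vs @ [s])"
    unfolding 1(2)[symmetric] by simp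
  also have "\<dots> = vs @ [t]" using 2 disj by (simp add: map_transpose_id)
  finally have 4: "map (transpose s t \<circ> f) (s # vs) = vs @ [t]" .
  show ?thesis
    unfolding cyc_def map_append 3 4 using 2 disj by auto
qed

lemma cyc_cut:
  assumes "cyc f ((t # us) @ (s # vs))"
  shows "cyc (transpose s t \<circ> f) (t # us)" "cyc (transpose s t \<circ> f) (s # vs)"
proof -
  have d: "distinct ((t # us) @ (s # vs))" and m: "map f ((t # us) @ (s # vs)) = rotate1 ((t # us) @ (s # vs))"
    using assms by (simp_all add: cyc_def)
  have "map f (t # us) @ map f (s # vs) = (us @ [s]) @ (vs @ [t])"
    using m by simp
  moreover have "length (map f (t # us)) = length (us @ [s])" by simp
  ultimately have 1: "map f (t # us) = us @ [s]" "map f (s # vs) = vs @ [t]"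
    by (metis append_eq_append_conv)+
  have "map (transpose s t \<circ> f) (t # us) = map (transpose s t) (us @ [s])"
    unfolding 1(1)[symmetric] by simp
  also have "\<dots> = us @ [t]" using d by (simp add: map_transpose_id)
  finally show "cyc (transpose s t \<circ> f) (t # us)" unfolding cyc_def using d by simp
  have "map (transpose s t \<circ> f) (s # vs) = map (transpose s t) (vs @ [t])"
    unfolding 1(2)[symmetric] by simp
  also have "\<dots> = vs @ [s]" using d by (simp add: map_transpose_id)
  finally show "cyc (transpose s t \<circ> f) (s # vs)" unfolding cyc_def using d by simp
qed

definition cycles :: "'a set \<Rightarrow> ('a \<Rightarrow> 'a) \<Rightarrow> 'a set set" where
  "cycles X f = orb f ` X"

definition ctype :: "'a set \<Rightarrow> ('a \<Rightarrow> 'a) \<Rightarrow> nat multiset" where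
  "ctype X f = parts card (cycles X f)"

text \<open>The permutation may move points outside \<open>X\<close>. Thus it can be restricted to a
  union of its cycles without being changed, as is required when a factorization decomposes.\<close>

locale perm_on =
  fixes X :: "'a set" and f :: "'a \<Rightarrow> 'a"
  assumes finite_X: "finite X" and perm: "permutation f" and image_X: "f ` X = X"
begin

lemma self_orbit: "x \<in> orb f x"
  using perm by (rule permutation_self_in_orbit)

lemma orbit_subset_X:
  assumes "x \<in> X" shows "orb f x \<subseteq> X"
proof
  fix y assume "y \<in> orb f x"
  then show "y \<in> X" by induction (use assms image_X in auto)
qed

lemma finite_cycles [simp]: "finite (cycles X f)"
  unfolding cycles_def using finite_X by simp

lemma Union_cycles: "\<Union> (cycles X f) = X"
  unfolding cycles_def using orbit_subset_X self_orbit by blast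

lemma cycles_disjoint:
  "A \<in> cycles X f \<Longrightarrow> B \<in> cycles X f \<Longrightarrow> A \<noteq> B \<Longrightarrow> A \<inter> B = {}"
  unfolding cycles_def using orbit_eq[OF perm] by (metis disjoint_iff imageE)

lemma cycle_orbit: "A \<in> cycles X f \<Longrightarrow> x \<in> A \<Longrightarrow> orb f x = A"
  unfolding cycles_def using orbit_eq[OF perm] by blast

lemma finite_cycle: "A \<in> cycles X f \<Longrightarrow> finite A"
  using Union_cycles finite_X by (metis Sup_upper finite_subset)

lemma cycle_nonempty: "A \<in> cycles X f \<Longrightarrow> A \<noteq> {}"
  unfolding cycles_def using self_orbit by auto

lemma card_cycle: "A \<in> cycles X f \<Longrightarrow> card A > 0"
  using finite_cycle cycle_nonempty by (simp add: card_gt_0_iff)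

lemma sum_ctype: "\<Sum>\<^sub># (ctype X f) = card X"
proof -
  have "\<Sum>\<^sub># (ctype X f) = (\<Sum>A\<in>cycles X f. card A)"
    by (simp add: ctype_def parts_def sum_unfold_sum_mset)
  also have "\<dots> = card (\<Union> (cycles X f))"
    by (rule card_Union_disjoint[symmetric])
      (auto simp: pairwise_def disjnt_def finite_cycle dest: cycles_disjoint)
  finally show ?thesis by (simp add: Union_cycles)
qed

lemma sub_cycles:
  assumes "Os \<subseteq> cycles X f"
  shows "f ` (\<Union> Os) = \<Union> Os" "cycles (\<Union> Os) f = Os"
proof -
  have "f ` A = A" if A: "A \<in> cycles X f" for A
  proof -
    obtain x where x: "x \<in> A" using cycle_nonempty[OF A] by blast
    obtain ys where ys: "cyc f (x # ys)" using cyc_exists[OF perm] by blast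
    have "A = set (x # ys)"
      using cyc_orbit[OF ys, of x] cycle_orbit[OF A x] by simp
    then show ?thesis using ys by (metis cyc_def set_map set_rotate1)
  qed
  then show "f ` (\<Union> Os) = \<Union> Os" using assms by (auto simp: image_Union) blast+
  show "cycles (\<Union> Os) f = Os"
  proof
    show "cycles (\<Union> Os) f \<subseteq> Os" unfolding cycles_def using cycle_orbit assms by auto
    show "Os \<subseteq> cycles (\<Union> Os) f"
    proof
      fix A assume A: "A \<in> Os"
      then obtain x where "x \<in> A" using assms cycle_nonempty by blast
      then show "A \<in> cycles (\<Union> Os) f"
        unfolding cycles_def using A assms cycle_orbit by (metis UnionI image_eqI subsetD)
    qed
  qed
qed

lemma invariant_subset:
  assumes "Y \<subseteq> X" "f ` Y = Y"
  shows "cycles Y f \<subseteq> cycles X f" "\<Union> (cycles Y f) = Y"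
proof -
  interpret Y: perm_on Y f
    by unfold_locales (use assms finite_X finite_subset perm in auto)
  show "cycles Y f \<subseteq> cycles X f" unfolding cycles_def using assms by blast
  show "\<Union> (cycles Y f) = Y" by (rule Y.Union_cycles)
qed

end

lemma permutation_transpose_comp: "permutation f \<Longrightarrow> permutation (transpose s t \<circ> f)"
  by (simp add: permutation_compose permutation_swap_id)

context perm_on
begin

lemma perm_on_transpose:
  assumes "s \<in> X" "t \<in> X"
  shows "perm_on X (transpose s t \<circ> f)"
proof
  show "(transpose s t \<circ> f) ` X = X"
    unfolding image_comp[symmetric] image_X using assms
    by (auto simp: transpose_def image_iff)
qed (use finite_X perm permutation_transpose_comp in auto)

lemma orbit_transpose_other:
  assumes "s \<notin> orb f x" "t \<notin> orb f x"
  shows "orb (transpose s t \<circ> f) x = orb f x"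
proof -
  obtain ys where ys: "cyc f (x # ys)" using cyc_exists[OF perm] by blast
  then have o: "orb f x = set (x # ys)" by (rule cyc_orbit) simp
  then have "cyc (transpose s t \<circ> f) (x # ys)" using cyc_unchanged[OF ys] assms by metis
  then have "orb (transpose s t \<circ> f) x = set (x # ys)" by (rule cyc_orbit) simp
  then show ?thesis using o by simp
qed

lemma ctype_remove:
  assumes "t \<in> X"
  shows "ctype X f = add_mset (card (orb f t)) (parts card (cycles X f - {orb f t}))"
proof -
  have "orb f t \<in> cycles X f" using assms by (auto simp: cycles_def)
  then show ?thesis unfolding ctype_def parts_def
    by (metis finite_cycles image_mset_add_mset mset_set.remove)
qed

lemma ctype_join:
  assumes t: "t \<in> X" and s: "s \<in> X" "s \<notin> orb f t"
  defines "f' \<equiv> transpose s t \<circ> f"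
  shows "orb f' s = orb f t \<union> orb f s"
    and "orb f' t = orb f t \<union> orb f s"
    and "ctype X f' = add_mset (card (orb f t) + card (orb f s))
      (parts card (cycles X f - {orb f t} - {orb f s}))"
proof -
  interpret f': perm_on X f' unfolding f'_def using s t by (intro perm_on_transpose)
  let ?C = "orb f t" and ?C' = "orb f s"
  obtain us where us: "cyc f (t # us)" using cyc_exists[OF perm] by blast
  obtain vs where vs: "cyc f (s # vs)" using cyc_exists[OF perm] by blast
  have C: "?C = set (t # us)" using us by (rule cyc_orbit) simp
  have C': "?C' = set (s # vs)" using vs by (rule cyc_orbit) simp
  have CX: "?C \<in> cycles X f" "?C' \<in> cycles X f" using s t by (auto simp: cycles_def)
  have ne: "?C \<noteq> ?C'" using s self_orbit by metis
  then have disj: "?C \<inter> ?C' = {}" using cycles_disjoint CX by blast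
  have "cyc f' ((t # us) @ (s # vs))"
    unfolding f'_def using cyc_join[OF us vs] disj C C' by simp
  then have "orb f' x = set ((t # us) @ (s # vs))" if "x \<in> set ((t # us) @ (s # vs))" for x
    using that by (rule cyc_orbit)
  then have o: "orb f' x = ?C \<union> ?C'" if "x \<in> ?C \<union> ?C'" for x
    using that unfolding C C' set_append by blast
  then show "orb f' s = ?C \<union> ?C'" "orb f' t = ?C \<union> ?C'"
    using self_orbit by blast+
  have other: "orb f' x = orb f x" if "x \<notin> ?C \<union> ?C'" for x
    unfolding f'_def using that orbit_eq[OF perm] self_orbit by (intro orbit_transpose_other) blast+
  have "cycles X f' - {orb f' t} = cycles X f - {?C} - {?C'}"
  proof (intro equalityI subsetI)
    fix A assume "A \<in> cycles X f' - {orb f' t}"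
    then obtain x where x: "x \<in> X" "A = orb f' x" "A \<noteq> orb f' t" by (auto simp: cycles_def)
    then have "x \<notin> ?C \<union> ?C'" using o \<open>orb f' t = ?C \<union> ?C'\<close> by blast
    then show "A \<in> cycles X f - {?C} - {?C'}" using x other[of x] self_orbit[of x] by (auto simp: cycles_def)
  next
    fix A assume "A \<in> cycles X f - {?C} - {?C'}"
    then obtain x where x: "x \<in> X" "A = orb f x" "A \<noteq> ?C" "A \<noteq> ?C'" by (auto simp: cycles_def)
    then have n: "x \<notin> ?C \<union> ?C'" using orbit_eq[OF perm] by blast
    then show "A \<in> cycles X f' - {orb f' t}"
      using x other[OF n] self_orbit[of x] \<open>orb f' t = ?C \<union> ?C'\<close> by (auto simp: cycles_def)
  qed
  moreover have "card (?C \<union> ?C') = card ?C + card ?C'"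
    using disj finite_cycle CX by (intro card_Un_disjoint) auto
  ultimately show "ctype X f' = add_mset (card ?C + card ?C') (parts card (cycles X f - {?C} - {?C'}))"
    using f'.ctype_remove[OF t] \<open>orb f' t = ?C \<union> ?C'\<close> by simp
qed

lemma cycles_cut:
  assumes t: "t \<in> X" and c: "cyc f ((t # us) @ (s # vs))"
  defines "f' \<equiv> transpose s t \<circ> f"
  shows "orb f' t = set (t # us)" "orb f' s = set (s # vs)"
    and "cycles X f' - {orb f' t} - {orb f' s} = cycles X f - {orb f t}"
    and "s \<in> X"
proof -
  have C: "orb f t = set ((t # us) @ (s # vs))" using c by (rule cyc_orbit) simp
  then show s: "s \<in> X" using orbit_subset_X[OF t] by auto
  interpret f': perm_on X f' unfolding f'_def using s t by (intro perm_on_transpose)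
  have ot: "orb f' x = set (t # us)" if "x \<in> set (t # us)" for x
    unfolding f'_def using cyc_cut(1)[OF c] that by (rule cyc_orbit)
  have os: "orb f' x = set (s # vs)" if "x \<in> set (s # vs)" for x
    unfolding f'_def using cyc_cut(2)[OF c] that by (rule cyc_orbit)
  show ot': "orb f' t = set (t # us)" by (rule ot) simp
  show os': "orb f' s = set (s # vs)" by (rule os) simp
  have tC: "t \<in> orb f t" "s \<in> orb f t" unfolding C by auto
  have other: "orb f' x = orb f x" if "x \<notin> orb f t" for x
    unfolding f'_def using that orbit_eq[OF perm, of _ x] orbit_eq[OF perm, of _ t] self_orbit tC
    by (intro orbit_transpose_other) metis+
  show "cycles X f' - {orb f' t} - {orb f' s} = cycles X f - {orb f t}"
  proof (intro equalityI subsetI)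
    fix A assume "A \<in> cycles X f' - {orb f' t} - {orb f' s}"
    then obtain x where x: "x \<in> X" "A = orb f' x" "A \<noteq> set (t # us)" "A \<noteq> set (s # vs)"
      unfolding ot' os' by (auto simp: cycles_def)
    then have "x \<notin> orb f t" unfolding C using ot[of x] os[of x] by auto
    then show "A \<in> cycles X f - {orb f t}"
      using x other self_orbit[of x] by (auto simp: cycles_def)
  next
    fix A assume "A \<in> cycles X f - {orb f t}"
    then obtain x where x: "x \<in> X" "A = orb f x" "A \<noteq> orb f t" by (auto simp: cycles_def)
    then have n: "x \<notin> orb f t" using orbit_eq[OF perm] by blast
    have "x \<in> A" using x self_orbit by simp
    then have "A \<noteq> set (t # us)" "A \<noteq> set (s # vs)" using n unfolding C by auto
    then show "A \<in> cycles X f' - {orb f' t} - {orb f' s}"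
      unfolding ot' os' using x other[OF n] by (auto simp: cycles_def)
  qed
qed

end

section \<open>Removing the last transposition\<close>

definition swaps :: "(nat \<times> nat) list \<Rightarrow> nat \<Rightarrow> nat" where
  "swaps ps = foldr (\<lambda>(s, t) g. transpose s t \<circ> g) ps id"

definition mono_seqs :: "nat \<Rightarrow> nat set \<Rightarrow> (nat \<times> nat) list set" where
  "mono_seqs r X = {ps. length ps = r \<and> sorted (map snd ps) \<and>
     (\<forall>(s, t)\<in>set ps. s \<in> X \<and> t \<in> X \<and> s < t)}"

definition edges :: "('a \<times> 'a) list \<Rightarrow> ('a \<times> 'a) set" where
  "edges ps = set ps \<union> (set ps)\<inverse>"

definition conn :: "'a set \<Rightarrow> ('a \<times> 'a) list \<Rightarrow> bool" where
  "conn X ps \<longleftrightarrow> (\<forall>x\<in>X. \<forall>y\<in>X. (x, y) \<in> (edges ps)\<^sup>*)"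

text \<open>The product is prescribed on \<open>X\<close> only, and transitivity is stated as
  connectivity of the graph of transpositions; in this form both conditions restrict to unions of
  cycles.\<close>

definition facts :: "nat \<Rightarrow> nat set \<Rightarrow> (nat \<Rightarrow> nat) \<Rightarrow> (nat \<times> nat) list set" where
  "facts r X f = {ps \<in> mono_seqs r X. (\<forall>x\<in>X. f (swaps ps x) = x) \<and> conn X ps}"

definition split_by :: "'a set \<Rightarrow> ('a \<times> 'a) list \<Rightarrow> bool" where
  "split_by Y ps \<longleftrightarrow> (\<forall>(u, v)\<in>set ps. u \<in> Y \<longleftrightarrow> v \<in> Y)"

definition inside :: "'a set \<Rightarrow> ('a \<times> 'a) list \<Rightarrow> ('a \<times> 'a) list" where
  "inside Y ps = filter (\<lambda>(u, v). u \<in> Y) ps"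

lemma swaps_simps [simp]: "swaps [] = id" "swaps ((s, t) # ps) = transpose s t \<circ> swaps ps"
  by (simp_all add: swaps_def)

lemma swaps_append: "swaps (ps @ qs) = swaps ps \<circ> swaps qs"
  by (induction ps) (auto simp: comp_assoc)

lemma bij_swaps: "bij (swaps ps)"
  by (induction ps) (auto simp: bij_comp bij_id[unfolded id_def])

lemma swaps_inside:
  assumes "split_by Y ps" "x \<in> Y"
  shows "swaps ps x = swaps (inside Y ps) x \<and> swaps ps x \<in> Y"
  using assms(1)
proof (induction ps)
  case (Cons p ps)
  obtain u v where p: "p = (u, v)" by fastforce
  have IH: "swaps ps x = swaps (inside Y ps) x" "swaps ps x \<in> Y"
    using Cons by (auto simp: split_by_def)
  have uv: "u \<in> Y \<longleftrightarrow> v \<in> Y" using Cons.prems p by (auto simp: split_by_def)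
  show ?case
  proof (cases "u \<in> Y")
    case True
    then show ?thesis using IH uv p by (auto simp: inside_def transpose_def)
  next
    case False
    then have "transpose u v (swaps ps x) = swaps ps x" using IH uv by (auto simp: transpose_def)
    then show ?thesis using IH False p by (simp add: inside_def)
  qed
qed (use assms in \<open>simp add: inside_def\<close>)

lemma sym_edges: "sym (edges ps)"
  by (auto simp: edges_def sym_def)

lemma edges_rtrancl_sym: "(x, y) \<in> (edges ps)\<^sup>* \<Longrightarrow> (y, x) \<in> (edges ps)\<^sup>*"
  using sym_rtrancl[OF sym_edges] by (metis symD)

lemma edges_mono: "set ps \<subseteq> set qs \<Longrightarrow> (edges ps)\<^sup>* \<subseteq> (edges qs)\<^sup>*"
  by (rule rtrancl_mono) (auto simp: edges_def)

lemma reach_inside: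
  assumes "split_by Y ps" "u \<in> Y" "(u, x) \<in> (edges ps)\<^sup>*"
  shows "x \<in> Y \<and> (u, x) \<in> (edges (inside Y ps))\<^sup>*"
  using assms(3)
proof (induction rule: rtrancl_induct)
  case (step y z)
  then have "z \<in> Y" using assms(1) by (auto simp: edges_def split_by_def)
  moreover have "(y, z) \<in> edges (inside Y ps)"
    using step \<open>z \<in> Y\<close> by (auto simp: edges_def inside_def)
  ultimately show ?case using step by (meson rtrancl.rtrancl_into_rtrancl)
qed (use assms in simp)

lemma split_by_Compl: "split_by (- Y) ps \<longleftrightarrow> split_by Y ps"
  by (auto simp: split_by_def)

lemma set_inside: "set (inside Y ps) \<subseteq> set ps"
  by (auto simp: inside_def)

text \<open>Connectivity forces an edge at the maximum, which is then the larger end of that edge;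
  monotonicity carries this value to the last pair.\<close>

lemma mono_seqs_last:
  assumes X: "finite X" and ps: "ps @ [(s, t)] \<in> mono_seqs r X" and c: "conn X (ps @ [(s, t)])"
  shows "t = Max X"
proof -
  let ?D = "Max X" and ?ps = "ps @ [(s, t)]"
  have st: "s \<in> X" "t \<in> X" "s < t" using ps by (auto simp: mono_seqs_def)
  then have D: "?D \<in> X" using X Max_in by blast
  have "s \<noteq> ?D" using st X by (metis Max_ge leD)
  then have "(?D, s) \<in> (edges ?ps)\<^sup>*" "?D \<noteq> s" using c st D by (auto simp: conn_def)
  then obtain y where "(?D, y) \<in> edges ?ps" by (metis converse_rtranclE)
  then consider "(?D, y) \<in> set ?ps" | "(y, ?D) \<in> set ?ps" by (auto simp: edges_def)
  then show ?thesis
  proof cases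
    case 1
    then have "?D < y" "y \<in> X" using ps unfolding mono_seqs_def by blast+
    then show ?thesis using X by (metis Max_ge leD)
  next
    case 2
    have "sorted (map snd ?ps)" using ps by (simp add: mono_seqs_def)
    then have "?D \<le> t" using 2 by (auto simp: sorted_append)
    then show ?thesis using X st by (simp add: antisym)
  qed
qed

text \<open>The last factor, being an involution, moves around cyclically and is absorbed into
  \<open>f\<close> from the left.\<close>

lemma swaps_last:
  assumes "s \<in> X" "t \<in> X"
  shows "(\<forall>x\<in>X. f (swaps (ps @ [(s, t)]) x) = x) \<longleftrightarrow> (\<forall>x\<in>X. (transpose s t \<circ> f) (swaps ps x) = x)"
proof -
  have X: "transpose s t x \<in> X" if "x \<in> X" for x using that assms by (auto simp: transpose_def)
  have "(\<forall>x\<in>X. f (swaps (ps @ [(s, t)]) x) = x) \<longleftrightarrow> (\<forall>x\<in>X. f (swaps ps (transpose s t x)) = x)"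
    by (simp add: swaps_append)
  also have "\<dots> \<longleftrightarrow> (\<forall>x\<in>X. f (swaps ps x) = transpose s t x)"
    using X by (metis transpose_involutory)
  also have "\<dots> \<longleftrightarrow> (\<forall>x\<in>X. transpose s t (f (swaps ps x)) = x)"
    by (metis transpose_involutory)
  finally show ?thesis by simp
qed

lemma finite_mono_seqs: "finite X \<Longrightarrow> finite (mono_seqs r X)"
proof -
  assume "finite X"
  have "mono_seqs r X \<subseteq> {ps. set ps \<subseteq> X \<times> X \<and> length ps = r}"
    by (auto simp: mono_seqs_def)
  then show ?thesis using \<open>finite X\<close> finite_lists_length_eq[of "X \<times> X" r] finite_subset by blast
qed

lemma finite_facts: "finite X \<Longrightarrow> finite (facts r X f)"
  unfolding facts_def using finite_mono_seqs by auto

lemma conn_append: "conn X ps \<Longrightarrow> conn X (ps @ qs)"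
  unfolding conn_def using edges_mono[of ps "ps @ qs"] by auto

section \<open>Factorizations that fall apart without the last transposition\<close>

definition comp_of :: "('a \<times> 'a) list \<Rightarrow> 'a \<Rightarrow> 'a set" where
  "comp_of ps s = {y. (s, y) \<in> (edges ps)\<^sup>*}"

lemma split_by_comp: "split_by (comp_of ps s) ps"
  unfolding split_by_def comp_of_def
proof safe
  fix u v assume "(u, v) \<in> set ps"
  then have uv: "(u, v) \<in> edges ps" "(v, u) \<in> edges ps" by (auto simp: edges_def)
  show "(s, v) \<in> (edges ps)\<^sup>*" if "(s, u) \<in> (edges ps)\<^sup>*" using that uv by (metis rtrancl.rtrancl_into_rtrancl)
  show "(s, u) \<in> (edges ps)\<^sup>*" if "(s, v) \<in> (edges ps)\<^sup>*" using that uv by (metis rtrancl.rtrancl_into_rtrancl)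
qed

definition blocks :: "nat set \<Rightarrow> (nat \<Rightarrow> nat) \<Rightarrow> nat \<Rightarrow> nat \<Rightarrow> nat set set" where
  "blocks X f s t = {Y. Y \<subseteq> X \<and> s \<in> Y \<and> t \<notin> Y \<and> f ` Y = Y}"

text \<open>In use, \<open>f\<close> is the permutation that has already absorbed the transposition
  of \<open>s\<close> and \<open>t\<close>.\<close>

definition joining :: "nat \<Rightarrow> nat set \<Rightarrow> (nat \<Rightarrow> nat) \<Rightarrow> nat \<Rightarrow> nat \<Rightarrow> (nat \<times> nat) list set" where
  "joining r X f s t = {ps \<in> mono_seqs r X. (\<forall>x\<in>X. f (swaps ps x) = x) \<and>
     conn X (ps @ [(s, t)]) \<and> \<not> conn X ps}"

lemma facts_Suc:
  assumes X: "finite X"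
  defines "t \<equiv> Max X"
  shows "card (facts (Suc r) X f) = (\<Sum>s\<in>X - {t}. card (facts r X (transpose s t \<circ> f))
    + card (joining r X (transpose s t \<circ> f) s t))"
proof -
  define B where "B s = {ps \<in> mono_seqs r X. (\<forall>x\<in>X. (transpose s t \<circ> f) (swaps ps x) = x) \<and> conn X (ps @ [(s, t)])}" for s
  have finB: "finite (B s)" for s unfolding B_def using finite_mono_seqs[OF X] by auto
  have B: "B s = facts r X (transpose s t \<circ> f) \<union> joining r X (transpose s t \<circ> f) s t" for s
    unfolding B_def facts_def joining_def using conn_append by auto
  have cB: "card (B s) = card (facts r X (transpose s t \<circ> f)) + card (joining r X (transpose s t \<circ> f) s t)" for s
    unfolding B
  proof (rule card_Un_disjoint)
    show "finite (facts r X (transpose s t \<circ> f))" "finite (joining r X (transpose s t \<circ> f) s t)"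
      using finB[of s] unfolding B by auto
  qed (auto simp: facts_def joining_def)
  have "facts (Suc r) X f = (\<Union>s\<in>X - {t}. (\<lambda>ps. ps @ [(s, t)]) ` B s)"
  proof (intro equalityI subsetI)
    fix ps assume ps: "ps \<in> facts (Suc r) X f"
    then have "length ps = Suc r" by (simp add: facts_def mono_seqs_def)
    then obtain qs p where "ps = qs @ [p]" by (metis length_Suc_conv_rev)
    then obtain s u where qs: "ps = qs @ [(s, u)]" by (metis surj_pair)
    then have u: "u = t" unfolding t_def using ps X by (intro mono_seqs_last) (auto simp: facts_def)
    have st: "s \<in> X" "t \<in> X" "s < t" using ps u qs by (auto simp: facts_def mono_seqs_def)
    have "qs \<in> B s"
      using ps swaps_last[OF st(1,2), of f qs] unfolding B_def qs u facts_def
      by (auto simp: mono_seqs_def sorted_append)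
    then show "ps \<in> (\<Union>s\<in>X - {t}. (\<lambda>ps. ps @ [(s, t)]) ` B s)"
      using st qs u by auto
  next
    fix ps assume "ps \<in> (\<Union>s\<in>X - {t}. (\<lambda>ps. ps @ [(s, t)]) ` B s)"
    then obtain s qs where s: "s \<in> X" "s \<noteq> t" and qs: "qs \<in> B s" "ps = qs @ [(s, t)]" by auto
    then have t: "t \<in> X" unfolding t_def using X Max_in by blast
    have lt: "s < t" using s X unfolding t_def by (metis Max_ge le_neq_implies_less)
    have "v \<le> t" if "(u, v) \<in> set qs" for u v
      using that qs X unfolding B_def mono_seqs_def t_def by auto
    then show "ps \<in> facts (Suc r) X f"
      using qs swaps_last[OF s(1) t, of f qs] s t lt unfolding B_def facts_def
      by (auto simp: mono_seqs_def sorted_append)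
  qed
  then have "card (facts (Suc r) X f) = card (\<Union>s\<in>X - {t}. (\<lambda>ps. ps @ [(s, t)]) ` B s)" by simp
  also have "\<dots> = (\<Sum>s\<in>X - {t}. card ((\<lambda>ps. ps @ [(s, t)]) ` B s))"
    using X finB by (intro card_UN_disjoint) auto
  also have "\<dots> = (\<Sum>s\<in>X - {t}. card (B s))"
    by (intro sum.cong refl card_image) (auto simp: inj_on_def)
  finally show ?thesis unfolding cB .
qed

text \<open>A component is preserved by the product of the transpositions, hence by
  \<open>f\<close>, which inverts this product on \<open>X\<close>; it misses \<open>t\<close>,
  since otherwise the last edge would add nothing.\<close>

lemma joining_comp:
  assumes X: "finite X" and st: "s \<in> X" "t \<in> X" and ps: "ps \<in> joining r X f s t"
  shows "comp_of ps s \<in> blocks X f s t"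
proof -
  let ?Y = "comp_of ps s"
  have sY: "s \<in> ?Y" by (simp add: comp_of_def)
  have YX: "?Y \<subseteq> X"
  proof
    fix y assume "y \<in> ?Y"
    then have "(s, y) \<in> (edges ps)\<^sup>*" by (simp add: comp_of_def)
    then show "y \<in> X"
    proof induction
      case (step y z)
      then show ?case using ps by (auto simp: joining_def mono_seqs_def edges_def)
    qed (rule st)
  qed
  have "t \<notin> ?Y"
  proof
    assume "t \<in> ?Y"
    then have "(s, t) \<in> (edges ps)\<^sup>*" "(t, s) \<in> (edges ps)\<^sup>*"
      using edges_rtrancl_sym by (auto simp: comp_of_def)
    then have "edges (ps @ [(s, t)]) \<subseteq> (edges ps)\<^sup>*" by (auto simp: edges_def)
    then have "(edges (ps @ [(s, t)]))\<^sup>* \<subseteq> (edges ps)\<^sup>*" by (rule rtrancl_subset_rtrancl)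
    then have "conn X ps" using ps by (auto simp: joining_def conn_def)
    then show False using ps by (simp add: joining_def)
  qed
  moreover have "f ` ?Y = ?Y"
  proof -
    have "swaps ps ` ?Y \<subseteq> ?Y" using swaps_inside[OF split_by_comp] by blast
    moreover have "inj_on (swaps ps) ?Y" using bij_swaps by (metis bij_def inj_on_subset subset_UNIV)
    moreover have "finite ?Y" using YX X finite_subset by blast
    ultimately have "swaps ps ` ?Y = ?Y" by (metis endo_inj_surj)
    then have "f ` ?Y = (\<lambda>x. f (swaps ps x)) ` ?Y" by (metis image_image)
    also have "\<dots> = (\<lambda>x. x) ` ?Y"
      by (rule image_cong) (use ps YX in \<open>auto simp: joining_def\<close>)
    also have "\<dots> = ?Y" by simp
    finally show ?thesis .
  qed
  ultimately show ?thesis using sY YX by (simp add: blocks_def)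
qed

text \<open>One edge can merge only two components, so without it there are exactly the component
  \<open>Y\<close> of \<open>s\<close> and its complement, which contains \<open>t\<close>.\<close>

lemma joining_iff:
  assumes Y: "Y \<subseteq> X" "s \<in> Y" "t \<in> X - Y" and ps: "ps \<in> mono_seqs r X"
  shows "(conn X (ps @ [(s, t)]) \<and> \<not> conn X ps \<and> comp_of ps s = Y) \<longleftrightarrow>
    (split_by Y ps \<and> conn Y (inside Y ps) \<and> conn (X - Y) (inside (- Y) ps))" (is "?L \<longleftrightarrow> ?R")
proof
  assume L: ?L
  then have sp: "split_by Y ps" using split_by_comp[of ps s] by simp
  have Ys: "(s, x) \<in> (edges (inside Y ps))\<^sup>*" if "x \<in> Y" for x
    using reach_inside[OF sp Y(2), of x] that L by (auto simp: comp_of_def)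
  have "conn Y (inside Y ps)"
    unfolding conn_def using Ys edges_rtrancl_sym by (meson rtrancl_trans)
  moreover have t: "(t, x) \<in> (edges (inside (- Y) ps))\<^sup>*" if x: "x \<in> X - Y" for x
  proof -
    have "(s, x) \<in> (edges (ps @ [(s, t)]))\<^sup>*" using L Y x by (auto simp: conn_def)
    then have "x \<in> Y \<or> (t, x) \<in> (edges ps)\<^sup>*"
    proof (induction rule: rtrancl_induct)
      case base then show ?case using Y by simp
    next
      case (step y z)
      then consider "(y, z) \<in> edges ps" | "y = s" "z = t" | "y = t" "z = s" by (auto simp: edges_def)
      then show ?case
      proof cases
        case 1
        then show ?thesis using step.IH sp
          by (auto simp: edges_def split_by_def intro: rtrancl.rtrancl_into_rtrancl)
      qed (use Y in auto)
    qed
    then have "(t, x) \<in> (edges ps)\<^sup>*" using x by simp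
    then show ?thesis using reach_inside[of "- Y" ps t x] sp Y by (simp add: split_by_Compl)
  qed
  ultimately show ?R using sp edges_rtrancl_sym unfolding conn_def by (meson rtrancl_trans)
next
  assume R: ?R
  have 1: "(s, x) \<in> (edges ps)\<^sup>*" if "x \<in> Y" for x
    using R Y that edges_mono[OF set_inside, of Y ps] by (auto simp: conn_def)
  have 2: "(t, x) \<in> (edges ps)\<^sup>*" if "x \<in> X - Y" for x
    using R Y that edges_mono[OF set_inside, of "- Y" ps] by (auto simp: conn_def)
  have c: "comp_of ps s = Y"
    using 1 reach_inside[of Y ps s] R Y by (auto simp: comp_of_def)
  then have "\<not> conn X ps" using Y by (auto simp: conn_def comp_of_def)
  moreover have "conn X (ps @ [(s, t)])"
  proof -
    have e: "(edges ps)\<^sup>* \<subseteq> (edges (ps @ [(s, t)]))\<^sup>*" by (rule edges_mono) auto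
    have "(s, t) \<in> (edges (ps @ [(s, t)]))\<^sup>*" by (auto simp: edges_def)
    then have "(s, x) \<in> (edges (ps @ [(s, t)]))\<^sup>*" if "x \<in> X" for x
      using that 1 2 e by (cases "x \<in> Y") (auto intro: rtrancl_trans)
    then show ?thesis unfolding conn_def using edges_rtrancl_sym by (meson rtrancl_trans)
  qed
  ultimately show ?L using c by simp
qed

text \<open>Monotone sequences on complementary sets can be interleaved in only one monotone way.\<close>

lemma sort_key_inside:
  assumes ps: "sorted (map snd ps)" "split_by Y ps"
  shows "sort_key snd (inside Y ps @ inside (- Y) ps) = ps"
proof (rule properties_for_sort_key)
  show "mset ps = mset (inside Y ps @ inside (- Y) ps)"
    unfolding inside_def by (induction ps) auto
  show "sorted (map snd ps)" by fact
  fix k assume "k \<in> set ps"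
  \<comment> \<open>Pairs with equal larger entry lie in the same block. So ties never occur between
    the blocks, and within a block the stable sort keeps their order.\<close>
  have eq: "u \<in> Y \<longleftrightarrow> snd k \<in> Y" if "(u, v) \<in> set ps" "snd k = v" for u v
    using that ps(2) by (auto simp: split_by_def)
  show "filter (\<lambda>x. snd k = snd x) ps = filter (\<lambda>x. snd k = snd x) (inside Y ps @ inside (- Y) ps)"
  proof (cases "snd k \<in> Y")
    case True
    then have "filter (\<lambda>x. snd k = snd x) (inside Y ps) = filter (\<lambda>x. snd k = snd x) ps"
      unfolding inside_def filter_filter using eq by (intro filter_cong) auto
    moreover have "filter (\<lambda>x. snd k = snd x) (inside (- Y) ps) = []"
      using True eq by (auto simp: inside_def filter_empty_conv)
    ultimately show ?thesis by simp
  next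
    case False
    then have "filter (\<lambda>x. snd k = snd x) (inside (- Y) ps) = filter (\<lambda>x. snd k = snd x) ps"
      unfolding inside_def filter_filter using eq by (intro filter_cong) auto
    moreover have "filter (\<lambda>x. snd k = snd x) (inside Y ps) = []"
      using False eq by (auto simp: inside_def filter_empty_conv)
    ultimately show ?thesis by simp
  qed
qed

text \<open>The splitting of a sequence into its two blocks is inverted by the stable merge along
  the larger entries.\<close>

lemma card_joining_block:
  assumes X: "finite X" and t: "t \<in> X" and Y: "Y \<in> blocks X f s t"
  shows "card {ps \<in> joining r X f s t. comp_of ps s = Y}
    = (\<Sum>k\<le>r. card (facts k Y f) * card (facts (r - k) (X - Y) f))"
proof -
  have Y': "Y \<subseteq> X" "s \<in> Y" "t \<in> X - Y" using Y t by (auto simp: blocks_def)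
  have fin: "finite Y" "finite (X - Y)" using X Y' finite_subset by auto
  define A where "A = {ps \<in> joining r X f s t. comp_of ps s = Y}"
  define B where "B = (\<Union>k\<le>r. facts k Y f \<times> facts (r - k) (X - Y) f)"
  have len: "length (inside Y ps) + length (inside (- Y) ps) = length ps" for ps
    unfolding inside_def by (induction ps) auto
  have "bij_betw (\<lambda>ps. (inside Y ps, inside (- Y) ps)) A B"
  proof (rule bij_betw_byWitness[where f' = "\<lambda>(p, q). sort_key snd (p @ q)"])
    have A: "ps \<in> mono_seqs r X" "\<forall>x\<in>X. f (swaps ps x) = x" "split_by Y ps" "conn Y (inside Y ps)"
      "conn (X - Y) (inside (- Y) ps)" if "ps \<in> A" for ps
      using that joining_iff[OF Y', of ps r] by (auto simp: A_def joining_def)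
    show "\<forall>ps\<in>A. (case (inside Y ps, inside (- Y) ps) of (p, q) \<Rightarrow> sort_key snd (p @ q)) = ps"
      using A by (auto simp: mono_seqs_def intro: sort_key_inside)
    show "(\<lambda>ps. (inside Y ps, inside (- Y) ps)) ` A \<subseteq> B"
    proof safe
      fix ps assume ps: "ps \<in> A"
      note a = A[OF ps]
      have "length (inside Y ps) \<le> r" using len[of ps] a(1) by (auto simp: mono_seqs_def)
      moreover have "inside Y ps \<in> mono_seqs (length (inside Y ps)) Y"
        using a(1,3) unfolding mono_seqs_def by (auto simp: inside_def split_by_def sorted_filter)
      moreover have "inside (- Y) ps \<in> mono_seqs (r - length (inside Y ps)) (X - Y)"
        using a(1,3) len[of ps] unfolding mono_seqs_def by (auto simp: inside_def split_by_def sorted_filter)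
      moreover have "f (swaps (inside Y ps) x) = x" if "x \<in> Y" for x
        using a(2) swaps_inside[OF a(3) that] that Y'(1) by (metis subsetD)
      moreover have "f (swaps (inside (- Y) ps) x) = x" if "x \<in> X - Y" for x
        using a(2) swaps_inside[of "- Y" ps x] a(3) that by (auto simp: split_by_Compl)
      ultimately show "(inside Y ps, inside (- Y) ps) \<in> B"
        unfolding B_def facts_def using a(4,5) by auto
    qed
    have B: "inside Y (sort_key snd (p @ q)) = p \<and> inside (- Y) (sort_key snd (p @ q)) = q
      \<and> sort_key snd (p @ q) \<in> A" if pq: "(p, q) \<in> B" for p q
    proof -
      obtain k where k: "k \<le> r" "p \<in> facts k Y f" "q \<in> facts (r - k) (X - Y) f"
        using pq by (auto simp: B_def)
      have p: "inside Y p = p" "inside (- Y) p = []"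
        using k(2) unfolding inside_def facts_def mono_seqs_def
        by (auto simp: filter_empty_conv intro!: filter_True)
      have q: "inside (- Y) q = q" "inside Y q = []"
        using k(3) unfolding inside_def facts_def mono_seqs_def
        by (auto simp: filter_empty_conv intro!: filter_True)
      have sorted: "sorted (map snd p)" "sorted (map snd q)"
        using k by (auto simp: facts_def mono_seqs_def)
      let ?ps = "sort_key snd (p @ q)"
      have "inside Y ?ps = sort_key snd (inside Y p @ inside Y q)"
        by (simp add: inside_def filter_sort)
      then have i1: "inside Y ?ps = p" using p q sorted by (simp add: sorted_sort_id sort_key_id_if_sorted)
      have "inside (- Y) ?ps = sort_key snd (inside (- Y) p @ inside (- Y) q)"
        by (simp add: inside_def filter_sort)
      then have i2: "inside (- Y) ?ps = q" using p q sorted by (simp add: sort_key_id_if_sorted)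
      have m: "?ps \<in> mono_seqs r X"
        using k Y' unfolding facts_def mono_seqs_def by auto
      have sp: "split_by Y ?ps"
        using k unfolding facts_def mono_seqs_def split_by_def by auto
      have "f (swaps ?ps x) = x" if x: "x \<in> X" for x
      proof (cases "x \<in> Y")
        case True
        then show ?thesis using swaps_inside[OF sp True] i1 k(2) by (auto simp: facts_def)
      next
        case False
        then show ?thesis using swaps_inside[of "- Y" ?ps x] sp i2 k(3) x by (auto simp: facts_def split_by_Compl)
      qed
      moreover have "conn X (?ps @ [(s, t)]) \<and> \<not> conn X ?ps \<and> comp_of ?ps s = Y"
        using joining_iff[OF Y' m] sp i1 i2 k by (simp add: facts_def)
      ultimately have "?ps \<in> A" using m by (simp add: A_def joining_def)
      then show ?thesis using i1 i2 by simp
    qed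
    show "\<forall>pq\<in>B. (inside Y (case pq of (p, q) \<Rightarrow> sort_key snd (p @ q)), inside (- Y) (case pq of (p, q) \<Rightarrow> sort_key snd (p @ q))) = pq"
      using B by auto
    show "(\<lambda>(p, q). sort_key snd (p @ q)) ` B \<subseteq> A"
      using B by auto
  qed
  then have "card A = card B" by (rule bij_betw_same_card)
  also have "card B = (\<Sum>k\<le>r. card (facts k Y f \<times> facts (r - k) (X - Y) f))"
    unfolding B_def
  proof (rule card_UN_disjoint)
    show "\<forall>k\<in>{..r}. finite (facts k Y f \<times> facts (r - k) (X - Y) f)"
      using finite_facts[OF fin(1)] finite_facts[OF fin(2)] by blast
  qed (auto simp: facts_def mono_seqs_def)
  finally show ?thesis unfolding A_def by (simp add: card_cartesian_product)
qed

lemma card_joining: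
  assumes X: "finite X" and st: "s \<in> X" "t \<in> X"
  shows "card (joining r X f s t) = (\<Sum>Y\<in>blocks X f s t. \<Sum>k\<le>r. card (facts k Y f) * card (facts (r - k) (X - Y) f))"
proof -
  have fin: "finite (joining r X f s t)" unfolding joining_def using finite_mono_seqs[OF X] by auto
  have "blocks X f s t \<subseteq> Pow X" by (auto simp: blocks_def)
  then have finb: "finite (blocks X f s t)" using X finite_subset by blast
  have "joining r X f s t = (\<Union>Y\<in>blocks X f s t. {ps \<in> joining r X f s t. comp_of ps s = Y})"
    using joining_comp[OF X st] by auto
  then have "card (joining r X f s t) = card (\<Union>Y\<in>blocks X f s t. {ps \<in> joining r X f s t. comp_of ps s = Y})"
    by simp
  also have "\<dots> = (\<Sum>Y\<in>blocks X f s t. card {ps \<in> joining r X f s t. comp_of ps s = Y})"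
    using fin finb by (intro card_UN_disjoint) auto
  finally show ?thesis using card_joining_block[OF X st(2)] by simp
qed

text \<open>By the Riemann-Hurwitz formula, the factorizations of length \<open>deg M - 2\<close> have genus zero, and those of
  length \<open>deg M\<close> have genus one.\<close>

definition deg :: "nat multiset \<Rightarrow> nat" where
  "deg M = size M + \<Sum>\<^sub># M"

text \<open>The predicted count for all \<open>r \<le> deg M\<close>. In this range the other
  lengths count nothing: \<open>deg M - 1\<close> has the wrong parity, and anything below
  \<open>deg M - 2\<close> is too short for transitivity.\<close>

definition \<Phi> :: "nat \<Rightarrow> nat multiset \<Rightarrow> real" where
  "\<Phi> r M = (if r + 2 = deg M then F0 M else 0) + (if r = deg M then F1 M else 0)"

lemma deg_add [simp]: "deg (add_mset m M) = Suc m + deg M"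
  by (simp add: deg_def)

lemma deg_parts_remove:
  "finite S \<Longrightarrow> A \<in> S \<Longrightarrow> deg (parts a S) = Suc (a A) + deg (parts a (S - {A}))"
  unfolding parts_def by (subst mset_set.remove) auto

lemma deg_parts_split:
  assumes "finite S" "A \<subseteq> S"
  shows "deg (parts a S) = deg (parts a A) + deg (parts a (S - A))"
proof -
  have "mset_set S = mset_set A + mset_set (S - A)"
    using assms by (metis Diff_disjoint Diff_partition finite_subset mset_set_Union finite_Diff)
  then show ?thesis by (simp add: deg_def parts_def)
qed

text \<open>The bound on \<open>r\<close> keeps the total genus at most one: a product of two genus
  one terms would need \<open>r = deg M + deg M'\<close>.\<close>

lemma \<Phi>_convolution:
  assumes "deg M \<ge> 2" "deg M' \<ge> 2" "r + 2 \<le> deg M + deg M'"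
  shows "(\<Sum>j\<le>r. \<Phi> j M * \<Phi> (r - j) M') =
    (if r + 4 = deg M + deg M' then F0 M * F0 M' else 0) +
    (if r + 2 = deg M + deg M' then F0 M * F1 M' + F1 M * F0 M' else 0)"
proof -
  have e: "(j + 2 = deg M) = (j = deg M - 2)" for j using assms by auto
  have "(\<Sum>j\<le>r. \<Phi> j M * \<Phi> (r - j) M') =
    (\<Sum>j\<le>r. (if j = deg M - 2 then F0 M * \<Phi> (r - (deg M - 2)) M' else 0) + (if j = deg M then F1 M * \<Phi> (r - deg M) M' else 0))"
    unfolding \<Phi>_def e by (intro sum.cong refl) (auto simp: distrib_right)
  also have "\<dots> = (if deg M - 2 \<le> r then F0 M * \<Phi> (r - (deg M - 2)) M' else 0) + (if deg M \<le> r then F1 M * \<Phi> (r - deg M) M' else 0)"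
    by (simp add: sum.distrib)
  also have "(if deg M - 2 \<le> r then F0 M * \<Phi> (r - (deg M - 2)) M' else 0) =
    (if r + 4 = deg M + deg M' then F0 M * F0 M' else 0) + (if r + 2 = deg M + deg M' then F0 M * F1 M' else 0)"
  proof (cases "deg M - 2 \<le> r")
    case True
    then have "(r - (deg M - 2) + 2 = deg M') = (r + 4 = deg M + deg M')"
      "(r - (deg M - 2) = deg M') = (r + 2 = deg M + deg M')" using assms(1) by arith+
    then have "\<Phi> (r - (deg M - 2)) M' =
      (if r + 4 = deg M + deg M' then F0 M' else 0) + (if r + 2 = deg M + deg M' then F1 M' else 0)"
      unfolding \<Phi>_def by (simp only:)
    then show ?thesis using True by (simp add: distrib_left)
  next
    case False
    then have "r + 4 \<noteq> deg M + deg M'" "r + 2 \<noteq> deg M + deg M'" using assms(2) by arith+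
    then show ?thesis using False by simp
  qed
  also have "(if deg M \<le> r then F1 M * \<Phi> (r - deg M) M' else 0) =
    (if r + 2 = deg M + deg M' then F1 M * F0 M' else 0)"
  proof (cases "deg M \<le> r")
    case True
    then have "(r - deg M + 2 = deg M') = (r + 2 = deg M + deg M')" "r - deg M \<noteq> deg M'"
      using assms(3) by arith+
    then have "\<Phi> (r - deg M) M' = (if r + 2 = deg M + deg M' then F0 M' else 0)"
      unfolding \<Phi>_def by (simp only: if_False add_0_right)
    then show ?thesis using True by simp
  next
    case False
    then have "r + 2 \<noteq> deg M + deg M'" using assms(2) by arith
    then show ?thesis using False by simp
  qed
  finally show ?thesis by simp
qed

section \<open>The recursion for the counts and its solution\<close>

context perm_on
begin

lemma invariant_orbit:
  assumes "Y \<subseteq> X" "f ` Y = Y" "x \<in> Y"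
  shows "orb f x \<subseteq> Y"
proof -
  interpret Y: perm_on Y f
    by unfold_locales (use assms finite_X finite_subset perm in auto)
  show ?thesis using assms by (intro Y.orbit_subset_X)
qed

end

lemma (in perm_on) ctype_union:
  assumes Os: "insert B A \<subseteq> cycles X f" and B: "B \<notin> A"
  shows "perm_on (B \<union> \<Union> A) f" "ctype (B \<union> \<Union> A) f = add_mset (card B) (parts card A)"
proof -
  note s = sub_cycles[OF Os]
  have "B \<union> \<Union> A \<subseteq> X" using Os Union_cycles by blast
  then show "perm_on (B \<union> \<Union> A) f"
    by unfold_locales (use s finite_X finite_subset perm in auto)
  have "finite A" using Os finite_cycles by (metis finite_subset insert_subset)
  then show "ctype (B \<union> \<Union> A) f = add_mset (card B) (parts card A)"
    using s(2) B by (simp add: ctype_def parts_def)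
qed

text \<open>With \<open>t = Max X\<close>, the other point \<open>s\<close> of the last
  transposition lies outside the cycle \<open>C\<close> of \<open>t\<close>, which gives a join, or
  inside, which gives a cut. A join lowers the degree by one and a cut raises it by one, so the
  shorter length \<open>r\<close> stays in the range of the induction hypothesis.\<close>

lemma facts_step:
  fixes X :: "nat set" and f :: "nat \<Rightarrow> nat"
  assumes p: "perm_on X f" and ne: "X \<noteq> {}"
    and IH: "\<And>j X f. j \<le> r \<Longrightarrow> perm_on X f \<Longrightarrow> X \<noteq> {} \<Longrightarrow> j \<le> deg (ctype X f) \<Longrightarrow>
       real (card (facts j X f)) = \<Phi> j (ctype X f)"
    and r: "Suc r \<le> deg (ctype X f)"
  defines "C \<equiv> orb f (Max X)"
  defines "Os \<equiv> cycles X f - {C}"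
  shows "real (card (facts (Suc r) X f)) =
    (\<Sum>A\<in>Os. real (card A) * \<Phi> r (add_mset (card C + card A) (parts card (Os - {A}))))
    + (\<Sum>k=1..<card C. \<Phi> r (add_mset k (add_mset (card C - k) (parts card Os)))
      + (\<Sum>A\<in>Pow Os. \<Sum>j\<le>r. \<Phi> j (add_mset k (parts card A)) * \<Phi> (r - j) (add_mset (card C - k) (parts card (Os - A)))))"
proof -
  interpret perm_on X f by (rule p)
  define t where "t = Max X"
  have t: "t \<in> X" unfolding t_def using finite_X ne by (rule Max_in)
  have C: "C = orb f t" by (simp add: C_def t_def)
  have CX: "C \<in> cycles X f" using t by (auto simp: C cycles_def)
  have tC: "t \<in> C" unfolding C by (rule self_orbit)
  have finO: "finite Os" by (simp add: Os_def)
  have OsX: "Os \<subseteq> cycles X f" by (auto simp: Os_def)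
  have M: "ctype X f = add_mset (card C) (parts card Os)"
    using ctype_remove[OF t] by (simp add: C Os_def)
  define g where "g s = card (facts r X (transpose s t \<circ> f)) + card (joining r X (transpose s t \<circ> f) s t)" for s
  have X: "X - {t} = (C - {t}) \<union> \<Union> Os"
    using Union_cycles CX tC cycles_disjoint[OF CX] unfolding Os_def by blast
  have "card (facts (Suc r) X f) = (\<Sum>s\<in>X - {t}. g s)"
    using facts_Suc[OF finite_X] by (simp add: g_def t_def)
  also have "\<dots> = (\<Sum>s\<in>C - {t}. g s) + (\<Sum>s\<in>\<Union> Os. g s)"
    unfolding X
    by (rule sum.union_disjoint)
      (use finO finite_cycle OsX CX cycles_disjoint[OF CX] in \<open>auto simp: Os_def\<close>)
  also have "(\<Sum>s\<in>\<Union> Os. g s) = (\<Sum>A\<in>Os. \<Sum>s\<in>A. g s)"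
  proof -
    have "\<forall>A\<in>Os. \<forall>B\<in>Os. A \<noteq> B \<longrightarrow> A \<inter> B = {}"
      using cycles_disjoint OsX by blast
    moreover have "\<forall>A\<in>Os. finite A" using finite_cycle OsX by blast
    ultimately show ?thesis by (simp add: sum.Union_disjoint)
  qed
  finally have 1: "real (card (facts (Suc r) X f)) = (\<Sum>A\<in>Os. \<Sum>s\<in>A. real (g s)) + (\<Sum>s\<in>C - {t}. real (g s))"
    by simp
  have join: "real (g s) = \<Phi> r (add_mset (card C + card A) (parts card (Os - {A})))" if A: "A \<in> Os" and s: "s \<in> A" for s A
  proof -
    let ?f = "transpose s t \<circ> f"
    have AX: "A \<in> cycles X f" using A OsX by blast
    have sX: "s \<in> X" using s AX Union_cycles by blast
    have oA: "orb f s = A" using cycle_orbit[OF AX s] .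
    have sC: "s \<notin> orb f t" using A s cycles_disjoint[OF CX AX] unfolding Os_def C by blast
    interpret f': perm_on X ?f using sX t by (rule perm_on_transpose)
    note j = ctype_join[OF t sX sC]
    have ct: "ctype X ?f = add_mset (card C + card A) (parts card (Os - {A}))"
      using j(3) by (simp add: oA C Os_def)
    have "deg (ctype X f) = Suc (deg (ctype X ?f))"
      unfolding M ct using deg_parts_remove[OF finO A, of card] by simp
    then have "r \<le> deg (ctype X ?f)" using r by simp
    then have "real (card (facts r X ?f)) = \<Phi> r (add_mset (card C + card A) (parts card (Os - {A})))"
      using IH[OF _ f'.perm_on_axioms ne] unfolding ct by simp
    \<comment> \<open>After a join, \<open>s\<close> and \<open>t\<close> lie on one cycle, so no
      invariant set separates them and the remaining factorization must be transitive.\<close>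
    moreover have "blocks X ?f s t = {}"
    proof -
      have "t \<in> orb ?f s" using j(1) tC by (simp add: C)
      then have "t \<in> Y" if "Y \<subseteq> X" "s \<in> Y" "?f ` Y = Y" for Y
        using f'.invariant_orbit[OF that(1,3,2)] by blast
      then show ?thesis unfolding blocks_def by blast
    qed
    then have "card (joining r X ?f s t) = 0"
      using card_joining[OF finite_X sX t] by simp
    ultimately show ?thesis by (simp add: g_def)
  qed
  have "(\<Sum>A\<in>Os. \<Sum>s\<in>A. real (g s)) = (\<Sum>A\<in>Os. \<Sum>s\<in>A. \<Phi> r (add_mset (card C + card A) (parts card (Os - {A}))))"
    using join by (intro sum.cong refl) auto
  then have 2: "(\<Sum>A\<in>Os. \<Sum>s\<in>A. real (g s)) = (\<Sum>A\<in>Os. real (card A) * \<Phi> r (add_mset (card C + card A) (parts card (Os - {A}))))"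
    by simp
  define h where "h k = \<Phi> r (add_mset k (add_mset (card C - k) (parts card Os)))
      + (\<Sum>A\<in>Pow Os. \<Sum>j\<le>r. \<Phi> j (add_mset k (parts card A)) * \<Phi> (r - j) (add_mset (card C - k) (parts card (Os - A))))" for k
  obtain ws where ws: "cyc f (t # ws)" using cyc_exists[OF perm] by blast
  define xs where "xs = t # ws"
  have Cxs: "C = set xs" unfolding C xs_def using ws by (rule cyc_orbit) simp
  have dist: "distinct xs" using ws by (simp add: xs_def cyc_def)
  have len: "length xs = card C" unfolding Cxs using dist by (simp add: distinct_card)
  \<comment> \<open>Cutting at the \<open>k\<close>-th successor of \<open>t\<close> leaves
    \<open>t\<close> on a cycle of length \<open>k\<close>; the argument of \<open>h\<close> is the
    length of the piece that contains \<open>s\<close>.\<close>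
  have cut: "real (g (xs ! k)) = h (card C - k)" if k: "k \<in> {1..<card C}" for k
  proof -
    define s us vs where "s = xs ! k" and "us = take (k - 1) ws" and "vs = drop k ws"
    have "Suc (length ws) = card C" "1 \<le> k" "k < card C" using k len by (auto simp: xs_def)
    then have kw: "k - 1 < length ws" by arith
    have sw: "s = ws ! (k - 1)" using k by (simp add: s_def xs_def nth_Cons')
    have "ws = us @ s # vs"
      unfolding us_def vs_def sw using id_take_nth_drop[OF kw] k by simp
    then have dec: "xs = (t # us) @ (s # vs)" by (simp add: xs_def)
    let ?f = "transpose s t \<circ> f"
    have c: "cyc f ((t # us) @ (s # vs))" using ws dec by (simp add: xs_def)
    note cc = cycles_cut[OF t c]
    let ?T = "set (t # us)" and ?S = "set (s # vs)"
    have cardT: "card ?T = k"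
    proof -
      have "distinct (t # us)" using dist dec by auto
      then have "card ?T = length (t # us)" by (rule distinct_card)
      then show ?thesis using k kw by (simp add: us_def)
    qed
    have disj: "?T \<inter> ?S = {}" using dist unfolding dec distinct_append by blast
    have cardS: "card ?S = card C - k"
    proof -
      have "C = ?T \<union> ?S" unfolding Cxs dec by auto
      then have "card C = card ?T + card ?S" using disj by (simp only: card_Un_disjoint finite_set)
      then show ?thesis using cardT by simp
    qed
    have sX: "s \<in> X" by (rule cc(4))
    interpret f': perm_on X ?f using sX t by (rule perm_on_transpose)
    have Tc: "?T \<in> cycles X ?f" and Sc: "?S \<in> cycles X ?f"
      using t sX cc(1,2) unfolding cycles_def by (metis image_eqI)+
    have TS: "?T \<noteq> ?S" using disj by auto
    have Os': "cycles X ?f - {?T} - {?S} = Os" using cc(1-3) by (simp add: Os_def C)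
    then have cyc': "cycles X ?f = insert ?T (insert ?S Os)" and TO: "?T \<notin> Os" and SO: "?S \<notin> Os"
      using Tc Sc by auto
    have ct: "ctype X ?f = add_mset (card C - k) (add_mset k (parts card Os))"
      using f'.ctype_remove[OF t] cc(1) TS TO SO finO cardT cardS unfolding cyc'
      by (simp add: parts_def insert_Diff_if add_mset_commute)
    have degM: "deg (ctype X f) = Suc (card C) + deg (parts card Os)" unfolding M by simp
    have "r \<le> deg (ctype X ?f)" unfolding ct using r k unfolding degM by simp
    then have f1: "real (card (facts r X ?f)) = \<Phi> r (add_mset (card C - k) (add_mset k (parts card Os)))"
      using IH[OF _ f'.perm_on_axioms ne] unfolding ct by simp
    have block: "real (card (facts j (?S \<union> \<Union> A) ?f)) * real (card (facts (r - j) (X - (?S \<union> \<Union> A)) ?f))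
      = \<Phi> j (add_mset (card C - k) (parts card A)) * \<Phi> (r - j) (add_mset k (parts card (Os - A)))"
      if A: "A \<subseteq> Os" and j: "j \<le> r" for A j
    proof -
      have XY: "X - (?S \<union> \<Union> A) = ?T \<union> \<Union> (Os - A)"
      proof -
        have "X = ?T \<union> (?S \<union> \<Union> Os)" using f'.Union_cycles unfolding cyc' by blast
        moreover have "?T \<inter> \<Union> A = {}" "?S \<inter> \<Union> (Os - A) = {}" "\<Union> A \<inter> \<Union> (Os - A) = {}"
          using f'.cycles_disjoint A TO SO unfolding cyc' by blast+
        ultimately show ?thesis using disj A by blast
      qed
      have Sn: "?S \<notin> A" "?T \<notin> Os - A" using A SO TO by blast+
      have Sub: "insert ?S A \<subseteq> cycles X ?f" "insert ?T (Os - A) \<subseteq> cycles X ?f" unfolding cyc' using A by blast+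
      note u1 = f'.ctype_union[OF Sub(1) Sn(1)] and u2 = f'.ctype_union[OF Sub(2) Sn(2)]
      let ?Y = "?S \<union> \<Union> A" and ?Z = "?T \<union> \<Union> (Os - A)"
      have nonempty: "?Y \<noteq> {}" "?Z \<noteq> {}" by auto
      define N1 N2 where "N1 = deg (ctype ?Y ?f)" and "N2 = deg (ctype ?Z ?f)"
      have N: "N1 + N2 = Suc (deg (ctype X f))"
        unfolding N1_def N2_def u1(2) u2(2) degM cardS cardT
        using deg_parts_split[OF finO A, of card] k by simp
      have v1: "real (card (facts j ?Y ?f)) = \<Phi> j (ctype ?Y ?f)" if "j \<le> N1"
        using IH[OF j u1(1) nonempty(1)] that by (simp add: N1_def)
      have v2: "real (card (facts (r - j) ?Z ?f)) = \<Phi> (r - j) (ctype ?Z ?f)" if "r - j \<le> N2"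
        using IH[OF _ u2(1) nonempty(2)] that by (simp add: N2_def)
      \<comment> \<open>The induction hypothesis reaches only up to the degree of each piece. But
        \<open>r \<le> N1 + N2 - 2\<close>, so if one length exceeds its degree, the other lies
        below its degree minus 2 and counts nothing; both products are then zero.\<close>
      have z1: "\<Phi> j (ctype ?Y ?f) = 0" if "r - j > N2"
        using that N r j unfolding \<Phi>_def N1_def[symmetric] by auto
      have z2: "\<Phi> (r - j) (ctype ?Z ?f) = 0" if "j > N1"
        using that N r j unfolding \<Phi>_def N2_def[symmetric] by auto
      have "j \<le> N1 \<or> r - j \<le> N2" using N r j by linarith
      then have "real (card (facts j ?Y ?f)) * real (card (facts (r - j) ?Z ?f))
        = \<Phi> j (ctype ?Y ?f) * \<Phi> (r - j) (ctype ?Z ?f)"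
        using v1 v2 z1 z2 by (metis mult_zero_left mult_zero_right not_le)
      then show ?thesis unfolding XY u1(2) u2(2) cardS cardT .
    qed
    have "card (joining r X ?f s t) = (\<Sum>Y\<in>blocks X ?f s t. \<Sum>j\<le>r. card (facts j Y ?f) * card (facts (r - j) (X - Y) ?f))"
      by (rule card_joining[OF finite_X sX t])
    \<comment> \<open>Invariant sets are unions of cycles. A block contains the cycle of
      \<open>s\<close> but not that of \<open>t\<close>, so it is determined by a subset of the
      untouched cycles.\<close>
    also have "\<dots> = (\<Sum>A\<in>Pow Os. \<Sum>j\<le>r. card (facts j (?S \<union> \<Union> A) ?f) * card (facts (r - j) (X - (?S \<union> \<Union> A)) ?f))"
    proof (rule sum.reindex_bij_witness[of _ "\<lambda>A. ?S \<union> \<Union> A" "\<lambda>Y. cycles Y ?f - {?S}"])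
      fix Y assume "Y \<in> blocks X ?f s t"
      then have Y: "Y \<subseteq> X" "s \<in> Y" "t \<notin> Y" "?f ` Y = Y" by (auto simp: blocks_def)
      note inv = f'.invariant_subset[OF Y(1,4)]
      have "?S \<in> cycles Y ?f" using cc(2) Y(2) unfolding cycles_def by (metis image_eqI)
      then show SY: "?S \<union> \<Union> (cycles Y ?f - {?S}) = Y" using inv(2) by blast
      have "?T \<notin> cycles Y ?f" using Y(3) inv(2) by auto
      then show "cycles Y ?f - {?S} \<in> Pow Os" using inv(1) unfolding cyc' by blast
      show "(\<Sum>j\<le>r. card (facts j (?S \<union> \<Union> (cycles Y ?f - {?S})) ?f) * card (facts (r - j) (X - (?S \<union> \<Union> (cycles Y ?f - {?S}))) ?f))
        = (\<Sum>j\<le>r. card (facts j Y ?f) * card (facts (r - j) (X - Y) ?f))"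
        unfolding SY ..
    next
      fix A assume "A \<in> Pow Os"
      then have A: "A \<subseteq> Os" by simp
      have Sub: "insert ?S A \<subseteq> cycles X ?f" unfolding cyc' using A by blast
      have Sn: "?S \<notin> A" using A SO by blast
      note sc = f'.sub_cycles[OF Sub]
      show "cycles (?S \<union> \<Union> A) ?f - {?S} = A" using sc(2) Sn by simp
      have "t \<notin> ?S \<union> \<Union> A"
        using disj f'.cycles_disjoint[OF Tc] A TO Sub by auto
      moreover have "?S \<union> \<Union> A \<subseteq> X" using Sub f'.Union_cycles by blast
      ultimately show "?S \<union> \<Union> A \<in> blocks X ?f s t"
        using sc(1) by (simp add: blocks_def)
    qed
    finally have "real (card (joining r X ?f s t)) =
      (\<Sum>A\<in>Pow Os. \<Sum>j\<le>r. real (card (facts j (?S \<union> \<Union> A) ?f)) * real (card (facts (r - j) (X - (?S \<union> \<Union> A)) ?f)))"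
      by simp
    also have "\<dots> = (\<Sum>A\<in>Pow Os. \<Sum>j\<le>r. \<Phi> j (add_mset (card C - k) (parts card A)) * \<Phi> (r - j) (add_mset k (parts card (Os - A))))"
      using block by (intro sum.cong refl) auto
    finally show ?thesis
      using f1 k unfolding g_def h_def s_def[symmetric] by simp
  qed
  have "(\<Sum>s\<in>C - {t}. real (g s)) = (\<Sum>k=1..<card C. real (g (xs ! k)))"
  proof (rule sum.reindex_bij_betw[symmetric])
    have "bij_betw ((!) xs) {..<card C} C"
      using bij_betw_nth[OF dist] len Cxs by auto
    then have "bij_betw ((!) xs) ({..<card C} - {0}) (C - {xs ! 0})"
      by (rule bij_betw_DiffI) (use len tC in \<open>auto simp: bij_betw_def xs_def\<close>)
    moreover have "{..<card C} - {0} = {1..<card C}" by auto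
    ultimately show "bij_betw ((!) xs) {1..<card C} (C - {t})" by (simp add: xs_def)
  qed
  also have "\<dots> = (\<Sum>k=1..<card C. h (card C - k))"
    using cut by (intro sum.cong refl)
  also have "\<dots> = (\<Sum>k=1..<card C. h k)"
    by (rule sum.reindex_bij_witness[of _ "\<lambda>k. card C - k" "\<lambda>k. card C - k"]) auto
  finally show ?thesis unfolding 1 2 h_def by simp
qed

text \<open>Separates the recursion by length: with \<open>n\<close> the degree,
  \<open>r + 3 = n\<close> is the genus zero case and \<open>r + 1 = n\<close> the genus one case,
  while in the remaining cases both sides vanish.\<close>

lemma \<Phi>_step:
  fixes I :: "'i set"
  assumes w: "weights I a" and m: "m > 0"
    and r: "Suc r \<le> deg (add_mset m (parts a I))"
  shows "\<Phi> (Suc r) (add_mset m (parts a I)) =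
    (\<Sum>i\<in>I. real (a i) * \<Phi> r (add_mset (m + a i) (parts a (I - {i}))))
    + (\<Sum>k=1..<m. \<Phi> r (add_mset k (add_mset (m - k) (parts a I)))
      + (\<Sum>A\<in>Pow I. \<Sum>j\<le>r. \<Phi> j (add_mset k (parts a A)) * \<Phi> (r - j) (add_mset (m - k) (parts a (I - A)))))"
proof -
  interpret weights I a by (rule w)
  let ?M = "add_mset m (parts a I)"
  define n where "n = deg ?M"
  have n: "n = Suc m + deg (parts a I)" by (simp add: n_def)
  have d1: "deg (add_mset (m + a i) (parts a (I - {i}))) = n - 1" if "i \<in> I" for i
    using deg_parts_remove[OF finite_I that, of a] by (simp add: n)
  have d2: "deg (add_mset k (add_mset (m - k) (parts a I))) = Suc n" if "k \<in> {1..<m}" for k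
    using that by (simp add: n)
  have d3: "deg (add_mset k (parts a A)) + deg (add_mset (m - k) (parts a (I - A))) = Suc n"
    "deg (add_mset k (parts a A)) \<ge> 2" "deg (add_mset (m - k) (parts a (I - A))) \<ge> 2"
    if "k \<in> {1..<m}" "A \<in> Pow I" for k A
    using that deg_parts_split[OF finite_I, of A a] by (auto simp: n)
  have conv: "(\<Sum>j\<le>r. \<Phi> j (add_mset k (parts a A)) * \<Phi> (r - j) (add_mset (m - k) (parts a (I - A)))) =
    (if r + 3 = n then F0 (add_mset k (parts a A)) * F0 (add_mset (m - k) (parts a (I - A))) else 0)
    + (if r + 1 = n then F0 (add_mset k (parts a A)) * F1 (add_mset (m - k) (parts a (I - A)))
      + F1 (add_mset k (parts a A)) * F0 (add_mset (m - k) (parts a (I - A))) else 0)"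
    if "k \<in> {1..<m}" "A \<in> Pow I" for k A
    using d3[OF that] r by (subst \<Phi>_convolution) (auto simp: n_def)
  have join: "\<Phi> r (add_mset (m + a i) (parts a (I - {i}))) =
    (if r + 3 = n then F0 (add_mset (m + a i) (parts a (I - {i}))) else 0)
    + (if r + 1 = n then F1 (add_mset (m + a i) (parts a (I - {i}))) else 0)" if "i \<in> I" for i
    unfolding \<Phi>_def d1[OF that] using m by (auto simp: n)
  have cut: "\<Phi> r (add_mset k (add_mset (m - k) (parts a I))) =
    (if r + 1 = n then F0 (add_mset k (add_mset (m - k) (parts a I))) else 0)" if "k \<in> {1..<m}" for k
    unfolding \<Phi>_def d2[OF that] using r by (auto simp: n_def)
  have rhs: "(\<Sum>i\<in>I. real (a i) * \<Phi> r (add_mset (m + a i) (parts a (I - {i}))))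
    + (\<Sum>k=1..<m. \<Phi> r (add_mset k (add_mset (m - k) (parts a I)))
      + (\<Sum>A\<in>Pow I. \<Sum>j\<le>r. \<Phi> j (add_mset k (parts a A)) * \<Phi> (r - j) (add_mset (m - k) (parts a (I - A)))))
    = (\<Sum>i\<in>I. real (a i) * ((if r + 3 = n then F0 (add_mset (m + a i) (parts a (I - {i}))) else 0)
        + (if r + 1 = n then F1 (add_mset (m + a i) (parts a (I - {i}))) else 0)))
    + (\<Sum>k=1..<m. (if r + 1 = n then F0 (add_mset k (add_mset (m - k) (parts a I))) else 0)
      + (\<Sum>A\<in>Pow I. (if r + 3 = n then F0 (add_mset k (parts a A)) * F0 (add_mset (m - k) (parts a (I - A))) else 0)
        + (if r + 1 = n then F0 (add_mset k (parts a A)) * F1 (add_mset (m - k) (parts a (I - A)))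
          + F1 (add_mset k (parts a A)) * F0 (add_mset (m - k) (parts a (I - A))) else 0)))"
    using join cut conv by simp
  have "\<Phi> (Suc r) ?M = (if r + 3 = n then F0 ?M else 0) + (if r + 1 = n then F1 ?M else 0)"
    unfolding \<Phi>_def n_def[symmetric] by (auto simp: numeral_3_eq_3)
  \<comment> \<open>A single fixed point has degree 2, which is too small for
    \<open>r + 3 = n\<close>.\<close>
  moreover have "m \<noteq> 1 \<or> I \<noteq> {}" if "r + 3 = n"
    using that by (auto simp: n deg_def parts_def)
  ultimately show ?thesis
    unfolding rhs using F0_rec[OF m] F1_rec[OF m] by auto
qed

theorem card_facts:
  assumes "perm_on X f" "X \<noteq> {}" "r \<le> deg (ctype X f)"
  shows "real (card (facts r X f)) = \<Phi> r (ctype X f)"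
  using assms
proof (induction r arbitrary: X f rule: less_induct)
  case (less r)
  interpret perm_on X f by (rule less.prems)
  define t where "t = Max X"
  have t: "t \<in> X" unfolding t_def using finite_X less.prems by (intro Max_in)
  let ?C = "orb f t"
  let ?Os = "cycles X f - {?C}"
  have M: "ctype X f = add_mset (card ?C) (parts card ?Os)" by (rule ctype_remove[OF t])
  have C0: "card ?C > 0" using t by (intro card_cycle) (auto simp: cycles_def)
  have w: "weights ?Os card" by unfold_locales (use card_cycle in auto)
  show ?case
  proof (cases r)
    case 0
    show ?thesis
    proof (cases "X = {t}")
      case True
      then have ft: "f t = t" using image_X by auto
      then have C: "?C = {t}" by (simp add: orbit_eq_singleton_iff)
      then have "ctype X f = {#1#}"
        unfolding M using True by (simp add: cycles_def parts_def)
      moreover have "F0 {#1#} = 1"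
        by (simp add: F0_def weight_def wt_def cbin_def rising3_def numeral_2_eq_2)
      moreover have "facts 0 X f = {[]}"
        using True ft by (auto simp: facts_def mono_seqs_def conn_def)
      ultimately show ?thesis using 0 by (simp add: \<Phi>_def deg_def)
    next
      case False
      then obtain u where u: "u \<in> X" "u \<noteq> t" using t by blast
      then have "facts 0 X f = {}"
        using t by (auto simp: facts_def mono_seqs_def conn_def edges_def)
      \<comment> \<open>Length 0 would have a nonzero prediction only for degree 0 or 2.\<close>
      moreover have "deg (ctype X f) \<ge> 3"
      proof -
        have "card {t, u} \<le> card X" using t u finite_X by (intro card_mono) auto
        then have "card X \<ge> 2" using u by auto
        moreover have "size (ctype X f) \<ge> 1" unfolding M by simp
        ultimately show ?thesis unfolding deg_def sum_ctype by linarith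
      qed
      ultimately show ?thesis using 0 by (simp add: \<Phi>_def)
    qed
  next
    case (Suc r')
    have "real (card (facts (Suc r') X f)) =
      (\<Sum>A\<in>?Os. real (card A) * \<Phi> r' (add_mset (card ?C + card A) (parts card (?Os - {A}))))
      + (\<Sum>k=1..<card ?C. \<Phi> r' (add_mset k (add_mset (card ?C - k) (parts card ?Os)))
        + (\<Sum>A\<in>Pow ?Os. \<Sum>j\<le>r'. \<Phi> j (add_mset k (parts card A)) * \<Phi> (r' - j) (add_mset (card ?C - k) (parts card (?Os - A)))))"
      unfolding t_def using less Suc by (intro facts_step) auto
    also have "\<dots> = \<Phi> (Suc r') (ctype X f)"
      unfolding M using less.prems Suc by (intro \<Phi>_step[OF w C0, symmetric]) (simp add: M)
    finally show ?thesis using Suc by simp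
  qed
qed

section \<open>Permutations of given cycle type\<close>

lemma perm_on_permutes: "finite X \<Longrightarrow> p permutes X \<Longrightarrow> perm_on X p"
  by unfold_locales (auto simp: permutation_permutes permutes_image)

text \<open>The order of the centralizer of a permutation with cycle type \<open>M\<close>.\<close>

definition zsize :: "nat multiset \<Rightarrow> nat" where
  "zsize M = (\<Prod>m\<in>#M. m) * (\<Prod>k\<in>set_mset M. fact (count M k))"

lemma zsize_add: "zsize (add_mset k M) = k * Suc (count M k) * zsize M"
proof -
  have "(\<Prod>j\<in>set_mset (add_mset k M). fact (count (add_mset k M) j))
    = fact (Suc (count M k)) * (\<Prod>j\<in>set_mset M - {k}. fact (count M j) :: nat)"
    by (subst prod.remove[of _ k]) (auto intro!: prod.cong)
  moreover have "(\<Prod>j\<in>set_mset M. fact (count M j)) = fact (count M k) * (\<Prod>j\<in>set_mset M - {k}. fact (count M j) :: nat)"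
  proof (cases "k \<in># M")
    case True
    then show ?thesis by (simp add: prod.remove)
  next
    case False
    then have "count M k = 0" by (simp add: count_eq_zero_iff)
    then show ?thesis using False by simp
  qed
  ultimately show ?thesis by (simp add: zsize_def algebra_simps)
qed

lemma sum_mset_count:
  "finite S \<Longrightarrow> set_mset M \<subseteq> S \<Longrightarrow> \<Sum>\<^sub># M = (\<Sum>j\<in>S. count M j * j)" for M :: "nat multiset"
proof (induction M)
  case (add k M)
  have "(\<Sum>j\<in>S. count (add_mset k M) j * j) = (\<Sum>j\<in>S. count M j * j + (if j = k then k else 0))"
    by (intro sum.cong) auto
  also have "\<dots> = \<Sum>\<^sub># M + k"
    using add by (simp add: sum.distrib)
  finally show ?case by simp
qed simp

text \<open>A sum of indicators instead of a cardinality, so that the sum over the permutations of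
  an enlarged set can be decomposed.\<close>

definition num_perms :: "nat set \<Rightarrow> nat multiset \<Rightarrow> nat" where
  "num_perms X M = (\<Sum>p | p permutes X. if ctype X p = M then 1 else 0)"

lemma count_ctype:
  assumes "finite Os"
  shows "count (parts card Os) k = card {A \<in> Os. card A = k}"
proof -
  have "count (parts card Os) k = (\<Sum>A | A \<in># mset_set Os \<and> k = card A. count (mset_set Os) A)"
    unfolding parts_def by (rule count_image_mset')
  also have "\<dots> = (\<Sum>A\<in>{A \<in> Os. card A = k}. 1)"
    using assms by (intro sum.cong) auto
  finally show ?thesis by simp
qed

lemma parts_remove: "finite S \<Longrightarrow> A \<in> S \<Longrightarrow> parts a S = add_mset (a A) (parts a (S - {A}))"
  unfolding parts_def by (subst mset_set.remove) auto

abbreviation shrink :: "nat multiset \<Rightarrow> nat \<Rightarrow> nat multiset" where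
  "shrink M j \<equiv> add_mset (j - 1) (M - {#j#})"

text \<open>Group the cycles by their length \<open>j\<close> after growing: the old type must be
  \<open>shrink M j\<close>, any of its cycles of length \<open>j - 1\<close> may have grown, and
  each of them has \<open>j - 1\<close> places for the new point.\<close>

lemma sum_grow_cycle:
  fixes Os :: "'b set set"
  assumes fin: "finite Os" and pos: "\<And>A. A \<in> Os \<Longrightarrow> card A > 0"
  shows "(\<Sum>A\<in>Os. card A * (if add_mset (Suc (card A)) (parts card (Os - {A})) = M then 1 else 0))
    = (\<Sum>j\<in>set_mset M - {1}. (j - 1) * count (shrink M j) (j - 1)
        * (if parts card Os = shrink M j then 1 else 0))"
proof -
  define S where "S = {A \<in> Os. add_mset (Suc (card A)) (parts card (Os - {A})) = M}"
  have finS: "finite S" using fin by (simp add: S_def)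
  have "(\<Sum>A\<in>Os. card A * (if add_mset (Suc (card A)) (parts card (Os - {A})) = M then 1 else 0)) = (\<Sum>A\<in>S. card A)"
    unfolding S_def using fin by (simp add: sum.inter_filter[symmetric] if_distrib cong: if_cong)
  also have "\<dots> = (\<Sum>j\<in>set_mset M - {1}. \<Sum>A\<in>{A \<in> S. Suc (card A) = j}. card A)"
  proof (rule sum.group[symmetric])
    show "(\<lambda>A. Suc (card A)) ` S \<subseteq> set_mset M - {1}"
    proof safe
      fix A assume "A \<in> S"
      then have A: "add_mset (Suc (card A)) (parts card (Os - {A})) = M" "A \<in> Os" by (auto simp: S_def)
      show "Suc (card A) \<in># M" unfolding A(1)[symmetric] by simp
      show False if "Suc (card A) = 1" using that pos[OF A(2)] by simp
    qed
  qed (use finS in auto)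
  also have "\<dots> = (\<Sum>j\<in>set_mset M - {1}. (j - 1) * count (shrink M j) (j - 1)
        * (if parts card Os = shrink M j then 1 else 0))"
  proof (rule sum.cong)
    fix j assume j: "j \<in> set_mset M - {1}"
    have iff: "add_mset (Suc (card A)) (parts card (Os - {A})) = M \<longleftrightarrow> parts card Os = shrink M j"
      if "A \<in> Os" "Suc (card A) = j" for A
    proof -
      have "parts card Os = add_mset (j - 1) (parts card (Os - {A}))"
        using parts_remove[OF fin that(1), of card] that(2) by auto
      moreover have "M = add_mset j (M - {#j#})" using j by simp
      ultimately show ?thesis using that(2) by (metis add_mset_add_mset_same_iff)
    qed
    show "(\<Sum>A\<in>{A \<in> S. Suc (card A) = j}. card A) = (j - 1) * count (shrink M j) (j - 1)
        * (if parts card Os = shrink M j then 1 else 0)"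
    proof (cases "parts card Os = shrink M j")
      case True
      \<comment> \<open>For \<open>j = 0\<close> the truncated \<open>j - 1\<close> would be a part
        0, but cycles are nonempty.\<close>
      have "j > 0"
      proof (rule ccontr)
        assume "\<not> j > 0"
        then have "0 \<in># parts card Os" unfolding True by simp
        then show False using pos fin unfolding parts_def by fastforce
      qed
      have "{A \<in> S. Suc (card A) = j} = {A \<in> Os. Suc (card A) = j}"
        unfolding S_def using iff True by blast
      also have "\<dots> = {A \<in> Os. card A = j - 1}" using \<open>j > 0\<close> by auto
      finally have eq: "{A \<in> S. Suc (card A) = j} = {A \<in> Os. card A = j - 1}" .
      have "(\<Sum>A\<in>{A \<in> S. Suc (card A) = j}. card A) = (\<Sum>A\<in>{A \<in> Os. card A = j - 1}. j - 1)"
        unfolding eq by (intro sum.cong) auto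
      also have "\<dots> = count (parts card Os) (j - 1) * (j - 1)"
        using count_ctype[OF fin] by simp
      finally show ?thesis using True by simp
    next
      case False
      then have none: "{A \<in> S. Suc (card A) = j} = {}" using iff unfolding S_def by blast
      show ?thesis unfolding none using False by simp
    qed
  qed simp
  finally show ?thesis .
qed

text \<open>Each permutation of the larger set is uniquely \<open>transpose t b\<close> after a
  permutation \<open>q\<close> of \<open>X\<close>. For \<open>b = t\<close> the new point is fixed,
  and otherwise it lengthens the cycle of \<open>b\<close>.\<close>

lemma num_perms_insert:
  assumes X: "finite X" "t \<notin> X"
  shows "num_perms (insert t X) M = (if 1 \<in># M then num_perms X (M - {#1#}) else 0)
    + (\<Sum>j\<in>set_mset M - {1}. (j - 1) * count (shrink M j) (j - 1)
        * num_perms X (shrink M j))"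
proof -
  let ?X = "insert t X"
  let ?i = "\<lambda>b. if b then 1 else 0 :: nat"
  have each: "(\<Sum>b\<in>?X. ?i (ctype ?X (transpose t b \<circ> q) = M)) = ?i (add_mset 1 (ctype X q) = M)
    + (\<Sum>j\<in>set_mset M - {1}. (j - 1) * count (shrink M j) (j - 1)
        * ?i (ctype X q = shrink M j))" if q: "q permutes X" for q
  proof -
    interpret q: perm_on X q using X(1) q by (rule perm_on_permutes)
    have "q permutes ?X" using q by (rule permutes_subset) auto
    then interpret q': perm_on ?X q using X(1) by (intro perm_on_permutes) auto
    have "q t = t" using q X(2) by (simp add: permutes_not_in)
    then have o: "orb q t = {t}" by (simp add: orbit_eq_singleton_iff)
    have tn: "{t} \<notin> cycles X q" using q.Union_cycles X(2) by auto
    have cyc: "cycles ?X q = insert {t} (cycles X q)" using o by (simp add: cycles_def)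
    have "cycles ?X q - {{t}} = cycles X q" unfolding cyc using tn by simp
    note cyc' = this
    have "ctype ?X (transpose t t \<circ> q) = add_mset 1 (ctype X q)"
      using q'.ctype_remove[of t] o cyc' by (simp add: ctype_def)
    moreover have "(\<Sum>b\<in>X. ?i (ctype ?X (transpose t b \<circ> q) = M))
      = (\<Sum>A\<in>cycles X q. \<Sum>b\<in>A. ?i (ctype ?X (transpose t b \<circ> q) = M))"
    proof -
      have "\<forall>A\<in>cycles X q. \<forall>B\<in>cycles X q. A \<noteq> B \<longrightarrow> A \<inter> B = {}"
        using q.cycles_disjoint by blast
      then have "(\<Sum>b\<in>\<Union> (cycles X q). ?i (ctype ?X (transpose t b \<circ> q) = M))
        = (\<Sum>A\<in>cycles X q. \<Sum>b\<in>A. ?i (ctype ?X (transpose t b \<circ> q) = M))"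
        using q.finite_cycle by (subst sum.Union_disjoint) auto
      then show ?thesis unfolding q.Union_cycles .
    qed
    moreover have "(\<Sum>A\<in>cycles X q. \<Sum>b\<in>A. ?i (ctype ?X (transpose t b \<circ> q) = M))
      = (\<Sum>A\<in>cycles X q. card A * ?i (add_mset (Suc (card A)) (parts card (cycles X q - {A})) = M))"
    proof (rule sum.cong)
      fix A assume A: "A \<in> cycles X q"
      have "ctype ?X (transpose t b \<circ> q) = add_mset (Suc (card A)) (parts card (cycles X q - {A}))" if b: "b \<in> A" for b
      proof -
        have bX: "b \<in> X" using A b q.Union_cycles by blast
        then have "b \<notin> orb q t" using o X(2) by auto
        then have "ctype ?X (transpose b t \<circ> q) = add_mset (card (orb q t) + card (orb q b))
          (parts card (cycles ?X q - {orb q t} - {orb q b}))"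
          using bX by (intro q'.ctype_join) auto
        then show ?thesis
          unfolding o cyc' q.cycle_orbit[OF A b] by (simp add: transpose_commute)
      qed
      then show "(\<Sum>b\<in>A. ?i (ctype ?X (transpose t b \<circ> q) = M))
        = card A * ?i (add_mset (Suc (card A)) (parts card (cycles X q - {A})) = M)"
        by simp
    qed simp
    moreover have "(\<Sum>A\<in>cycles X q. card A * ?i (add_mset (Suc (card A)) (parts card (cycles X q - {A})) = M))
      = (\<Sum>j\<in>set_mset M - {1}. (j - 1) * count (shrink M j) (j - 1)
        * ?i (ctype X q = shrink M j))"
      unfolding ctype_def by (rule sum_grow_cycle[OF q.finite_cycles q.card_cycle])
    ultimately show ?thesis using X by simp
  qed
  have fin: "finite {q. q permutes X}" using X(1) by (rule finite_permutations)
  have "num_perms ?X M = (\<Sum>q | q permutes X. \<Sum>b\<in>?X. ?i (ctype ?X (transpose t b \<circ> q) = M))"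
    unfolding num_perms_def sum_over_permutations_insert[OF X] by (rule sum.swap)
  also have "\<dots> = (\<Sum>q | q permutes X. ?i (add_mset 1 (ctype X q) = M)
    + (\<Sum>j\<in>set_mset M - {1}. (j - 1) * count (shrink M j) (j - 1)
        * ?i (ctype X q = shrink M j)))"
    using each by (intro sum.cong) auto
  also have "\<dots> = (\<Sum>q | q permutes X. ?i (add_mset 1 (ctype X q) = M))
    + (\<Sum>j\<in>set_mset M - {1}. \<Sum>q | q permutes X. (j - 1) * count (shrink M j) (j - 1)
        * ?i (ctype X q = shrink M j))"
    unfolding sum.distrib by (subst sum.swap) rule
  also have "(\<Sum>q | q permutes X. ?i (add_mset 1 (ctype X q) = M)) = (if 1 \<in># M then num_perms X (M - {#1#}) else 0)"
  proof (cases "1 \<in># M")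
    case True
    then have "(add_mset 1 N = M) = (N = M - {#1#})" for N by auto
    then show ?thesis using True by (simp add: num_perms_def)
  next
    case False
    then have "add_mset 1 N \<noteq> M" for N by auto
    then show ?thesis using False by simp
  qed
  finally show ?thesis by (simp only: num_perms_def sum_distrib_left)
qed

text \<open>By induction on \<open>X\<close>: with \<open>n\<close> the size before insertion, each
  value \<open>j\<close> of a part contributes \<open>count M j * j * n!\<close>, and the products
  \<open>count M j * j\<close> add up to \<open>n + 1\<close>.\<close>

lemma num_perms:
  assumes "finite X" "0 \<notin># M" "\<Sum>\<^sub># M = card X"
  shows "num_perms X M * zsize M = fact (card X)"
  using assms
proof (induction X arbitrary: M rule: finite_induct)
  case empty
  then have "M = {#}" by (cases M) auto
  moreover have "num_perms {} {#} = 1" by (simp add: num_perms_def ctype_def cycles_def parts_def)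
  ultimately show ?case by (simp add: zsize_def)
next
  case (insert t X)
  define n where "n = card X"
  have first: "(if 1 \<in># M then num_perms X (M - {#1#}) else 0) * zsize M = (if 1 \<in># M then count M 1 * fact n else 0)"
  proof (cases "1 \<in># M")
    case True
    then obtain M' where M': "M = add_mset 1 M'" by (metis mset_add)
    have "num_perms X M' * zsize M' = fact n"
      using insert.prems insert.hyps unfolding n_def by (intro insert.IH) (auto simp: M')
    moreover have "num_perms X M' * zsize M = Suc (count M' 1) * (num_perms X M' * zsize M')"
      unfolding M' zsize_add by (simp only: mult_ac mult_1)
    ultimately have "num_perms X M' * zsize M = Suc (count M' 1) * fact n" by (simp only:)
    then show ?thesis by (simp add: M')
  qed simp
  have rest: "(j - 1) * count (shrink M j) (j - 1) * num_perms X (shrink M j) * zsize M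
    = count M j * j * fact n" if j: "j \<in> set_mset M - {1}" for j
  proof -
    obtain M' where M': "M = add_mset j M'" using j by (metis DiffD1 mset_add)
    have j2: "j \<ge> 2" using j insert.prems(1) by (cases j) (auto simp: Suc_le_eq)
    let ?N = "add_mset (j - 1) M'"
    have IH: "num_perms X ?N * zsize ?N = fact n"
      using insert.prems insert.hyps j2 unfolding n_def by (intro insert.IH) (auto simp: M')
    have zN: "zsize ?N = (j - 1) * count ?N (j - 1) * zsize M'" by (simp add: zsize_add)
    have zM: "zsize M = j * count M j * zsize M'" by (simp add: zsize_add M')
    have "M - {#j#} = M'" by (simp add: M')
    then have "(j - 1) * count (shrink M j) (j - 1) * num_perms X (shrink M j) * zsize M
      = (num_perms X ?N * zsize ?N) * (count M j * j)"
      unfolding zN zM by (simp only: mult_ac)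
    then show ?thesis unfolding IH by (simp only: mult_ac)
  qed
  have "num_perms (insert t X) M * zsize M = (if 1 \<in># M then num_perms X (M - {#1#}) else 0) * zsize M
    + (\<Sum>j\<in>set_mset M - {1}. (j - 1) * count (shrink M j) (j - 1)
        * num_perms X (shrink M j) * zsize M)"
    unfolding num_perms_insert[OF insert.hyps] distrib_right sum_distrib_right ..
  also have "\<dots> = (if 1 \<in># M then count M 1 * fact n else 0) + (\<Sum>j\<in>set_mset M - {1}. count M j * j * fact n)"
    unfolding first using rest by simp
  also have "\<dots> = (\<Sum>j\<in>set_mset M. count M j * j * fact n)"
    by (cases "1 \<in># M") (simp_all add: sum.remove[of _ 1])
  also have "\<dots> = \<Sum>\<^sub># M * fact n"
    using sum_mset_count[of "set_mset M" M] by (simp flip: sum_distrib_right)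
  finally show ?case using insert.prems insert.hyps by (simp add: n_def)
qed

section \<open>From factorizations in the symmetric group to sequences of pairs\<close>

lemma reach_swaps: "(x, swaps ps x) \<in> (edges ps)\<^sup>*"
proof (induction ps)
  case (Cons p ps)
  obtain u v where p: "p = (u, v)" by fastforce
  have "(x, swaps ps x) \<in> (edges (p # ps))\<^sup>*"
    using Cons edges_mono[of ps "p # ps"] by auto
  moreover have "(swaps ps x, transpose u v (swaps ps x)) \<in> (edges (p # ps))\<^sup>*"
    by (auto simp: transpose_def p edges_def)
  ultimately show ?case by (simp add: p)
qed simp

lemma swaps_permutes: "ps \<in> mono_seqs r X \<Longrightarrow> swaps ps permutes X"
proof (induction ps arbitrary: r)
  case (Cons p ps)
  obtain u v where p: "p = (u, v)" by fastforce
  have "swaps ps permutes X" using Cons by (intro Cons.IH[of "length ps"]) (auto simp: mono_seqs_def)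
  moreover have "transpose u v permutes X"
    using Cons.prems p by (intro permutes_swap_id) (auto simp: mono_seqs_def)
  ultimately show ?case unfolding p swaps_simps by (rule permutes_compose)
qed (simp add: permutes_id)

text \<open>The permutation \<open>f\<close> inverts the product of the transpositions, so it moves
  points only inside the components of their graph. Conversely every edge is itself a
  generator.\<close>

lemma transitive_iff_conn:
  fixes d :: nat
  defines "X \<equiv> {1..d}"
  assumes f: "f permutes X" and ps: "ps \<in> mono_seqs r X" and fs: "\<forall>x\<in>X. f (swaps ps x) = x"
  shows "transitive_on X (generate (sym_group d) (insert f (set (map (\<lambda>(s, t). transpose s t) ps)))) \<longleftrightarrow> conn X ps"
    (is "transitive_on X (generate ?G ?H) \<longleftrightarrow> _")
proof
  have tr: "transpose s t permutes X" if "(s, t) \<in> set ps" for s t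
    using that ps by (intro permutes_swap_id) (auto simp: mono_seqs_def)
  have H: "h permutes X \<and> (\<forall>x\<in>X. (x, h x) \<in> (edges ps)\<^sup>*)" if h: "h \<in> ?H" for h
  proof (cases "h = f")
    case True
    have "(x, f x) \<in> (edges ps)\<^sup>*" if x: "x \<in> X" for x
    proof -
      have "(swaps ps) ` X = X"
        using swaps_permutes[OF ps] by (rule permutes_image)
      then obtain y where y: "y \<in> X" "x = swaps ps y" using x by blast
      then have "f x = y" using fs by simp
      then show ?thesis using reach_swaps[of y ps] y edges_rtrancl_sym by metis
    qed
    then show ?thesis using True f by simp
  next
    case False
    then obtain s t where st: "(s, t) \<in> set ps" "h = transpose s t" using h by auto
    then have "(x, h x) \<in> (edges ps)\<^sup>*" for x
      by (auto simp: transpose_def edges_def)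
    then show ?thesis using tr st by simp
  qed
  have gen: "g permutes X \<and> (\<forall>x\<in>X. (x, g x) \<in> (edges ps)\<^sup>*)" if "g \<in> generate ?G ?H" for g
    using that
  proof induction
    case one then show ?case by (simp add: sym_group_one permutes_id[unfolded id_def])
  next
    case (incl h) then show ?case by (rule H)
  next
    case (inv h)
    then have h: "h permutes X" "\<forall>x\<in>X. (x, h x) \<in> (edges ps)\<^sup>*" using H by blast+
    have "inv\<^bsub>?G\<^esub> h = Hilbert_Choice.inv h"
      using h(1) by (intro sym_group_inv_equality) (simp add: sym_group_carrier X_def)
    moreover have "Hilbert_Choice.inv h permutes X" using h(1) by (rule permutes_inv)
    moreover have "(x, Hilbert_Choice.inv h x) \<in> (edges ps)\<^sup>*" if "x \<in> X" for x
    proof -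
      have "Hilbert_Choice.inv h x \<in> X" using permutes_in_image[OF permutes_inv[OF h(1)]] that by simp
      then have "(Hilbert_Choice.inv h x, h (Hilbert_Choice.inv h x)) \<in> (edges ps)\<^sup>*" using h(2) by blast
      then show ?thesis using edges_rtrancl_sym permutes_inverses(1)[OF h(1)] by metis
    qed
    ultimately show ?case by simp
  next
    case (eng g h)
    have "(x, (g \<circ> h) x) \<in> (edges ps)\<^sup>*" if "x \<in> X" for x
      using that eng.IH permutes_in_image[of h X x] by (simp, meson rtrancl_trans)
    moreover have "g \<circ> h permutes X" using eng.IH by (blast intro: permutes_compose)
    ultimately show ?case unfolding sym_group_mult by blast
  qed
  show "conn X ps" if t: "transitive_on X (generate ?G ?H)"
    unfolding conn_def
  proof (intro ballI)
    fix x y assume "x \<in> X" "y \<in> X"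
    then obtain g where "g \<in> generate ?G ?H" "g x = y"
      using t unfolding transitive_on_def by metis
    then show "(x, y) \<in> (edges ps)\<^sup>*" using gen[of g] \<open>x \<in> X\<close> by metis
  qed
  show "transitive_on X (generate ?G ?H)" if c: "conn X ps"
    unfolding transitive_on_def
  proof (intro ballI)
    fix x y assume "x \<in> X" "y \<in> X"
    then have "(x, y) \<in> (edges ps)\<^sup>*" using c by (simp add: conn_def)
    then show "\<exists>g\<in>generate ?G ?H. g x = y"
    proof induction
      case base
      have "id \<in> generate ?G ?H" using generate.one[of ?G ?H] by (simp add: sym_group_one)
      then show ?case by (metis id_apply)
    next
      case (step y z)
      then obtain g where g: "g \<in> generate ?G ?H" "g x = y" by blast
      obtain s t where st: "(s, t) \<in> set ps" "y = s \<and> z = t \<or> y = t \<and> z = s"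
        using step.hyps(2) by (auto simp: edges_def)
      then have "transpose s t \<in> ?H" by force
      then have "transpose s t \<in> generate ?G ?H" by (rule generate.incl)
      then have "transpose s t \<circ> g \<in> generate ?G ?H"
        using generate.eng[of _ ?G ?H g] g(1) by (simp add: sym_group_mult)
      moreover have "(transpose s t \<circ> g) x = z" using g(2) st(2) by auto
      ultimately show ?case by blast
    qed
  qed
qed

lemma swaps_eq: "foldr (\<circ>) (map (\<lambda>(s, t). transpose s t) ps) id = swaps ps"
  by (induction ps) auto

lemma monotone_transpositions_iff:
  "monotone_transpositions d ts \<longleftrightarrow> (\<exists>ps\<in>mono_seqs (length ts) {1..d}. ts = map (\<lambda>(s, t). transpose s t) ps)"
proof
  assume "monotone_transpositions d ts"
  then obtain ss us where l: "length ss = length ts" "length us = length ts"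
    and i: "\<And>i. i < length ts \<Longrightarrow> ss ! i \<in> {1..d} \<and> us ! i \<in> {1..d} \<and> ss ! i < us ! i \<and> ts ! i = transpose (ss ! i) (us ! i)"
    and s: "sorted us" unfolding monotone_transpositions_def by blast
  have "zip ss us \<in> mono_seqs (length ts) {1..d}"
    unfolding mono_seqs_def using l i s by (auto simp: in_set_zip)
  moreover have "ts = map (\<lambda>(s, t). transpose s t) (zip ss us)"
    using l i by (intro nth_equalityI) auto
  ultimately show "\<exists>ps\<in>mono_seqs (length ts) {1..d}. ts = map (\<lambda>(s, t). transpose s t) ps" by blast
next
  assume "\<exists>ps\<in>mono_seqs (length ts) {1..d}. ts = map (\<lambda>(s, t). transpose s t) ps"
  then obtain ps where ps: "ps \<in> mono_seqs (length ts) {1..d}" "ts = map (\<lambda>(s, t). transpose s t) ps" by blast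
  have "fst (ps ! i) \<in> {1..d} \<and> snd (ps ! i) \<in> {1..d} \<and> fst (ps ! i) < snd (ps ! i)" if "i < length ps" for i
    using ps(1) nth_mem[OF that] unfolding mono_seqs_def by (auto simp: case_prod_beta)
  then show "monotone_transpositions d ts"
    unfolding monotone_transpositions_def using ps
    by (intro exI[of _ "map fst ps"] exI[of _ "map snd ps"]) (auto simp: mono_seqs_def case_prod_beta)
qed

lemma transpose_inject:
  assumes "transpose s t = transpose u v" "s < t" "u < (v :: nat)"
  shows "(s, t) = (u, v)"
proof -
  have "transpose u v s = t" "transpose u v t = s" using assms(1) by (metis transpose_apply_first transpose_apply_second)+
  then show ?thesis using assms(2,3) by (auto simp: transpose_def split: if_splits)
qed

lemma inj_map_transpose: "inj_on (map (\<lambda>(s, t). transpose s t)) (mono_seqs r X)"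
proof (rule inj_onI)
  fix ps qs
  assume "ps \<in> mono_seqs r X" "qs \<in> mono_seqs r X"
    "map (\<lambda>(s, t). transpose s t) ps = map (\<lambda>(s, t). transpose s t) qs"
  then show "ps = qs"
  proof (induction ps arbitrary: qs r)
    case (Cons p ps)
    obtain s t where p: "p = (s, t)" by fastforce
    obtain q qs' where q: "qs = q # qs'" using Cons.prems(3) by (cases qs) auto
    obtain u v where q': "q = (u, v)" by fastforce
    have "(s, t) = (u, v)"
      using Cons.prems p q q' by (intro transpose_inject) (auto simp: mono_seqs_def)
    moreover have "ps = qs'"
      using Cons.prems q by (intro Cons.IH[of "length ps" qs']) (auto simp: mono_seqs_def dest: map_eq_imp_length_eq)
    ultimately show ?case using p q q' by simp
  qed auto
qed

lemma monotone_hurwitz_facts: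
  assumes d: "d = sum_list \<alpha>"
  shows "monotone_hurwitz g \<alpha> = (\<Sum>f | f permutes {1..d}.
    if ctype {1..d} f = mset \<alpha> then card (facts (2 * g + length \<alpha> + d - 2) {1..d} f) else 0)"
proof -
  let ?X = "{1..d}" and ?r = "2 * g + length \<alpha> + d - 2"
  let ?m = "map (\<lambda>(s, t). transpose s t)"
  define P where "P = {f. f permutes ?X \<and> ctype ?X f = mset \<alpha>}"
  have finP: "finite P" unfolding P_def using finite_permutations[of ?X] by auto
  have ct: "cycle_type d f = ctype ?X f" for f
    by (simp add: cycle_type_def ctype_def parts_def cycles_def)
  have id_iff: "f \<circ> swaps ps = id \<longleftrightarrow> (\<forall>x\<in>?X. f (swaps ps x) = x)" if "f permutes ?X" "ps \<in> mono_seqs ?r ?X" for f ps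
  proof
    assume *: "\<forall>x\<in>?X. f (swaps ps x) = x"
    show "f \<circ> swaps ps = id"
    proof
      fix x show "(f \<circ> swaps ps) x = id x"
      proof (cases "x \<in> ?X")
        case False
        then have "swaps ps x = x" "f x = x"
          using permutes_not_in[OF swaps_permutes[OF that(2)] False] permutes_not_in[OF that(1) False] by auto
        then show ?thesis by simp
      qed (use * in simp)
    qed
  qed (simp add: fun_eq_iff)
  have "monotone_factorizations g \<alpha> = (\<Union>f\<in>P. (\<lambda>ps. (f, ?m ps)) ` facts ?r ?X f)"
  proof (intro equalityI subsetI)
    fix z assume z: "z \<in> monotone_factorizations g \<alpha>"
    obtain f ts where z': "z = (f, ts)" by fastforce
    have f: "f permutes ?X" "ctype ?X f = mset \<alpha>" and ts: "length ts = ?r" "monotone_transpositions d ts"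
      "f \<circ> foldr (\<circ>) ts id = id" "transitive_on ?X (generate (sym_group d) (insert f (set ts)))"
      using z unfolding z' monotone_factorizations_def by (auto simp: Let_def d[symmetric] ct)
    obtain ps where ps: "ps \<in> mono_seqs ?r ?X" "ts = ?m ps"
      using ts(1,2) monotone_transpositions_iff by auto
    have fs: "\<forall>x\<in>?X. f (swaps ps x) = x" using ts(3) id_iff[OF f(1) ps(1)] unfolding ps(2) swaps_eq by blast
    have "conn ?X ps" using ts(4) transitive_iff_conn[OF f(1) ps(1) fs] unfolding ps(2) by blast
    then have "ps \<in> facts ?r ?X f" using ps(1) fs by (simp add: facts_def)
    then show "z \<in> (\<Union>f\<in>P. (\<lambda>ps. (f, ?m ps)) ` facts ?r ?X f)"
      using f ps(2) by (auto simp: z' P_def)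
  next
    fix z assume "z \<in> (\<Union>f\<in>P. (\<lambda>ps. (f, ?m ps)) ` facts ?r ?X f)"
    then obtain f ps where f: "f permutes ?X" "ctype ?X f = mset \<alpha>" and ps: "ps \<in> mono_seqs ?r ?X"
      and fs: "\<forall>x\<in>?X. f (swaps ps x) = x" and c: "conn ?X ps" and z: "z = (f, ?m ps)"
      by (auto simp: P_def facts_def)
    have len: "length (?m ps) = ?r" using ps by (simp add: mono_seqs_def)
    have "monotone_transpositions d (?m ps)"
      unfolding monotone_transpositions_iff len using ps by blast
    moreover have "f \<circ> foldr (\<circ>) (?m ps) id = id" unfolding swaps_eq using id_iff[OF f(1) ps] fs by blast
    moreover have "transitive_on ?X (generate (sym_group d) (insert f (set (?m ps))))"
      using transitive_iff_conn[OF f(1) ps fs] c by blast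
    ultimately show "z \<in> monotone_factorizations g \<alpha>"
      unfolding z monotone_factorizations_def using f len by (simp add: Let_def d[symmetric] ct del: set_map)
  qed
  then have "monotone_hurwitz g \<alpha> = card (\<Union>f\<in>P. (\<lambda>ps. (f, ?m ps)) ` facts ?r ?X f)"
    by (simp add: monotone_hurwitz_def)
  also have "\<dots> = (\<Sum>f\<in>P. card ((\<lambda>ps. (f, ?m ps)) ` facts ?r ?X f))"
    using finP finite_facts[of ?X] by (intro card_UN_disjoint) auto
  also have "\<dots> = (\<Sum>f\<in>P. card (facts ?r ?X f))"
  proof (intro sum.cong refl card_image)
    fix f
    show "inj_on (\<lambda>ps. (f, ?m ps)) (facts ?r ?X f)"
      using inj_map_transpose[of ?r ?X] by (auto simp: inj_on_def facts_def)
  qed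
  also have "\<dots> = (\<Sum>f | f permutes ?X. if ctype ?X f = mset \<alpha> then card (facts ?r ?X f) else 0)"
    unfolding P_def using finite_permutations[of ?X]
    by (simp add: sum.inter_filter[symmetric] Collect_conj_eq)
  finally show ?thesis .
qed

lemma prod_mset_nth: "(\<Prod>m\<in>#mset xs. f m) = (\<Prod>i<length xs. f (xs ! i))"
  unfolding mset_map[symmetric] prod_mset_prod_list prod.list_conv_set_nth
  by (simp add: atLeast0LessThan)

text \<open>The product is expanded over positions, not values, so that equal parts remain distinct
  variables.\<close>

lemma mesym_eq_elem_sym: "mesym (mset \<alpha>) k = elem_sym k (map (\<lambda>a. 2 * real a + 1) \<alpha>)"
proof -
  let ?n = "length \<alpha>" and ?x = "\<lambda>i. 2 * real (\<alpha> ! i) + 1"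
  have "(\<Prod>m\<in>#mset \<alpha>. [:1, 2 * real m + 1:]) = (\<Prod>i<?n. [:1, ?x i:])"
    by (rule prod_mset_nth)
  also have "\<dots> = (\<Prod>i<?n. monom (?x i) 1 + 1)"
    by (intro prod.cong refl) (simp add: monom_altdef one_pCons)
  also have "\<dots> = (\<Sum>S\<in>Pow {..<?n}. \<Prod>i\<in>S. monom (?x i) 1)"
    by (subst prod_add) auto
  also have "\<dots> = (\<Sum>S\<in>Pow {..<?n}. monom (\<Prod>i\<in>S. ?x i) (card S))"
  proof (intro sum.cong refl)
    fix S assume "S \<in> Pow {..<?n}"
    then have "finite S" using finite_subset by auto
    then show "(\<Prod>i\<in>S. monom (?x i) 1) = monom (\<Prod>i\<in>S. ?x i) (card S)"
      by induction (auto simp: mult_monom one_poly_eq_simps monom_0 one_pCons)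
  qed
  finally have "mesym (mset \<alpha>) k = (\<Sum>S\<in>Pow {..<?n}. if card S = k then \<Prod>i\<in>S. ?x i else 0)"
    unfolding mesym_def by (simp add: coeff_sum)
  also have "\<dots> = (\<Sum>S | S \<subseteq> {..<?n} \<and> card S = k. \<Prod>i\<in>S. ?x i)"
    by (subst sum.inter_filter[symmetric]) (auto intro!: sum.cong)
  also have "\<dots> = elem_sym k (map (\<lambda>a. 2 * real a + 1) \<alpha>)"
    unfolding elem_sym_def by (intro sum.cong prod.cong) auto
  finally show ?thesis .
qed

theorem theorem0p4:
  fixes d :: nat and \<alpha> :: "nat list"
  assumes "d \<ge> 1" and "is_partition d \<alpha>"
  shows "real (aut_size \<alpha>) / fact d * real (monotone_hurwitz 1 \<alpha>) =
    1 / 24 * (\<Prod>i<length \<alpha>. real ((2 * \<alpha> ! i) choose (\<alpha> ! i))) *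
      (pochhammer (2 * real d + 1) (length \<alpha>)
       - 3 * pochhammer (2 * real d + 1) (length \<alpha> - 1)
       - (\<Sum>k = 2..length \<alpha>. fact (k - 2) * pochhammer (2 * real d + 1) (length \<alpha> - k) *
            elem_sym k (map (\<lambda>a. 2 * real a + 1) \<alpha>)))"
proof -
  let ?X = "{1..d}" and ?M = "mset \<alpha>"
  have d: "d = sum_list \<alpha>" and pos: "0 \<notin># ?M" using assms(2) by (auto simp: is_partition_def)
  have degM: "deg ?M = 2 * 1 + length \<alpha> + d - 2" by (simp add: deg_def d sum_mset_sum_list)
  have "real (card (facts (2 * 1 + length \<alpha> + d - 2) ?X f)) = F1 ?M" if f: "f permutes ?X" "ctype ?X f = ?M" for f
  proof -
    have "perm_on ?X f" using f(1) by (intro perm_on_permutes) auto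
    then have "real (card (facts (deg ?M) ?X f)) = \<Phi> (deg ?M) ?M"
      using card_facts[of ?X f "deg ?M"] assms(1) f(2) by simp
    then show ?thesis unfolding degM[symmetric] by (simp add: \<Phi>_def)
  qed
  then have "real (monotone_hurwitz 1 \<alpha>) = (\<Sum>f | f permutes ?X. if ctype ?X f = ?M then F1 ?M else 0)"
    unfolding monotone_hurwitz_facts[OF d] of_nat_sum by (intro sum.cong refl) simp
  also have "\<dots> = real (num_perms ?X ?M) * F1 ?M"
    unfolding num_perms_def of_nat_sum sum_distrib_right by (intro sum.cong refl) simp
  finally have hur: "real (monotone_hurwitz 1 \<alpha>) = real (num_perms ?X ?M) * F1 ?M" .
  have z: "zsize ?M = prod_list \<alpha> * aut_size \<alpha>"
    by (simp add: zsize_def aut_size_def prod_mset_prod_list count_mset)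
  have "num_perms ?X ?M * zsize ?M = fact d"
    using num_perms[of ?X ?M] pos by (simp add: sum_mset_sum_list d[symmetric])
  then have "real (num_perms ?X ?M) * (real (prod_list \<alpha>) * real (aut_size \<alpha>)) = fact d"
    unfolding z by (metis of_nat_fact of_nat_mult)
  moreover have "weight ?M = real (prod_list \<alpha>) * (\<Prod>i<length \<alpha>. real ((2 * \<alpha> ! i) choose (\<alpha> ! i)))"
    unfolding weight_def prod_mset_nth
    by (simp add: wt_def cbin_def prod.list_conv_set_nth atLeast0LessThan prod.distrib)
  moreover have "real (prod_list \<alpha>) \<noteq> 0" using pos by (simp add: prod_list_zero_iff)
  moreover have "fact d \<noteq> (0 :: real)" by simp
  \<comment> \<open>The size of the conjugacy class cancels \<open>fact d\<close> and
    \<open>aut_size \<alpha>\<close> and leaves the product of the parts as a denominator, which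
    turns each weight into a central binomial coefficient.\<close>
  ultimately have "real (aut_size \<alpha>) / fact d * real (monotone_hurwitz 1 \<alpha>)
    = 1 / 24 * (\<Prod>i<length \<alpha>. real ((2 * \<alpha> ! i) choose (\<alpha> ! i))) * torus (2 * real d + 1) (length \<alpha>) (mesym ?M)"
    unfolding hur F1_def by (simp add: sum_mset_sum_list d[symmetric] field_simps)
  then show ?thesis unfolding torus_def mesym_eq_elem_sym .
qed

end
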